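(* Let $E$, $H$, $i_H$, $\mu$, $\mathscr{L}$, $\nabla_H$ be as in the context, assume (A1) and (A3), and suppose $\mathscr{L}$ is self-adjoint on $L^2(E,\mu)$. Then the unitary group $(e^{it\mathscr{D}})_{t\in\mathbb{R}}$ on $L^2(E,\mu)\oplus L^2(E,\mu;H)$ generated by $i\mathscr{D}$, where $\mathscr{D}=\begin{bmatrix}0&\nabla_H^*\\ \nabla_H&0\end{bmatrix}$, has speed of propagation $\|i_H\|_{\mathcal{L}(H,E)}$.
   Context: Let $E$ be a real Banach space and $H$ a real Hilbert space continuously embedded in $E$ by a bounded injective operator $i_H:H\to E$; identify $H$ with its dual and put $Q_H=i_H i_H^*$. Let $(S(t))_{t\ge 0}$ be a $C_0$-semigroup on $E$ with generator $A$. (A1): there exists a centred Gaussian Radon measure $\mu$ on $E$ whose covariance operator $Q_\mu:E^*\to E$ satisfies $\langle Q_\mu x^*,y^*\rangle=\int_0^\infty\langle Q_H S(s)^*x^*,S(s)^*y^*\rangle\,ds$ for all $x^*,y^*\in E^*$, the integrals being convergent. The Ornstein–Uhlenbeck semigroup is $P(t)f(x)=\mathbb{E}\,f(U(t,x))$, where $U(\cdot,x)$ solves $dU(t)=AU(t)\,dt+i_H\,dW_H(t)$, $U(0)=x$, with $W_H$ an $H$-cylindrical Brownian motion; $\mu$ is invariant and $P$ extends to a $C_0$-contraction semigroup on $L^2(E,\mu)$ (complex-valued functions) with generator $\mathscr{L}$. The reproducing kernel Hilbert space $H_\mu$ of $\mu$ is the completion of $\mathsf{R}(Q_\mu)$ with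 respect to $\|Q_\mu x^*\|_{H_\mu}^2=\langle Q_\mu x^*,x^*\rangle$; it embeds continuously into $E$. (A3): $H_\mu$ is densely contained in $H$ (as subspaces of $E$). $\nabla_H$ is the closure in $L^2(E,\mu)\to L^2(E,\mu;H)$ of the gradient $\nabla_Hf(x)=\sum_{j}\partial_j\phi(\langle x,x_1^*\rangle,\dots,\langle x,x_n^*\rangle)\,i_H^*x_j^*$ on $C^1_b$-cylindrical functions $f(x)=\phi(\langle x,x_1^*\rangle,\dots,\langle x,x_n^*\rangle)$; $\nabla_H^*$ is its adjoint; $\mathscr{D}$ is self-adjoint on $L^2(E,\mu)\oplus L^2(E,\mu;H)\cong L^2(E,\mu;\mathbb{C}\oplus H)$, supports of elements being taken in the latter space. A family $(T_t)_{t\in\mathbb{R}}$ of bounded operators on $L^2(E,\mu;\mathscr{H})$ has speed of propagation $\kappa$ if for all closed $K\subseteq E$, all $u$ and all $t$, $\operatorname{supp}(u)\subseteq K$ implies $\operatorname{supp}(T_tu)\subseteq\{x\in E:\operatorname{dist}(x,K)\le\kappa|t|\}$, where $\operatorname{dist}$ uses the norm of $E$. *)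

theory Defs
  imports "HOL-Analysis.Analysis" "HOL-Probability.Probability"
begin

section \<open>Complexification of the real Hilbert space H, represented as pairs (re, im)\<close>

definition scaleHC :: "complex \<Rightarrow> ('h::real_inner \<times> 'h) \<Rightarrow> 'h \<times> 'h" where
  "scaleHC c p = (Re c *\<^sub>R fst p - Im c *\<^sub>R snd p, Im c *\<^sub>R fst p + Re c *\<^sub>R snd p)"

text \<open>complex inner product on H_C, linear in the first, conjugate linear in the second argument\<close>
definition cinnerH :: "('h::real_inner \<times> 'h) \<Rightarrow> ('h \<times> 'h) \<Rightarrow> complex" where
  "cinnerH p q = Complex (inner (fst p) (fst q) + inner (snd p) (snd q))
                         (inner (snd p) (fst q) - inner (fst p) (snd q))"

definition scaleV :: "complex \<Rightarrow> complex \<times> ('h::real_inner \<times> 'h) \<Rightarrow> complex \<times> ('h \<times> 'h)" where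
  "scaleV c v = (c * fst v, scaleHC c (snd v))"

definition iV :: "complex \<times> ('h::real_inner \<times> 'h) \<Rightarrow> complex \<times> ('h \<times> 'h)" where
  "iV v = scaleV \<i> v"

definition hadj :: "('h::real_inner \<Rightarrow> 'e::real_normed_vector) \<Rightarrow> ('e \<Rightarrow> real) \<Rightarrow> 'h" where
  "hadj iH xs = (THE h. \<forall>k. inner h k = xs (iH k))"

definition C0_semigroup :: "(real \<Rightarrow> 'e::real_normed_vector \<Rightarrow> 'e) \<Rightarrow> bool" where
  "C0_semigroup S \<longleftrightarrow>
     (\<forall>t\<ge>0. bounded_linear (S t)) \<and> S 0 = id \<and>
     (\<forall>s\<ge>0. \<forall>t\<ge>0. S (s + t) = S s \<circ> S t) \<and>
     (\<forall>x. ((\<lambda>t. S t x) \<longlongrightarrow> x) (at_right 0))"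

definition radon_measure :: "'e::topological_space measure \<Rightarrow> bool" where
  "radon_measure \<mu> \<longleftrightarrow>
     (\<forall>B\<in>sets \<mu>. emeasure \<mu> B = (SUP K\<in>{K. compact K \<and> K \<subseteq> B}. emeasure \<mu> K))"

definition centred_gaussian :: "'e::real_normed_vector measure \<Rightarrow> bool" where
  "centred_gaussian \<mu> \<longleftrightarrow> prob_space \<mu> \<and> sets \<mu> = sets borel \<and>
     (\<forall>xs. bounded_linear xs \<longrightarrow>
        (\<exists>\<sigma>\<ge>0. distr \<mu> lborel xs =
            (if \<sigma> = 0 then return lborel 0 else density lborel (normal_density 0 \<sigma>))))"

definition Qcov :: "'e::real_normed_vector measure \<Rightarrow> ('e \<Rightarrow> real) \<Rightarrow> 'e" where
  "Qcov \<mu> xs = (THE h. \<forall>ys. bounded_linear ys \<longrightarrow> ys h = (LINT x|\<mu>. xs x * ys x))"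

text \<open>integrand  s |-> < Q_H S(s)^* x^*, S(s)^* y^* >\<close>
definition covint :: "('h::real_inner \<Rightarrow> 'e::real_normed_vector) \<Rightarrow> (real \<Rightarrow> 'e \<Rightarrow> 'e)
                      \<Rightarrow> ('e \<Rightarrow> real) \<Rightarrow> ('e \<Rightarrow> real) \<Rightarrow> real \<Rightarrow> real" where
  "covint iH S xs ys s = inner (hadj iH (xs \<circ> S s)) (hadj iH (ys \<circ> S s))"

definition A1 :: "('h::real_inner \<Rightarrow> 'e::real_normed_vector) \<Rightarrow> (real \<Rightarrow> 'e \<Rightarrow> 'e) \<Rightarrow> 'e measure \<Rightarrow> bool" where
  "A1 iH S \<mu> \<longleftrightarrow> centred_gaussian \<mu> \<and> radon_measure \<mu> \<and>
     (\<forall>xs ys. bounded_linear xs \<longrightarrow> bounded_linear ys \<longrightarrow>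
        set_integrable lborel {0..} (covint iH S xs ys) \<and>
        xs (Qcov \<mu> ys) = (LBINT s:{0..}. covint iH S xs ys s))"

text \<open>Reproducing kernel Hilbert space H_mu, as a subset of E: the image in E of the completion
  of the range of Q_mu w.r.t. ||Q_mu x^*||^2 = <Q_mu x^*, x^*>\<close>
definition rkhs :: "'e::real_normed_vector measure \<Rightarrow> 'e set" where
  "rkhs \<mu> = {h. \<exists>X. (\<forall>n. bounded_linear (X n)) \<and> (\<lambda>n. Qcov \<mu> (X n)) \<longlonglongrightarrow> h \<and>
      (\<forall>\<epsilon>>0. \<exists>N. \<forall>m\<ge>N. \<forall>n\<ge>N.
         (X m - X n) (Qcov \<mu> (X m - X n)) < \<epsilon>)}"

definition A3 :: "('h::real_inner \<Rightarrow> 'e::real_normed_vector) \<Rightarrow> 'e measure \<Rightarrow> bool" where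
  "A3 iH \<mu> \<longleftrightarrow> rkhs \<mu> \<subseteq> range iH \<and> closure (iH -` rkhs \<mu>) = UNIV"

section \<open>L^2 spaces (functions, modulo a.e. equality where relevant)\<close>

definition L2 :: "'e measure \<Rightarrow> ('e \<Rightarrow> 'v::real_normed_vector) set" where
  "L2 \<mu> = {f. f \<in> borel_measurable \<mu> \<and> integrable \<mu> (\<lambda>x. (norm (f x))\<^sup>2)}"

definition l2norm :: "'e measure \<Rightarrow> ('e \<Rightarrow> 'v::real_normed_vector) \<Rightarrow> real" where
  "l2norm \<mu> f = sqrt (LINT x|\<mu>. (norm (f x))\<^sup>2)"

definition l2lim :: "'e measure \<Rightarrow> (nat \<Rightarrow> 'e \<Rightarrow> 'v::real_normed_vector) \<Rightarrow> ('e \<Rightarrow> 'v) \<Rightarrow> bool" where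
  "l2lim \<mu> F f \<longleftrightarrow> (\<lambda>k. l2norm \<mu> (\<lambda>x. F k x - f x)) \<longlonglongrightarrow> 0"

definition ae_eq :: "'e measure \<Rightarrow> ('e \<Rightarrow> 'v) \<Rightarrow> ('e \<Rightarrow> 'v) \<Rightarrow> bool" where
  "ae_eq \<mu> u v \<longleftrightarrow> (AE x in \<mu>. u x = v x)"

definition l2supp :: "'e::topological_space measure \<Rightarrow> ('e \<Rightarrow> 'v::zero) \<Rightarrow> 'e set" where
  "l2supp \<mu> u = - \<Union>{V. open V \<and> (AE x in \<mu>. x \<in> V \<longrightarrow> u x = 0)}"

text \<open>mu_t: centred Gaussian Radon measure with covariance Q_t = int_0^t S(s) Q_H S(s)^* ds;
  it is the law of the stochastic convolution int_0^t S(t-s) i_H dW_H(s)\<close>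
definition mu_t :: "('h::real_inner \<Rightarrow> 'e::real_normed_vector) \<Rightarrow> (real \<Rightarrow> 'e \<Rightarrow> 'e) \<Rightarrow> real \<Rightarrow> 'e measure" where
  "mu_t iH S t = (THE \<nu>. centred_gaussian \<nu> \<and> radon_measure \<nu> \<and>
      (\<forall>xs ys. bounded_linear xs \<longrightarrow> bounded_linear ys \<longrightarrow>
         (LINT x|\<nu>. xs x * ys x) = (LBINT s:{0..t}. covint iH S xs ys s)))"

text \<open>P(t) f (x) = E f(U(t,x)),  U(t,x) = S(t)x + int_0^t S(t-s) i_H dW_H(s)\<close>
definition OU :: "('h::real_inner \<Rightarrow> 'e::real_normed_vector) \<Rightarrow> (real \<Rightarrow> 'e \<Rightarrow> 'e) \<Rightarrow> real
                   \<Rightarrow> ('e \<Rightarrow> complex) \<Rightarrow> ('e \<Rightarrow> complex)" where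
  "OU iH S t f x = (LINT y|mu_t iH S t. f (S t x + y))"

definition OUgen :: "('h::real_inner \<Rightarrow> 'e::real_normed_vector) \<Rightarrow> (real \<Rightarrow> 'e \<Rightarrow> 'e) \<Rightarrow> 'e measure
                     \<Rightarrow> (('e \<Rightarrow> complex) \<times> ('e \<Rightarrow> complex)) set" where
  "OUgen iH S \<mu> = {(f, g). f \<in> L2 \<mu> \<and> g \<in> L2 \<mu> \<and>
      ((\<lambda>t. l2norm \<mu> (\<lambda>x. (OU iH S t f x - f x) / complex_of_real t - g x)) \<longlongrightarrow> 0) (at_right 0)}"

definition l2adj :: "'e measure \<Rightarrow> (('e \<Rightarrow> complex) \<times> ('e \<Rightarrow> complex)) set
                     \<Rightarrow> (('e \<Rightarrow> complex) \<times> ('e \<Rightarrow> complex)) set" where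
  "l2adj \<mu> T = {(g, h). g \<in> L2 \<mu> \<and> h \<in> L2 \<mu> \<and>
      (\<forall>(f, k)\<in>T. (LINT x|\<mu>. k x * cnj (g x)) = (LINT x|\<mu>. f x * cnj (h x)))}"

definition OU_selfadjoint :: "('h::real_inner \<Rightarrow> 'e::real_normed_vector) \<Rightarrow> (real \<Rightarrow> 'e \<Rightarrow> 'e) \<Rightarrow> 'e measure \<Rightarrow> bool" where
  "OU_selfadjoint iH S \<mu> \<longleftrightarrow> OUgen iH S \<mu> = l2adj \<mu> (OUgen iH S \<mu>)"

definition cyl :: "nat \<Rightarrow> (nat \<Rightarrow> 'e \<Rightarrow> real) \<Rightarrow> 'e \<Rightarrow> (nat \<Rightarrow> real)" where
  "cyl n xs x = (\<lambda>j. if j < n then xs j x else 0)"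

definition pd :: "((nat \<Rightarrow> real) \<Rightarrow> complex) \<Rightarrow> nat \<Rightarrow> (nat \<Rightarrow> real) \<Rightarrow> complex" where
  "pd \<phi> j y = vector_derivative (\<lambda>s. \<phi> (y(j := s))) (at (y j))"

definition C1b :: "nat \<Rightarrow> ((nat \<Rightarrow> real) \<Rightarrow> complex) \<Rightarrow> bool" where
  "C1b n \<phi> \<longleftrightarrow> (\<forall>y. \<phi> y = \<phi> (\<lambda>j. if j < n then y j else 0)) \<and> bounded (range \<phi>) \<and>
     (\<forall>j<n. (\<forall>y. (\<lambda>s. \<phi> (y(j := s))) differentiable (at (y j))) \<and>
            continuous_on UNIV (pd \<phi> j) \<and> bounded (range (pd \<phi> j)))"

definition grad0 :: "('h::real_inner \<Rightarrow> 'e::real_normed_vector)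
                     \<Rightarrow> (('e \<Rightarrow> complex) \<times> ('e \<Rightarrow> 'h \<times> 'h)) set" where
  "grad0 iH = {(f, g). \<exists>n xs \<phi>. C1b n \<phi> \<and> (\<forall>j<n. bounded_linear (xs j)) \<and>
      f = (\<lambda>x. \<phi> (cyl n xs x)) \<and>
      g = (\<lambda>x. \<Sum>j<n. scaleHC (pd \<phi> j (cyl n xs x)) (hadj iH (xs j), 0))}"

definition gradH :: "('h::real_inner \<Rightarrow> 'e::real_normed_vector) \<Rightarrow> 'e measure
                     \<Rightarrow> (('e \<Rightarrow> complex) \<times> ('e \<Rightarrow> 'h \<times> 'h)) set" where
  "gradH iH \<mu> = {(f, g). f \<in> L2 \<mu> \<and> g \<in> L2 \<mu> \<and>
      (\<exists>F G. (\<forall>k. (F k, G k) \<in> grad0 iH) \<and> l2lim \<mu> F f \<and> l2lim \<mu> G g)}"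

definition gradH_adj :: "('h::real_inner \<Rightarrow> 'e::real_normed_vector) \<Rightarrow> 'e measure
                     \<Rightarrow> (('e \<Rightarrow> 'h \<times> 'h) \<times> ('e \<Rightarrow> complex)) set" where
  "gradH_adj iH \<mu> = {(g, h). g \<in> L2 \<mu> \<and> h \<in> L2 \<mu> \<and>
      (\<forall>(f, k)\<in>gradH iH \<mu>. (LINT x|\<mu>. cinnerH (k x) (g x)) = (LINT x|\<mu>. f x * cnj (h x)))}"

text \<open>D = [[0, nabla^*],[nabla, 0]] on L^2(E,mu) (+) L^2(E,mu;H) = L^2(E,mu; C (+) H)\<close>
definition Dirac :: "('h::real_inner \<Rightarrow> 'e::real_normed_vector) \<Rightarrow> 'e measure
        \<Rightarrow> (('e \<Rightarrow> complex \<times> ('h \<times> 'h)) \<times> ('e \<Rightarrow> complex \<times> ('h \<times> 'h))) set" where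
  "Dirac iH \<mu> = {(u, d). (\<lambda>x. snd (u x), \<lambda>x. fst (d x)) \<in> gradH_adj iH \<mu> \<and>
                        (\<lambda>x. fst (u x), \<lambda>x. snd (d x)) \<in> gradH iH \<mu>}"

definition unitary_group_generated_by :: "'e measure
     \<Rightarrow> (('e \<Rightarrow> complex \<times> ('h::real_inner \<times> 'h)) \<times> ('e \<Rightarrow> complex \<times> ('h \<times> 'h))) set
     \<Rightarrow> (real \<Rightarrow> ('e \<Rightarrow> complex \<times> ('h \<times> 'h)) \<Rightarrow> ('e \<Rightarrow> complex \<times> ('h \<times> 'h))) \<Rightarrow> bool" where
  "unitary_group_generated_by \<mu> D U \<longleftrightarrow>
     (\<forall>t u. u \<in> L2 \<mu> \<longrightarrow> U t u \<in> L2 \<mu>) \<and>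
     (\<forall>t u v. u \<in> L2 \<mu> \<longrightarrow> v \<in> L2 \<mu> \<longrightarrow> ae_eq \<mu> u v \<longrightarrow> ae_eq \<mu> (U t u) (U t v)) \<and>
     (\<forall>t u v. u \<in> L2 \<mu> \<longrightarrow> v \<in> L2 \<mu> \<longrightarrow>
        ae_eq \<mu> (U t (\<lambda>x. u x + v x)) (\<lambda>x. U t u x + U t v x)) \<and>
     (\<forall>t u c. u \<in> L2 \<mu> \<longrightarrow> ae_eq \<mu> (U t (\<lambda>x. scaleV c (u x))) (\<lambda>x. scaleV c (U t u x))) \<and>
     (\<forall>t u. u \<in> L2 \<mu> \<longrightarrow> l2norm \<mu> (U t u) = l2norm \<mu> u) \<and>
     (\<forall>u. u \<in> L2 \<mu> \<longrightarrow> ae_eq \<mu> (U 0 u) u) \<and>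
     (\<forall>s t u. u \<in> L2 \<mu> \<longrightarrow> ae_eq \<mu> (U (s + t) u) (U s (U t u))) \<and>
     (\<forall>u t0. u \<in> L2 \<mu> \<longrightarrow> ((\<lambda>t. l2norm \<mu> (\<lambda>x. U t u x - U t0 u x)) \<longlongrightarrow> 0) (at t0)) \<and>
     (\<forall>u w. u \<in> L2 \<mu> \<longrightarrow> w \<in> L2 \<mu> \<longrightarrow>
        (((\<lambda>t. l2norm \<mu> (\<lambda>x. (1 / t) *\<^sub>R (U t u x - u x) - w x)) \<longlongrightarrow> 0) (at 0)
         \<longleftrightarrow> (\<exists>d. (u, d) \<in> D \<and> ae_eq \<mu> w (\<lambda>x. iV (d x)))))"

definition speed_of_propagation :: "'e::metric_space measure \<Rightarrow> (real \<Rightarrow> ('e \<Rightarrow> 'v::real_normed_vector) \<Rightarrow> ('e \<Rightarrow> 'v))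
                                     \<Rightarrow> real \<Rightarrow> bool" where
  "speed_of_propagation \<mu> T \<kappa> \<longleftrightarrow>
     (\<forall>K u t. closed K \<longrightarrow> u \<in> L2 \<mu> \<longrightarrow> l2supp \<mu> u \<subseteq> K \<longrightarrow>
        l2supp \<mu> (T t u) \<subseteq> {x. infdist x K \<le> \<kappa> * \<bar>t\<bar>})"

end

theory Submission
  imports Defs
begin

text \<open>For a functional \<open>l\<close> of norm at most one and a bounded \<open>C\<^sup>1\<close> function \<open>g\<close> with \<open>0 \<le> g' \<le> 1\<close>, the weight
  \<open>w = exp (2 \<alpha> g(l))\<close> is cylindrical, so it multiplies the domain of the gradient into itself by the
  product rule, and its gradient is at most \<open>2 \<alpha> \<kappa> w\<close> in norm, where \<open>\<kappa> = onorm iH\<close>. Only this commutator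
  survives when \<open>\<integral> w |U(t)u|\<^sup>2\<close> is differentiated, and Gronwall bounds its growth by
  \<open>exp (2 \<alpha> \<kappa> |t|)\<close>. Letting \<open>\<alpha> \<rightarrow> \<infinity>\<close>, a \<open>u\<close> that vanishes on \<open>l > c\<close> evolves into one that vanishes on
  \<open>l > c + \<kappa> |t|\<close>. Balls are intersections of such half-spaces by Hahn--Banach and the Radon property,
  and a general closed \<open>K\<close> follows by duality: \<open>\<langle>U(t)u, z\<rangle> = \<langle>u, U(-t)z\<rangle>\<close> vanishes for \<open>z\<close> supported in a
  small ball at distance more than \<open>\<kappa> |t|\<close> from \<open>K\<close>.\<close>

section \<open>The Hahn--Banach theorem\<close>

text \<open>This forces the detour through linear functionals, which only see convex sets, and hence
  the final duality step. The speed is \<open>onorm iH\<close> and not twice that because the Dirac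
  matrix couples the components of u = (f, G) only with each other: the commutator is at most 2
  \<alpha> \<kappa> w |f| |G| \<le> \<alpha> \<kappa> w (|f|^2 + |G|^2). Differentiating a square
  gives back the factor 2, in balance with the 2 \<alpha> of the weight. Gronwall needs orbits in
  the domain of the generator; its density is derived from the group axioms alone. Sums of H-valued
  measurable functions are measurable because H is separable, which follows from the Radon property
  of \<mu> and the density of the reproducing kernel space in H.\<close>

definition sublinear :: "('a::real_vector \<Rightarrow> real) \<Rightarrow> bool" where
  "sublinear p \<longleftrightarrow> p 0 = 0 \<and> (\<forall>x y. p (x + y) \<le> p x + p y) \<and> (\<forall>r>0. \<forall>x. p (r *\<^sub>R x) \<le> r * p x)"

text \<open>The inequality for \<open>inverse r\<close> at the point \<open>r *\<^sub>R x\<close> is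
  the reverse one. Hence the definition asks for one inequality only, which is all that has to be
  checked for infima.\<close>

lemma sublinear_scaleR:
  assumes "sublinear p" "0 \<le> r"
  shows "p (r *\<^sub>R x) = r * p x"
proof (cases "r = 0")
  case False
  then have r: "r > 0" using assms by simp
  have "p (inverse r *\<^sub>R r *\<^sub>R x) \<le> inverse r * p (r *\<^sub>R x)"
    using assms r unfolding sublinear_def by (metis inverse_positive_iff_positive)
  then have "p x \<le> inverse r * p (r *\<^sub>R x)" using r by simp
  then have "r * p x \<le> p (r *\<^sub>R x)"
    using r by (simp add: field_simps)
  then show ?thesis using assms r unfolding sublinear_def by (meson order_antisym)
qed (use assms in \<open>simp add: sublinear_def\<close>)

lemma sublinear_lower: "sublinear p \<Longrightarrow> - p (- x) \<le> p x"
  unfolding sublinear_def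
  by (metis add.right_inverse add_0 minus_le_iff diff_ge_0_iff_ge diff_minus_eq_add)

text \<open>\<open>p\<close> is lowered along the ray of \<open>v\<close>; the competitor t = 1 at
  \<open>- v\<close> gives the last bound. The lemma serves twice: it shows that a minimal sublinear
  functional is odd, and it provides the starting point that forces \<open>f v = p v\<close> in the
  Hahn-Banach theorem.\<close>

lemma sublinear_directional:
  fixes p :: "'a::real_vector \<Rightarrow> real"
  assumes p: "sublinear p"
  obtains q where "sublinear q" "q \<le> p" "q (- v) \<le> - p v"
proof
  define q where "q x = (INF t\<in>{0..}. p (x + t *\<^sub>R v) - t * p v)" for x
  have add: "p (x + y) \<le> p x + p y" for x y using p by (simp add: sublinear_def)
  \<comment> \<open>Finiteness of the infimum: \<open>t *\<^sub>R v\<close> is the sum of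
    \<open>x + t *\<^sub>R v\<close> and \<open>- x\<close>.\<close>
  have lb: "- p (- x) \<le> p (x + t *\<^sub>R v) - t * p v" if "t \<ge> 0" for x t
    using add[of "x + t *\<^sub>R v" "- x"] sublinear_scaleR[OF p that, of v] by simp
  have bdd: "bdd_below ((\<lambda>t. p (x + t *\<^sub>R v) - t * p v) ` {0..})" for x
    by (rule bdd_belowI[where m = "- p (- x)"]) (use lb in auto)
  have le: "q x \<le> p (x + t *\<^sub>R v) - t * p v" if "t \<ge> 0" for x t
    unfolding q_def by (rule cINF_lower[OF bdd]) (use that in auto)
  have ge: "c \<le> q x" if "\<And>t. t \<ge> 0 \<Longrightarrow> c \<le> p (x + t *\<^sub>R v) - t * p v" for x c
    unfolding q_def by (rule cINF_greatest) (use that in auto)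
  show "q \<le> p" using le[of 0] by (auto simp: le_fun_def)
  show "q (- v) \<le> - p v" using le[of 1 "- v"] p by (simp add: sublinear_def)
  show "sublinear q"
    unfolding sublinear_def
  proof (intro conjI allI impI)
    have "q 0 \<le> 0" using le[of 0 0] p by (simp add: sublinear_def)
    moreover have "q 0 \<ge> 0" by (rule ge) (use lb[of _ 0] p in \<open>auto simp: sublinear_def\<close>)
    ultimately show "q 0 = 0" by simp
    fix x y
    have "q (x + y) - (p (y + s *\<^sub>R v) - s * p v) \<le> q x" if s: "s \<ge> 0" for s
    proof (rule ge)
      fix t :: real assume t: "t \<ge> 0"
      show "q (x + y) - (p (y + s *\<^sub>R v) - s * p v) \<le> p (x + t *\<^sub>R v) - t * p v"
        using le[of "t + s" "x + y"] add[of "x + t *\<^sub>R v" "y + s *\<^sub>R v"] s t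
        by (simp add: algebra_simps)
    qed
    then have "q (x + y) - q x \<le> q y" by (intro ge) (smt (verit))
    then show "q (x + y) \<le> q x + q y" by simp
  next
    fix r :: real and x assume r: "r > 0"
    have "inverse r * q (r *\<^sub>R x) \<le> q x"
    proof (rule ge)
      fix t :: real assume t: "t \<ge> 0"
      have "p (r *\<^sub>R x + (r * t) *\<^sub>R v) = r * p (x + t *\<^sub>R v)"
        using sublinear_scaleR[OF p, of r "x + t *\<^sub>R v"] r by (simp add: scaleR_add_right)
      then have "q (r *\<^sub>R x) \<le> r * (p (x + t *\<^sub>R v) - t * p v)"
        using le[of "r * t" "r *\<^sub>R x"] r t by (simp add: algebra_simps)
      then show "inverse r * q (r *\<^sub>R x) \<le> p (x + t *\<^sub>R v) - t * p v"
        using r by (simp add: field_simps)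
    qed
    then show "q (r *\<^sub>R x) \<le> r * q x" using r by (simp add: field_simps)
  qed
qed

text \<open>The infimum is finite because p x \<ge> - p (- x) \<ge> - p0 (- x) on \<open>C\<close>.
  Subadditivity needs the chain: given two members, the smaller one bounds both terms at
  once.\<close>

lemma sublinear_Inf_chain:
  fixes C :: "('a::real_vector \<Rightarrow> real) set"
  assumes ne: "C \<noteq> {}" and sub: "\<And>p. p \<in> C \<Longrightarrow> sublinear p"
    and below: "\<And>p. p \<in> C \<Longrightarrow> p \<le> p0"
    and chain: "\<And>p q. p \<in> C \<Longrightarrow> q \<in> C \<Longrightarrow> p \<le> q \<or> q \<le> p"
  shows "sublinear (\<lambda>x. INF p\<in>C. p x)" and "\<And>p. p \<in> C \<Longrightarrow> (\<lambda>x. INF p\<in>C. p x) \<le> p"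
proof -
  define u where "u x = (INF p\<in>C. p x)" for x
  have bdd: "bdd_below ((\<lambda>p. p x) ` C)" for x
  proof (rule bdd_belowI2)
    fix p assume "p \<in> C"
    then show "- p0 (- x) \<le> p x"
      using sublinear_lower[OF sub, of p x] below[of p] by (smt (verit) le_funD)
  qed
  have le: "u x \<le> p x" if "p \<in> C" for p x
    unfolding u_def by (rule cINF_lower[OF bdd that])
  have ge: "c \<le> u x" if "\<And>p. p \<in> C \<Longrightarrow> c \<le> p x" for c x
    unfolding u_def by (rule cINF_greatest[OF ne that])
  show "(\<lambda>x. INF p\<in>C. p x) \<le> p" if "p \<in> C" for p
    using le[OF that] by (simp add: u_def le_fun_def)
  have "sublinear u"
    unfolding sublinear_def
  proof (intro conjI allI impI)
    have "u 0 = (INF p\<in>C. 0)"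
      unfolding u_def by (rule INF_cong) (use sub in \<open>auto simp: sublinear_def\<close>)
    then show "u 0 = 0" using ne by simp
    fix x y
    have *: "u (x + y) \<le> p x + q y" if pq: "p \<in> C" "q \<in> C" for p q
    proof -
      obtain r where r: "r \<in> C" "r \<le> p" "r \<le> q" using chain[OF pq] pq by blast
      have "u (x + y) \<le> r (x + y)" by (rule le[OF r(1)])
      also have "\<dots> \<le> r x + r y" using sub[OF r(1)] by (simp add: sublinear_def)
      finally show ?thesis using r(2,3) by (smt (verit) le_funD)
    qed
    have "u (x + y) - q y \<le> u x" if "q \<in> C" for q
      by (rule ge) (use *[OF _ that] in \<open>simp add: algebra_simps\<close>)
    then have "u (x + y) - u x \<le> u y" by (intro ge) (smt (verit))
    then show "u (x + y) \<le> u x + u y" by simp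
  next
    fix r :: real and x assume r: "r > 0"
    have "inverse r * u (r *\<^sub>R x) \<le> u x"
    proof (rule ge)
      fix p assume p: "p \<in> C"
      have "u (r *\<^sub>R x) \<le> r * p x"
        using le[OF p, of "r *\<^sub>R x"] sublinear_scaleR[OF sub[OF p], of r x] r by simp
      then show "inverse r * u (r *\<^sub>R x) \<le> p x" using r by (simp add: field_simps)
    qed
    then show "u (r *\<^sub>R x) \<le> r * u x" using r by (simp add: field_simps)
  qed
  moreover have "u = (\<lambda>x. INF p\<in>C. p x)" by (rule ext) (rule u_def)
  ultimately show "sublinear (\<lambda>x. INF p\<in>C. p x)" by simp
qed

text \<open>Minimality against \<open>sublinear_directional\<close> makes \<open>p\<close> odd, and
  an odd subadditive function is additive: compare the inequalities at x, y and at -x, -y.\<close>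

lemma minimal_sublinear_linear:
  assumes p: "sublinear p" and min: "\<And>q. sublinear q \<Longrightarrow> q \<le> p \<Longrightarrow> q = p"
  shows "linear p"
proof -
  have neg: "p (- v) = - p v" for v
  proof -
    obtain q where "sublinear q" "q \<le> p" "q (- v) \<le> - p v"
      by (rule sublinear_directional[OF p, of v])
    then show ?thesis using min sublinear_lower[OF p, of v] by fastforce
  qed
  have add: "p (x + y) \<le> p x + p y" for x y using p by (simp add: sublinear_def)
  have "p (x + y) = p x + p y" for x y
    using add[of x y] add[of "- x" "- y"] neg[of x] neg[of y] neg[of "x + y"] by simp
  moreover have "p (r *\<^sub>R x) = r * p x" for r x
  proof (cases "r \<ge> 0")
    case False
    then have "p ((- r) *\<^sub>R x) = - r * p x" by (intro sublinear_scaleR[OF p]) simp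
    then show ?thesis using neg[of "r *\<^sub>R x"] by simp
  qed (rule sublinear_scaleR[OF p])
  ultimately show ?thesis by (intro linearI) auto
qed

text \<open>No functional is extended from a subspace: a minimal sublinear functional below
  \<open>p\<close> is already linear. Minimality is taken below \<open>p0\<close> instead of
  \<open>p\<close>, so that f (- v) \<le> - p v, which turns f v \<le> p v into an equality.\<close>

theorem Hahn_Banach_sublinear:
  fixes p :: "'a::real_vector \<Rightarrow> real"
  assumes p: "sublinear p"
  obtains f where "linear f" "\<And>x. f x \<le> p x" "f v = p v"
proof -
  obtain p0 where p0: "sublinear p0" "p0 \<le> p" "p0 (- v) \<le> - p v"
    by (rule sublinear_directional[OF p, of v])
  define A where "A = {q. sublinear q \<and> q \<le> p0}"
  \<comment> \<open>The order is reversed, so that the maximal element of Zorn's lemma is a minimal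
    functional.\<close>
  have "\<exists>m\<in>A. \<forall>a\<in>A. (\<lambda>f g. g \<le> f) m a \<longrightarrow> a = m"
  proof (rule predicate_Zorn)
    show "partial_order_on A (relation_of (\<lambda>f g. g \<le> f) A)"
      by (rule partial_order_on_relation_ofI) auto
    fix C assume C: "C \<in> Chains (relation_of (\<lambda>f g. g \<le> f) A)"
    then have chain: "q \<le> r \<or> r \<le> q" and CA: "q \<in> A" if "q \<in> C" "r \<in> C" for q r
      using that unfolding Chains_def relation_of_def by blast+
    show "\<exists>u\<in>A. \<forall>a\<in>C. u \<le> a"
    proof (cases "C = {}")
      case True then show ?thesis using p0 by (auto simp: A_def)
    next
      case False
      have *: "sublinear q" "q \<le> p0" if "q \<in> C" for q using CA[OF that that] by (auto simp: A_def)
      note I = sublinear_Inf_chain[OF False * chain]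
      have "(\<lambda>x. INF q\<in>C. q x) \<in> A"
        unfolding A_def using I False * by (metis (no_types, lifting) ex_in_conv mem_Collect_eq order_trans)
      then show ?thesis using I(2) by blast
    qed
  qed
  then obtain f where f: "f \<in> A" "\<And>a. a \<in> A \<Longrightarrow> a \<le> f \<Longrightarrow> a = f" by auto
  have "linear f"
    by (rule minimal_sublinear_linear) (use f in \<open>auto simp: A_def intro: order_trans\<close>)
  moreover have le: "f x \<le> p x" for x
    using f(1) p0(2) by (auto simp: A_def le_fun_def intro: order_trans)
  moreover have "f (- v) \<le> - p v" using f(1) p0(3) by (auto simp: A_def le_fun_def intro: order_trans)
  then have "p v \<le> f v" using linear_neg[OF \<open>linear f\<close>, of v] by simp
  ultimately show thesis using that le[of v] by (metis order_antisym)
qed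

corollary norming_functional:
  fixes v :: "'a::real_normed_vector"
  obtains l where "bounded_linear l" "\<And>x. \<bar>l x\<bar> \<le> norm x" "l v = norm v"
proof -
  have "sublinear (norm :: 'a \<Rightarrow> real)" by (auto simp: sublinear_def norm_triangle_ineq)
  then obtain l where l: "linear l" "\<And>x. l x \<le> norm x" "l v = norm v"
    using Hahn_Banach_sublinear[of norm v] by blast
  have abs: "\<bar>l x\<bar> \<le> norm x" for x
    using l(2)[of x] l(2)[of "- x"] linear_neg[OF l(1), of x] by simp
  have "bounded_linear l"
    using l(1) abs by (intro bounded_linear_intro[where K = 1]) (auto simp: linear_add linear_scale)
  then show thesis using that abs l(3) by blast
qed

text \<open>The distance to a subspace is sublinear, at most the norm, zero on \<open>M\<close> and
  positive at \<open>v\<close> since \<open>M\<close> is closed. A linear functional below it that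
  agrees with it at \<open>v\<close> has all the required properties.\<close>

corollary annihilating_functional:
  fixes M :: "'a::real_normed_vector set"
  assumes M: "subspace M" "closed M" and v: "v \<notin> M"
  obtains l where "bounded_linear l" "\<And>x. x \<in> M \<Longrightarrow> l x = 0" "l v \<noteq> (0::real)"
proof -
  have ne: "M \<noteq> {}" and M0: "0 \<in> M" using subspace_0[OF M(1)] by auto
  define p where "p x = infdist x M" for x
  have ex: "\<exists>m\<in>M. dist x m < p x + e" if "e > 0" for x e
    using that cInf_lessD[of "dist x ` M" "p x + e"] ne
    unfolding p_def infdist_def by auto
  have "sublinear p"
    unfolding sublinear_def
  proof (intro conjI allI impI)
    show "p 0 = 0" using M0 by (simp add: p_def)
    fix x y
    show "p (x + y) \<le> p x + p y"
    proof (rule field_le_epsilon)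
      fix e :: real assume "e > 0"
      then obtain a b where ab: "a \<in> M" "dist x a < p x + e / 2" "b \<in> M" "dist y b < p y + e / 2"
        using ex[of "e / 2"] by (meson half_gt_zero)
      have "p (x + y) \<le> dist (x + y) (a + b)"
        unfolding p_def by (intro infdist_le subspace_add M ab)
      also have "\<dots> \<le> dist x a + dist y b" by (rule dist_triangle_add)
      finally show "p (x + y) \<le> p x + p y + e" using ab by simp
    qed
  next
    fix r :: real and x assume r: "r > 0"
    show "p (r *\<^sub>R x) \<le> r * p x"
    proof (rule field_le_epsilon)
      fix e :: real assume "e > 0"
      then obtain a where a: "a \<in> M" "dist x a < p x + e / r" using ex r by (meson divide_pos_pos)
      have "p (r *\<^sub>R x) \<le> dist (r *\<^sub>R x) (r *\<^sub>R a)"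
        unfolding p_def by (intro infdist_le subspace_scale M a)
      also have "\<dots> = r * dist x a" using r by (simp add: dist_norm flip: scaleR_diff_right)
      also have "\<dots> \<le> r * (p x + e / r)" using a r by simp
      also have "\<dots> = r * p x + e" using r by (simp add: distrib_left)
      finally show "p (r *\<^sub>R x) \<le> r * p x + e" .
    qed
  qed
  then obtain l where l: "linear l" "\<And>x. l x \<le> p x" "l v = p v"
    using Hahn_Banach_sublinear[of p v] by blast
  have "p x \<le> norm x" for x using infdist_le[OF M0, of x] by (simp add: p_def)
  then have abs: "\<bar>l x\<bar> \<le> norm x" for x
    using l(2)[of x] l(2)[of "- x"] linear_neg[OF l(1), of x] by (smt (verit) norm_minus_cancel)
  have "bounded_linear l"
    using l(1) abs by (intro bounded_linear_intro[where K = 1]) (auto simp: linear_add linear_scale)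
  moreover have "l x = 0" if "x \<in> M" for x
    using l(2)[of x] l(2)[of "- x"] linear_neg[OF l(1), of x] that subspace_neg[OF M(1) that]
    by (simp add: p_def)
  moreover have "l v \<noteq> 0"
    using v M(2) ne l(3) in_closed_iff_infdist_zero[of M v] by (simp add: p_def)
  ultimately show thesis using that by blast
qed

section \<open>Unitary groups on semi-Hilbert spaces\<close>

text \<open>The limit \<open>c\<close> of the bound is kept apart from 0 so that it can be given in
  the unsimplified form that \<open>tendsto_intros\<close> produces.\<close>

lemma tendsto_if_close:
  fixes f :: "'a \<Rightarrow> real"
  assumes "(g \<longlongrightarrow> c) F" "c = 0" "\<forall>\<^sub>F x in F. \<bar>f x - L\<bar> \<le> g x"
  shows "(f \<longlongrightarrow> L) F"
proof -
  have "((\<lambda>x. f x - L) \<longlongrightarrow> 0) F"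
    by (rule Lim_null_comparison[of _ g]) (use assms in auto)
  then show ?thesis by (simp add: LIM_zero_iff)
qed

lemma le_of_square_le:
  fixes a c :: real
  assumes "a * a \<le> c * a" "0 \<le> a" "0 \<le> c"
  shows "a \<le> c"
  using assms by (cases "a = 0") auto

lemma linear_coefficient_zero:
  fixes a b :: real
  assumes "\<And>t. 0 \<le> 2 * t * a + t\<^sup>2 * b" "b \<ge> 0"
  shows "a = 0"
proof (rule ccontr)
  assume a: "a \<noteq> 0"
  \<comment> \<open>Dividing by b + 1 and not by b also covers b = 0.\<close>
  have "0 \<le> 2 * (- a / (b + 1)) * a + (- a / (b + 1))\<^sup>2 * b" by (rule assms)
  also have "\<dots> = - a\<^sup>2 * (b + 2) / (b + 1)\<^sup>2"
    using assms(2) by (simp add: divide_simps power2_eq_square) (simp add: algebra_simps)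
  also have "\<dots> < 0" using a assms(2) by (intro divide_neg_pos mult_neg_pos) auto
  finally show False by simp
qed

text \<open>Mean value inequality for \<Gamma> minus its linear part. It lets averages of orbits be
  estimated through scalar antiderivatives, without vector-valued integrals; \<open>t\<close> may
  have either sign.\<close>

lemma antiderivative_increment:
  fixes A \<Gamma> :: "real \<Rightarrow> real"
  assumes der: "\<And>x. DERIV \<Gamma> x :> A x" and c: "\<And>s. \<bar>s\<bar> \<le> \<bar>t\<bar> \<Longrightarrow> \<bar>A (a + s) - A a\<bar> \<le> c"
  shows "\<bar>\<Gamma> (a + t) - \<Gamma> a - t * A a\<bar> \<le> \<bar>t\<bar> * c"
proof -
  define f where "f x = \<Gamma> x - x * A a" for x
  have "norm (f (a + t) - f a) \<le> c * norm ((a + t) - a)"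
  proof (rule field_differentiable_bound[where S = "closed_segment a (a + t)" and f = f and f' = "\<lambda>x. A x - A a"])
    fix x assume x: "x \<in> closed_segment a (a + t)"
    show "(f has_field_derivative A x - A a) (at x within closed_segment a (a + t))"
      unfolding f_def by (auto intro!: derivative_eq_intros has_field_derivative_at_within[OF der])
    have "\<bar>x - a\<bar> \<le> \<bar>t\<bar>" using x by (auto simp: closed_segment_eq_real_ivl split: if_splits)
    then show "norm (A x - A a) \<le> c" using c[of "x - a"] by simp
  qed auto
  then show ?thesis by (simp add: f_def algebra_simps)
qed

text \<open>Square integrable functions are not identified modulo a.e. equality and form no type of their
  own, hence a carrier set, an explicit operation \<open>lin a x b y\<close> for \<open>a x + b y\<close>, and a possibly
  degenerate form.\<close>
locale semi_hilbert =
  fixes X :: "'a set" and lin :: "real \<Rightarrow> 'a \<Rightarrow> real \<Rightarrow> 'a \<Rightarrow> 'a" and B :: "'a \<Rightarrow> 'a \<Rightarrow> real"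
  assumes nonempty: "X \<noteq> {}"
    and lin_in [simp, intro]: "x \<in> X \<Longrightarrow> y \<in> X \<Longrightarrow> lin a x b y \<in> X"
    and sym: "x \<in> X \<Longrightarrow> y \<in> X \<Longrightarrow> B x y = B y x"
    and lin_left [simp]: "x \<in> X \<Longrightarrow> y \<in> X \<Longrightarrow> z \<in> X \<Longrightarrow> B (lin a x b y) z = a * B x z + b * B y z"
    and nonneg [simp]: "x \<in> X \<Longrightarrow> B x x \<ge> 0"
    and complete: "(\<And>n. f n \<in> X) \<Longrightarrow>
      (\<And>e. e > 0 \<Longrightarrow> \<exists>N. \<forall>m\<ge>N. \<forall>n\<ge>N. B (lin 1 (f m) (-1) (f n)) (lin 1 (f m) (-1) (f n)) < e) \<Longrightarrow>
      \<exists>x\<in>X. (\<lambda>n::nat. B (lin 1 (f n) (-1) x) (lin 1 (f n) (-1) x)) \<longlonglongrightarrow> 0"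
begin

definition q :: "'a \<Rightarrow> 'a \<Rightarrow> real" where
  "q x y = B (lin 1 x (-1) y) (lin 1 x (-1) y)"

definition nrm :: "'a \<Rightarrow> real" where
  "nrm x = sqrt (B x x)"

lemma lin_right [simp]:
  "x \<in> X \<Longrightarrow> y \<in> X \<Longrightarrow> z \<in> X \<Longrightarrow> B z (lin a x b y) = a * B z x + b * B z y"
  by (metis lin_in lin_left sym)

lemma q_eq: "x \<in> X \<Longrightarrow> y \<in> X \<Longrightarrow> q x y = B x x - 2 * B x y + B y y"
  by (simp add: q_def sym[of y x])

lemma q_nonneg [simp]: "x \<in> X \<Longrightarrow> y \<in> X \<Longrightarrow> 0 \<le> q x y"
  by (simp add: q_def del: lin_left lin_right)

lemma nrm_nonneg [simp]: "x \<in> X \<Longrightarrow> 0 \<le> nrm x"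
  by (simp add: nrm_def)

lemma nrm_square [simp]: "x \<in> X \<Longrightarrow> nrm x * nrm x = B x x"
  by (simp add: nrm_def)

lemma Cauchy_Schwarz:
  assumes x: "x \<in> X" and y: "y \<in> X"
  shows "\<bar>B x y\<bar> \<le> nrm x * nrm y"
proof -
  have *: "0 \<le> B x x + 2 * t * B x y + t\<^sup>2 * B y y" for t
    using nonneg[of "lin 1 x t y"] x y sym[OF y x]
    by (simp add: power2_eq_square algebra_simps)
  have "(B x y)\<^sup>2 \<le> B x x * B y y"
  proof (cases "B y y = 0")
    case True
    have "B x y = 0"
    proof (rule ccontr)
      assume n: "B x y \<noteq> 0"
      show False using *[of "- (B x x + 1) / (2 * B x y)"] n True by (simp add: field_simps)
    qed
    then show ?thesis using True by simp
  next
    case False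
    then have "B y y > 0" using nonneg[OF y] by linarith
    then show ?thesis using *[of "- B x y / B y y"] by (simp add: field_simps power2_eq_square)
  qed
  then have "sqrt ((B x y)\<^sup>2) \<le> sqrt (B x x * B y y)" by (rule real_sqrt_le_mono)
  then show ?thesis by (simp add: nrm_def real_sqrt_mult)
qed

lemma B_diff_le:
  assumes "x \<in> X" "y \<in> X" "z \<in> X"
  shows "\<bar>B x z - B y z\<bar> \<le> sqrt (q x y) * nrm z"
  using Cauchy_Schwarz[of "lin 1 x (-1) y" z] assms by (simp add: nrm_def q_def)

text \<open>Variational proof: the representer minimises B x x - 2 l x. It tolerates a degenerate
  form, because the bound on \<open>l\<close> makes it vanish on null vectors.\<close>

theorem Riesz:
  assumes l_lin: "\<And>a b x y. x \<in> X \<Longrightarrow> y \<in> X \<Longrightarrow> l (lin a x b y) = a * l x + b * l y"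
    and l_bound: "\<And>x. x \<in> X \<Longrightarrow> \<bar>l x\<bar> \<le> C * nrm x"
  shows "\<exists>p\<in>X. \<forall>z\<in>X. B p z = l z"
proof -
  define J where "J x = B x x - 2 * l x" for x
  define m where "m = Inf (J ` X)"
  have "- (C\<^sup>2) \<le> J x" if "x \<in> X" for x
  proof -
    have "0 \<le> (nrm x - C)\<^sup>2" by simp
    also have "\<dots> = B x x - 2 * (C * nrm x) + C\<^sup>2" using that
      by (simp add: power2_eq_square algebra_simps)
    also have "\<dots> \<le> J x + C\<^sup>2" using l_bound[OF that] by (simp add: J_def)
    finally show ?thesis by simp
  qed
  then have bdd: "bdd_below (J ` X)" by (rule bdd_belowI2)
  have mle: "m \<le> J x" if "x \<in> X" for x
    unfolding m_def by (rule cINF_lower[OF bdd that])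
  have "\<exists>x\<in>X. J x < m + 1 / real (Suc n)" for n
    using cInf_lessD[of "J ` X" "m + 1 / real (Suc n)"] nonempty unfolding m_def by auto
  then obtain f where f: "\<And>n. f n \<in> X" "\<And>n. J (f n) < m + 1 / real (Suc n)" by metis
  \<comment> \<open>Parallelogram law: the squared distance equals 2 J(f i) + 2 J(f j) - 4
    J(midpoint), and the midpoint has value at least \<open>m\<close>.\<close>
  have D: "q (f i) (f j) \<le> 2 * (1 / real (Suc i)) + 2 * (1 / real (Suc j))" for i j
  proof -
    have "m \<le> J (lin (1/2) (f i) (1/2) (f j))" by (intro mle lin_in f)
    also have "\<dots> = (B (f i) (f i) + 2 * B (f i) (f j) + B (f j) (f j)) / 4 - l (f i) - l (f j)"
      using f(1) sym[OF f(1) f(1), of i j] by (simp add: J_def l_lin field_simps)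
    finally have "4 * m + 4 * l (f i) + 4 * l (f j) \<le> B (f i) (f i) + 2 * B (f i) (f j) + B (f j) (f j)"
      by (simp add: field_simps)
    then show ?thesis
      using f(2)[of i] f(2)[of j] unfolding q_eq[OF f(1) f(1)] J_def by argo
  qed
  have "\<exists>x\<in>X. (\<lambda>n. B (lin 1 (f n) (-1) x) (lin 1 (f n) (-1) x)) \<longlonglongrightarrow> 0"
  proof (rule complete)
    fix e :: real assume "e > 0"
    then obtain N where N: "1 / real (Suc N) < e / 4"
      using nat_approx_posE[of "e / 4"] by auto
    have "q (f i) (f j) < e" if "i \<ge> N" "j \<ge> N" for i j
    proof -
      have "1 / real (Suc i) \<le> 1 / real (Suc N)" "1 / real (Suc j) \<le> 1 / real (Suc N)"
        using that by (auto simp: frac_le)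
      then show ?thesis using D[of i j] N by simp
    qed
    then show "\<exists>N. \<forall>m\<ge>N. \<forall>n\<ge>N. B (lin 1 (f m) (-1) (f n)) (lin 1 (f m) (-1) (f n)) < e"
      unfolding q_def by blast
  qed (rule f)
  then obtain p where p: "p \<in> X" "(\<lambda>n. q (f n) p) \<longlonglongrightarrow> 0" by (auto simp: q_def)
  have "B p z = l z" if z: "z \<in> X" for z
  proof -
    have "(\<lambda>n. sqrt (q (f n) p) * nrm z) \<longlonglongrightarrow> sqrt 0 * nrm z"
      by (intro tendsto_intros p)
    then have lim: "(\<lambda>n. B (f n) z) \<longlonglongrightarrow> B p z"
      by (rule tendsto_if_close) (use B_diff_le[OF f(1) p(1) z] in auto)
    \<comment> \<open>Vanishing first variation: J (f n + t z) \<ge> m > J (f n) - 1 / (n + 1),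
      taken to the limit.\<close>
    have "0 \<le> 2 * t * (B p z - l z) + t\<^sup>2 * B z z" for t
    proof (rule LIMSEQ_le)
      show "(\<lambda>n. 2 * t * (B (f n) z - l z) + t\<^sup>2 * B z z) \<longlonglongrightarrow> 2 * t * (B p z - l z) + t\<^sup>2 * B z z"
        by (intro tendsto_intros lim)
      show "(\<lambda>n. - (1 / real (Suc n))) \<longlonglongrightarrow> 0"
        using tendsto_minus[OF LIMSEQ_inverse_real_of_nat] by (simp add: inverse_eq_divide)
      have "- (1 / real (Suc n)) \<le> 2 * t * (B (f n) z - l z) + t\<^sup>2 * B z z" for n
        using mle[of "lin 1 (f n) t z"] f(1)[of n] f(2)[of n] z sym[OF z f(1)[of n]]
        by (simp add: J_def l_lin power2_eq_square algebra_simps del: of_nat_Suc)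
      then show "\<exists>N. \<forall>n\<ge>N. - (1 / real (Suc n)) \<le> 2 * t * (B (f n) z - l z) + t\<^sup>2 * B z z"
        by blast
    qed
    then have "B p z - l z = 0"
      by (rule linear_coefficient_zero) (use z in simp)
    then show ?thesis by simp
  qed
  then show ?thesis using p(1) by blast
qed

end

text \<open>The identities are tested against every \<open>z\<close>, since the operators respect
  sums and composition only up to null vectors of \<open>B\<close>. Only continuity at 0 is asked
  for; the isometry carries it to all times.\<close>

locale semi_hilbert_group = semi_hilbert X lin B
  for X :: "'a set" and lin B +
  fixes U :: "real \<Rightarrow> 'a \<Rightarrow> 'a"
  assumes U_in [simp, intro]: "x \<in> X \<Longrightarrow> U t x \<in> X"
    and U_lin: "x \<in> X \<Longrightarrow> y \<in> X \<Longrightarrow> z \<in> X \<Longrightarrow> B (U t (lin a x b y)) z = a * B (U t x) z + b * B (U t y) z"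
    and U_isometry: "x \<in> X \<Longrightarrow> B (U t x) (U t x) = B x x"
    and U_0: "x \<in> X \<Longrightarrow> z \<in> X \<Longrightarrow> B (U 0 x) z = B x z"
    and U_add: "x \<in> X \<Longrightarrow> z \<in> X \<Longrightarrow> B (U (s + t) x) z = B (U s (U t x)) z"
    and U_cont: "x \<in> X \<Longrightarrow> ((\<lambda>t. B (lin 1 (U t x) (-1) x) (lin 1 (U t x) (-1) x)) \<longlongrightarrow> 0) (at 0)"
begin

text \<open>Polarisation of the isometry, carried out by hand because \<open>U t\<close> is additive
  only inside \<open>B\<close>.\<close>

lemma U_inner:
  assumes x: "x \<in> X" and y: "y \<in> X"
  shows "B (U t x) (U t y) = B x y"
proof -
  let ?z = "lin 1 x 1 y"
  have z: "?z \<in> X" using assms by simp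
  have exp: "B (U t ?z) w = B (U t x) w + B (U t y) w" if "w \<in> X" for w
    using U_lin[OF x y that, of t 1 1] by simp
  have "B (U t ?z) (U t ?z) = B x x + 2 * B (U t x) (U t y) + B y y"
    using x y z exp[of "U t ?z"] exp[of "U t x"] exp[of "U t y"]
      sym[of "U t x" "U t ?z"] sym[of "U t y" "U t ?z"] sym[of "U t y" "U t x"]
      U_isometry[OF x, of t] U_isometry[OF y, of t] by simp
  moreover have "B (U t ?z) (U t ?z) = B x x + 2 * B x y + B y y"
    unfolding U_isometry[OF z] using x y by (simp add: sym[of y x])
  ultimately show ?thesis by simp
qed

lemma U_adjoint:
  assumes x: "x \<in> X" and z: "z \<in> X"
  shows "B (U t x) z = B x (U (- t) z)"
proof -
  have "B x (U (- t) z) = B (U t x) (U t (U (- t) z))" using assms by (simp add: U_inner)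
  also have "\<dots> = B (U (t + - t) z) (U t x)" using U_add[OF z, of "U t x" t "- t"] sym[of "U t x" "U t (U (- t) z)"] assms by simp
  also have "\<dots> = B (U t x) z" using assms by (simp add: U_0 sym)
  finally show ?thesis by simp
qed

lemma q_U: "x \<in> X \<Longrightarrow> y \<in> X \<Longrightarrow> q (U t x) (U t y) = q x y"
  by (simp add: q_eq U_inner)

lemma B_U_add:
  assumes "x \<in> X" "z \<in> X"
  shows "B (U (s + t) x) z = B (U s x) (U (- t) z)"
  using U_add[OF assms, of t s] U_adjoint[of "U s x" z t] assms by (simp add: add.commute)

lemma q_U_add:
  assumes "x \<in> X"
  shows "q (U (t + s) x) (U t x) = q (U s x) x"
  using assms by (simp add: q_eq U_inner U_add)

lemma q_U_tendsto: "x \<in> X \<Longrightarrow> ((\<lambda>t. q (U t x) x) \<longlongrightarrow> 0) (at 0)"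
  using U_cont by (simp add: q_def del: lin_left lin_right)

lemma q_U_small:
  assumes "x \<in> X" "e > 0"
  obtains d where "d > 0" "\<And>s. \<bar>s\<bar> < d \<Longrightarrow> q (U s x) x < e"
proof -
  obtain d where d: "d > 0" "\<And>s. s \<noteq> 0 \<Longrightarrow> \<bar>s\<bar> < d \<Longrightarrow> \<bar>q (U s x) x\<bar> < e"
    using tendstoD[OF q_U_tendsto[OF assms(1)] assms(2)] unfolding eventually_at
    by (auto simp: dist_real_def)
  have "q (U 0 x) x = 0" using assms(1) by (simp add: q_eq U_isometry U_0)
  then have "q (U s x) x < e" if "\<bar>s\<bar> < d" for s
    using d(2)[of s] that assms(2) by (cases "s = 0") auto
  then show thesis using that d(1) by blast
qed

lemma B_U_diff:
  assumes "x \<in> X" "z \<in> X"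
  shows "\<bar>B (U (t + s) x) z - B (U t x) z\<bar> \<le> sqrt (q (U s x) x) * nrm z"
  using B_diff_le[of "U (t + s) x" "U t x" z] q_U_add[of x t s] assms by simp

lemma isCont_B_U:
  assumes "x \<in> X" "z \<in> X"
  shows "isCont (\<lambda>t. B (U t x) z) t"
proof -
  have "((\<lambda>s. sqrt (q (U s x) x) * nrm z) \<longlongrightarrow> sqrt 0 * nrm z) (at 0)"
    by (intro tendsto_intros q_U_tendsto assms)
  then have "((\<lambda>s. B (U (t + s) x) z) \<longlongrightarrow> B (U t x) z) (at 0)"
    by (rule tendsto_if_close) (use B_U_diff[OF assms] in auto)
  then show ?thesis by (simp add: isCont_iff)
qed

text \<open>The graph of the generator, as a relation: a seminorm limit determines \<open>w\<close>
  only up to null vectors.\<close>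

definition generates :: "'a \<Rightarrow> 'a \<Rightarrow> bool" where
  "generates v w \<longleftrightarrow> v \<in> X \<and> w \<in> X \<and> ((\<lambda>t. q (lin (1 / t) (U t v) (- 1 / t) v) w) \<longlongrightarrow> 0) (at 0)"

text \<open>The vector \<open>v\<close> is the mean of \<open>U s u\<close> over a short interval, obtained weakly by the Riesz
  representation theorem.\<close>
theorem generator_dense:
  assumes u: "u \<in> X" and e: "e > 0"
  obtains v w where "generates v w" "q v u < e"
proof -
  obtain d where d: "d > 0" "\<And>s. \<bar>s\<bar> < d \<Longrightarrow> q (U s u) u < e / 4"
    using q_U_small[OF u, of "e / 4"] e by auto
  \<comment> \<open>Keeps the closed interval [0, h] inside the range where \<open>U s u\<close> is
    close to \<open>u\<close>.\<close>
  define h where "h = d / 2"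
  have h: "h > 0" "h < d" using d by (auto simp: h_def)
  have cont: "continuous_on S (\<lambda>t. B (U t u) z)" if "z \<in> X" for z S
    using isCont_B_U[OF u that] by (simp add: continuous_at_imp_continuous_on)
  define l where "l z = integral {0..h} (\<lambda>s. B (U s u) z) / h" for z
  have int: "(\<lambda>s. B (U s u) z) integrable_on {0..h}" if "z \<in> X" for z
    using cont[OF that] by (rule integrable_continuous_real)
  have FTC: "integral {0..h} (\<lambda>s. A (s + t)) = \<Gamma> (h + t) - \<Gamma> t"
    if "\<And>x. DERIV \<Gamma> x :> A x" for A \<Gamma> :: "real \<Rightarrow> real" and t
  proof -
    have "((\<lambda>s. \<Gamma> (s + t)) has_real_derivative A (s + t)) (at s)" for s
      using DERIV_shift[of \<Gamma> "A (s + t)" s t] that[of "s + t"] by simp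
    then have "((\<lambda>s. A (s + t)) has_integral \<Gamma> (h + t) - \<Gamma> (0 + t)) {0..h}"
      using h by (intro fundamental_theorem_of_calculus)
        (auto simp flip: has_real_derivative_iff_has_vector_derivative
              intro: has_field_derivative_at_within)
    then show ?thesis by (simp add: integral_unique)
  qed
  have "\<exists>v\<in>X. \<forall>z\<in>X. B v z = l z"
  proof (rule Riesz)
    show "l (lin a x b y) = a * l x + b * l y" if "x \<in> X" "y \<in> X" for a b x y
      using that u int by (simp add: l_def integral_add integrable_on_mult_right add_divide_distrib)
    show "\<bar>l z\<bar> \<le> nrm u * nrm z" if z: "z \<in> X" for z
    proof -
      have "norm (integral {0..h} (\<lambda>s. B (U s u) z)) \<le> nrm u * nrm z * (h - 0)"
      proof (rule integral_bound)
        show "continuous_on {0..h} (\<lambda>s. B (U s u) z)" by (rule cont[OF z])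
        show "norm (B (U s u) z) \<le> nrm u * nrm z" for s
          using Cauchy_Schwarz[of "U s u" z] u z by (simp add: nrm_def U_isometry)
      qed (use h in auto)
      then show ?thesis using h by (simp add: l_def field_simps)
    qed
  qed
  then obtain v where v: "v \<in> X" "\<And>z. z \<in> X \<Longrightarrow> B v z = l z" by blast
  \<comment> \<open>Formally the derivative at t = 0 of the mean of \<open>U s u\<close> over
    [t, t + h].\<close>
  define w where "w = lin (1 / h) (U h u) (- 1 / h) u"
  have w: "w \<in> X" using u by (simp add: w_def)
  have anti: "\<exists>\<Gamma>. \<forall>x. DERIV \<Gamma> x :> B (U x u) z" if "z \<in> X" for z
    using einterval_antiderivative[of "-\<infinity>" "\<infinity>" "\<lambda>t. B (U t u) z"] isCont_B_U[OF u that]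
    by (auto simp: has_real_derivative_iff_has_vector_derivative)
  \<comment> \<open>Moving \<open>U t\<close> to the other argument shifts the window of averaging
    from [0, h] to [t, t + h], so the pairing is an increment of a scalar antiderivative.\<close>
  have vt: "B (U t v) z = (\<Gamma> (h + t) - \<Gamma> t) / h"
    if "z \<in> X" "\<And>x. DERIV \<Gamma> x :> B (U x u) z" for z t \<Gamma>
    using FTC[OF that(2), of t] that(1) u v by (simp add: U_adjoint[OF v(1)] v(2) l_def B_U_add)
  \<comment> \<open>The error vector itself is the test vector \<open>z\<close>. Its squared
    seminorm is a difference of two increments of \<Gamma>, at h and at 0, each linear up to |t| c
    \<open>nrm z\<close>; dividing by \<open>nrm z\<close> gives 2 c / h.\<close>
  have bound: "q (lin (1 / t) (U t v) (- 1 / t) v) w \<le> (2 * c / h)\<^sup>2"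
    if t: "t \<noteq> 0" and c: "c \<ge> 0" "\<And>s. \<bar>s\<bar> \<le> \<bar>t\<bar> \<Longrightarrow> q (U s u) u \<le> c\<^sup>2" for t c
  proof -
    define z where "z = lin 1 (lin (1 / t) (U t v) (- 1 / t) v) (-1) w"
    have z: "z \<in> X" using u v w by (simp add: z_def)
    obtain \<Gamma> where \<Gamma>: "\<And>x. DERIV \<Gamma> x :> B (U x u) z" using anti[OF z] by blast
    have incr: "\<bar>\<Gamma> (a + t) - \<Gamma> a - t * B (U a u) z\<bar> \<le> \<bar>t\<bar> * (c * nrm z)" for a
    proof (rule antiderivative_increment[OF \<Gamma>])
      fix s assume "\<bar>s\<bar> \<le> \<bar>t\<bar>"
      then have "sqrt (q (U s u) u) \<le> c" using c by (intro real_le_lsqrt) auto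
      then show "\<bar>B (U (a + s) u) z - B (U a u) z\<bar> \<le> c * nrm z"
        using B_U_diff[OF u z, of a s] z by (smt (verit) mult_right_mono nrm_nonneg)
    qed
    have "B z z = B (lin 1 (lin (1 / t) (U t v) (- 1 / t) v) (-1) w) z" by (simp only: z_def)
    also have "\<dots> = (B (U t v) z - B (U 0 v) z) / t - (B (U h u) z - B (U 0 u) z) / h"
      using u v w z t by (simp add: w_def U_0 diff_divide_distrib)
    also have "\<dots> = ((\<Gamma> (h + t) - \<Gamma> h - t * B (U h u) z) - (\<Gamma> (0 + t) - \<Gamma> 0 - t * B (U 0 u) z)) / (t * h)"
      using t h by (simp add: vt[OF z \<Gamma>] field_simps)
    also have "\<dots> \<le> \<bar>(\<Gamma> (h + t) - \<Gamma> h - t * B (U h u) z) - (\<Gamma> (0 + t) - \<Gamma> 0 - t * B (U 0 u) z)\<bar> / (\<bar>t\<bar> * h)"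
      using h by (metis abs_divide abs_ge_self abs_mult abs_of_pos)
    also have "\<dots> \<le> (2 * (\<bar>t\<bar> * (c * nrm z))) / (\<bar>t\<bar> * h)"
      using incr[of h] incr[of 0] h by (intro divide_right_mono) auto
    also have "\<dots> = 2 * c / h * nrm z" using t h by (simp add: field_simps)
    finally have "nrm z * nrm z \<le> 2 * c / h * nrm z" using z by simp
    then have "nrm z \<le> 2 * c / h"
      using c(1) h z by (rule_tac le_of_square_le) auto
    then have "(nrm z)\<^sup>2 \<le> (2 * c / h)\<^sup>2" using z by (intro power_mono) auto
    then show ?thesis using z by (simp add: q_def z_def power2_eq_square del: lin_left lin_right)
  qed
  have "((\<lambda>t. q (lin (1 / t) (U t v) (- 1 / t) v) w) \<longlongrightarrow> 0) (at 0)"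
  proof (rule tendstoI)
    fix \<epsilon> :: real assume \<epsilon>: "\<epsilon> > 0"
    \<comment> \<open>Makes (2 c / h)^2 equal to \<epsilon> / 4.\<close>
    define c where "c = h * sqrt \<epsilon> / 4"
    have c: "c > 0" using \<epsilon> h by (simp add: c_def)
    have small: "(2 * c / h)\<^sup>2 < \<epsilon>" using h \<epsilon> by (simp add: c_def power_divide)
    obtain r where r: "r > 0" "\<And>s. \<bar>s\<bar> < r \<Longrightarrow> q (U s u) u < c\<^sup>2"
      using q_U_small[OF u, of "c\<^sup>2"] c by auto
    have "dist (q (lin (1 / t) (U t v) (- 1 / t) v) w) 0 < \<epsilon>" if "t \<noteq> 0" "dist t 0 < r" for t
    proof -
      have "q (lin (1 / t) (U t v) (- 1 / t) v) w \<le> (2 * c / h)\<^sup>2"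
      proof (rule bound)
        fix s assume "\<bar>s\<bar> \<le> \<bar>t\<bar>"
        then have "\<bar>s\<bar> < r" using that by (simp add: dist_real_def)
        then show "q (U s u) u \<le> c\<^sup>2" using r(2) by (intro less_imp_le)
      qed (use that c in auto)
      then show ?thesis using small v w by simp
    qed
    then show "\<forall>\<^sub>F t in at 0. dist (q (lin (1 / t) (U t v) (- 1 / t) v) w) 0 < \<epsilon>"
      unfolding eventually_at using r(1) by auto
  qed
  then have gen: "generates v w" using v w by (simp add: generates_def)
  have "q v u \<le> e / 4"
  proof -
    define z where "z = lin 1 v (-1) u"
    have z: "z \<in> X" using u v by (simp add: z_def)
    obtain \<Gamma> where \<Gamma>: "\<And>x. DERIV \<Gamma> x :> B (U x u) z" using anti[OF z] by blast
    have incr: "\<bar>\<Gamma> (0 + h) - \<Gamma> 0 - h * B (U 0 u) z\<bar> \<le> \<bar>h\<bar> * (sqrt (e / 4) * nrm z)"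
    proof (rule antiderivative_increment[OF \<Gamma>])
      fix s assume "\<bar>s\<bar> \<le> \<bar>h\<bar>"
      then have "sqrt (q (U s u) u) \<le> sqrt (e / 4)" using d(2)[of s] h by auto
      then show "\<bar>B (U (0 + s) u) z - B (U 0 u) z\<bar> \<le> sqrt (e / 4) * nrm z"
        using B_U_diff[OF u z, of 0 s] z by (smt (verit) mult_right_mono nrm_nonneg)
    qed
    have "B z z = B (lin 1 v (-1) u) z" by (simp only: z_def)
    also have "\<dots> = B (U 0 v) z - B (U 0 u) z"
      using u v z by (simp add: U_0)
    also have "\<dots> = (\<Gamma> (0 + h) - \<Gamma> 0 - h * B (U 0 u) z) / h"
      using h by (simp add: vt[OF z \<Gamma>] field_simps)
    also have "\<dots> \<le> \<bar>h\<bar> * (sqrt (e / 4) * nrm z) / h"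
      using incr h by (intro divide_right_mono) auto
    finally have "nrm z * nrm z \<le> sqrt (e / 4) * nrm z" using z h by simp
    then have "nrm z \<le> sqrt (e / 4)"
      using z e by (rule_tac le_of_square_le) auto
    then show ?thesis by (simp add: nrm_def q_def z_def del: lin_left lin_right)
  qed
  then show thesis using that[OF gen] e by simp
qed

text \<open>The isometry \<open>U t\<close> commutes with difference quotients, so orbits stay in
  the domain of the generator and a derivative at 0 yields one at every time.\<close>

lemma generates_U:
  assumes "generates v w"
  shows "generates (U t v) (U t w)"
proof -
  have v: "v \<in> X" and w: "w \<in> X" using assms by (auto simp: generates_def)
  have "q (lin (1 / s) (U s (U t v)) (- 1 / s) (U t v)) (U t w) = q (lin (1 / s) (U s v) (- 1 / s) v) w" for s
  proof -
    let ?D = "lin (1 / s) (U s v) (- 1 / s) v"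
    have eq: "B (lin (1 / s) (U s (U t v)) (- 1 / s) (U t v)) z = B (U t ?D) z" if "z \<in> X" for z
    proof -
      have "B (U s (U t v)) z = B (U t (U s v)) z"
        using U_add[OF v that, of s t] U_add[OF v that, of t s] by (simp add: add.commute)
      then show ?thesis using v that by (simp add: U_lin)
    qed
    let ?L = "lin (1 / s) (U s (U t v)) (- 1 / s) (U t v)"
    have L: "?L \<in> X" "?D \<in> X" using v by auto
    have "B ?L ?L = B (U t ?D) (U t ?D)"
      using eq[OF L(1)] eq[of "U t ?D"] L sym by (metis U_in)
    moreover have "B ?L (U t w) = B (U t ?D) (U t w)" using eq w by blast
    ultimately have "q ?L (U t w) = q (U t ?D) (U t w)"
      using L w by (simp only: q_eq U_in)
    then show ?thesis using q_U[OF L(2) w] by simp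
  qed
  then show ?thesis using assms unfolding generates_def by auto
qed

section \<open>A Gronwall inequality for bounded symmetric forms along the group\<close>

context
  fixes b :: "'a \<Rightarrow> 'a \<Rightarrow> real" and C c :: real
  assumes b_lin: "x \<in> X \<Longrightarrow> y \<in> X \<Longrightarrow> z \<in> X \<Longrightarrow> b (lin r x s y) z = r * b x z + s * b y z"
    and b_sym: "x \<in> X \<Longrightarrow> y \<in> X \<Longrightarrow> b x y = b y x"
    and b_bound: "x \<in> X \<Longrightarrow> y \<in> X \<Longrightarrow> \<bar>b x y\<bar> \<le> C * (nrm x * nrm y)"
    and b_gen: "generates v w \<Longrightarrow> \<bar>b w v\<bar> \<le> c * b v v"
begin

lemma b_diff_le:
  assumes "x \<in> X" "y \<in> X" "z \<in> X"
  shows "\<bar>b x z - b y z\<bar> \<le> C * (sqrt (q x y) * nrm z)"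
  using b_bound[of "lin 1 x (-1) y" z] b_lin[of x y z 1 "-1"] assms
  by (simp add: q_def nrm_def)

text \<open>Needed because \<open>U 0 v\<close> and \<open>v\<close>, or \<open>U (s + t) v\<close>
  and \<open>U s (U t v)\<close>, agree only up to null vectors; boundedness hides these from
  \<open>b\<close>.\<close>

lemma b_null:
  assumes "x \<in> X" "y \<in> X" "q x y = 0"
  shows "b x x = b y y"
proof -
  have "b x x = b y x" using b_diff_le[of x y x] assms by simp
  also have "\<dots> = b x y" using b_sym assms by blast
  also have "\<dots> = b y y" using b_diff_le[of x y y] assms by simp
  finally show ?thesis .
qed

lemma b_derivative_0:
  assumes "generates v w"
  shows "DERIV (\<lambda>s. b (U s v) (U s v)) 0 :> 2 * b w v"
proof -
  have v: "v \<in> X" and w: "w \<in> X"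
    and lim: "((\<lambda>t. q (lin (1 / t) (U t v) (- 1 / t) v) w) \<longlongrightarrow> 0) (at 0)"
    using assms by (auto simp: generates_def)
  have b0: "b (U 0 v) (U 0 v) = b v v"
    by (rule b_null) (use v in \<open>auto simp: q_eq U_0 U_isometry\<close>)
  have est: "\<bar>(b (U s v) (U s v) - b v v) / s - 2 * b w v\<bar>
      \<le> C * (sqrt (q (lin (1 / s) (U s v) (- 1 / s) v) w) * (2 * nrm v)) + C * (sqrt (q (U s v) v) * nrm w)"
    if s: "s \<noteq> 0" for s
  proof -
    let ?D = "lin (1 / s) (U s v) (- 1 / s) v"
    have D: "?D \<in> X" using v by simp
    \<comment> \<open>A difference of squares, factored by symmetry of \<open>b\<close>. With D
      tending to \<open>w\<close> and \<open>U s v\<close> to \<open>v\<close>, the right-hand side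
      tends to 2 \<open>b w v\<close>.\<close>
    have "(b (U s v) (U s v) - b v v) / s = b ?D (U s v) + b ?D v"
      using v s by (simp add: b_lin b_sym[of v "U s v"] field_simps)
    then have "(b (U s v) (U s v) - b v v) / s - 2 * b w v
       = (b ?D (U s v) - b w (U s v)) + (b ?D v - b w v) + (b (U s v) w - b v w)"
      using v w by (simp add: b_sym[of "U s v" w] b_sym[of v w])
    moreover have "\<bar>b ?D (U s v) - b w (U s v)\<bar> \<le> C * (sqrt (q ?D w) * nrm v)"
      using b_diff_le[OF D w, of "U s v"] v by (simp add: nrm_def U_isometry)
    moreover have "\<bar>b ?D v - b w v\<bar> \<le> C * (sqrt (q ?D w) * nrm v)"
      using b_diff_le[OF D w v] .
    moreover have "\<bar>b (U s v) w - b v w\<bar> \<le> C * (sqrt (q (U s v) v) * nrm w)"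
      using b_diff_le v w by simp
    ultimately show ?thesis by (simp add: algebra_simps)
  qed
  have "((\<lambda>s. C * (sqrt (q (lin (1 / s) (U s v) (- 1 / s) v) w) * (2 * nrm v))
              + C * (sqrt (q (U s v) v) * nrm w)) \<longlongrightarrow> C * (sqrt 0 * (2 * nrm v)) + C * (sqrt 0 * nrm w)) (at 0)"
    by (intro tendsto_intros lim q_U_tendsto v)
  then have "((\<lambda>s. (b (U s v) (U s v) - b v v) / s) \<longlongrightarrow> 2 * b w v) (at 0)"
    by (rule tendsto_if_close) (use est in \<open>auto simp: eventually_at_filter\<close>)
  then show ?thesis using b0 by (simp add: has_field_derivative_iff)
qed

lemma b_derivative:
  assumes "generates v w"
  shows "DERIV (\<lambda>s. b (U s v) (U s v)) t :> 2 * b (U t w) (U t v)"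
proof -
  have v: "v \<in> X" using assms by (simp add: generates_def)
  have "b (U (s + t) v) (U (s + t) v) = b (U s (U t v)) (U s (U t v))" for s
  proof (rule b_null)
    have eq: "B (U (s + t) v) z = B (U s (U t v)) z" if "z \<in> X" for z
      using U_add[OF v that] .
    show "q (U (s + t) v) (U s (U t v)) = 0"
      using v by (simp add: q_eq eq U_isometry)
  qed (use v in auto)
  then have "DERIV (\<lambda>s. b (U (s + t) v) (U (s + t) v)) 0 :> 2 * b (U t w) (U t v)"
    using b_derivative_0[OF generates_U[OF assms, of t]] by simp
  then show ?thesis using DERIV_shift[of "\<lambda>s. b (U s v) (U s v)" _ 0 t] by simp
qed

text \<open>The generator bound controls the absolute value of the derivative, hence both directions
  of time: exp (-2 c s) \<Phi>(s) does not increase forwards, and exp (2 c s) \<Phi>(s) does not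
  decrease up to 0.\<close>

lemma gronwall_generator:
  assumes gen: "generates v w"
  shows "b (U t v) (U t v) \<le> exp (2 * c * \<bar>t\<bar>) * b v v"
proof -
  have v: "v \<in> X" using assms by (simp add: generates_def)
  define \<Phi> where "\<Phi> s = b (U s v) (U s v)" for s
  have \<Phi>0: "\<Phi> 0 = b v v"
    unfolding \<Phi>_def by (rule b_null) (use v in \<open>auto simp: q_eq U_0 U_isometry\<close>)
  have der: "DERIV \<Phi> s :> 2 * b (U s w) (U s v)" for s
    unfolding \<Phi>_def by (rule b_derivative[OF gen])
  have bd: "\<bar>2 * b (U s w) (U s v)\<bar> \<le> 2 * c * \<Phi> s" for s
    using b_gen[OF generates_U[OF gen, of s]] by (simp add: \<Phi>_def)
  show ?thesis
  proof (cases "t \<ge> 0")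
    case True
    have "exp (- (2 * c * t)) * \<Phi> t \<le> exp (- (2 * c * 0)) * \<Phi> 0"
    proof (rule DERIV_nonpos_imp_nonincreasing[OF True])
      fix s :: real
      have "DERIV (\<lambda>s. exp (- (2 * c * s)) * \<Phi> s) s :> exp (- (2 * c * s)) * (2 * b (U s w) (U s v) - 2 * c * \<Phi> s)"
        by (auto intro!: derivative_eq_intros der simp: algebra_simps)
      moreover have "exp (- (2 * c * s)) * (2 * b (U s w) (U s v) - 2 * c * \<Phi> s) \<le> 0"
        using bd[of s] by (intro mult_nonneg_nonpos) auto
      ultimately show "\<exists>y. DERIV (\<lambda>s. exp (- (2 * c * s)) * \<Phi> s) s :> y \<and> y \<le> 0" by blast
    qed
    then show ?thesis using True \<Phi>0 by (simp add: \<Phi>_def[of t] exp_minus field_simps)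
  next
    case False
    have "exp (2 * c * t) * \<Phi> t \<le> exp (2 * c * 0) * \<Phi> 0"
    proof (rule DERIV_nonneg_imp_nondecreasing[where f = "\<lambda>s. exp (2 * c * s) * \<Phi> s"])
      fix s :: real
      have "DERIV (\<lambda>s. exp (2 * c * s) * \<Phi> s) s :> exp (2 * c * s) * (2 * b (U s w) (U s v) + 2 * c * \<Phi> s)"
        by (auto intro!: derivative_eq_intros der simp: algebra_simps)
      moreover have "exp (2 * c * s) * (2 * b (U s w) (U s v) + 2 * c * \<Phi> s) \<ge> 0"
        using bd[of s] by (intro mult_nonneg_nonneg) auto
      ultimately show "\<exists>y. DERIV (\<lambda>s. exp (2 * c * s) * \<Phi> s) s :> y \<and> y \<ge> 0" by blast
    qed (use False in auto)
    then show ?thesis using False \<Phi>0 by (simp add: \<Phi>_def[of t] exp_minus field_simps)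
  qed
qed

text \<open>Density of the domain extends the bound: \<open>b\<close> is continuous for the
  seminorm, and by isometry \<open>U t (v n)\<close> approaches \<open>U t u\<close> at the same
  rate as \<open>v n\<close> approaches \<open>u\<close>.\<close>

theorem gronwall:
  assumes u: "u \<in> X"
  shows "b (U t u) (U t u) \<le> exp (2 * c * \<bar>t\<bar>) * b u u"
proof -
  have "\<exists>v w. generates v w \<and> q v u < 1 / real (Suc n)" for n
    using generator_dense[OF u, of "1 / real (Suc n)"] by (metis of_nat_0_less_iff zero_less_Suc zero_less_divide_1_iff)
  then obtain v w where gen: "\<And>n. generates (v n) (w n)" and q: "\<And>n. q (v n) u < 1 / real (Suc n)"
    by metis
  have v: "v n \<in> X" for n using gen by (simp add: generates_def)
  have "(\<lambda>n. q (v n) u) \<longlonglongrightarrow> 0"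
    by (rule tendsto_sandwich[OF _ _ tendsto_const LIMSEQ_inverse_real_of_nat])
       (use q v u in \<open>auto simp: inverse_eq_divide intro!: less_imp_le always_eventually\<close>)
  note q0 = this
  have lim: "(\<lambda>n. b (x n) (x n)) \<longlonglongrightarrow> b y y"
    if x: "\<And>n. x n \<in> X" "y \<in> X" "\<And>n. q (x n) y = q (v n) u" for x y
  proof -
    have est: "\<bar>b (x n) (x n) - b y y\<bar> \<le> C * (sqrt (q (v n) u) * (sqrt (q (v n) u))) + C * (sqrt (q (v n) u) * nrm y) + C * (sqrt (q (v n) u) * nrm y)" for n
    proof -
      let ?d = "lin 1 (x n) (-1) y"
      have d: "?d \<in> X" using x by simp
      have "b (x n) (x n) - b y y = (b (x n) ?d - b y ?d) + (b (x n) y - b y y) + (b (x n) y - b y y)"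
        using x d by (simp add: b_lin b_sym[of "x n" ?d] b_sym[of y ?d] b_sym[of y "x n"])
      moreover have nd: "nrm ?d = sqrt (q (v n) u)" by (simp only: nrm_def q_def[symmetric] x(3))
      ultimately show ?thesis
        using b_diff_le[OF x(1)[of n] x(2) d] b_diff_le[OF x(1)[of n] x(2) x(2)]
        unfolding x(3) nd by linarith
    qed
    have "(\<lambda>n. C * (sqrt (q (v n) u) * (sqrt (q (v n) u))) + C * (sqrt (q (v n) u) * nrm y) + C * (sqrt (q (v n) u) * nrm y))
        \<longlonglongrightarrow> C * (sqrt 0 * sqrt 0) + C * (sqrt 0 * nrm y) + C * (sqrt 0 * nrm y)"
      by (intro tendsto_intros q0)
    then show ?thesis
      by (rule tendsto_if_close) (use est in auto)
  qed
  show ?thesis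
  proof (rule LIMSEQ_le)
    show "(\<lambda>n. b (U t (v n)) (U t (v n))) \<longlonglongrightarrow> b (U t u) (U t u)"
      by (rule lim) (use u v q_U in auto)
    show "(\<lambda>n. exp (2 * c * \<bar>t\<bar>) * b (v n) (v n)) \<longlonglongrightarrow> exp (2 * c * \<bar>t\<bar>) * b u u"
      by (intro tendsto_intros lim) (use u v in auto)
    show "\<exists>N. \<forall>n\<ge>N. b (U t (v n)) (U t (v n)) \<le> exp (2 * c * \<bar>t\<bar>) * b (v n) (v n)"
      using gronwall_generator[OF gen] by blast
  qed
qed

end

end

section \<open>Square integrable functions with values in a separable space\<close>

text \<open>Young's inequality with a free weight; it bounds integrals of norms by integrals of
  squares.\<close>

lemma le_half_weighted_square:
  fixes a y :: real
  assumes a: "a > 0"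
  shows "y \<le> (a * y\<^sup>2 + 1 / a) / 2"
proof -
  have "a * (a * y\<^sup>2 + 1 / a - 2 * y) = (a * y - 1)\<^sup>2"
    using a by (simp add: power2_eq_square algebra_simps)
  then have "0 \<le> a * (a * y\<^sup>2 + 1 / a - 2 * y)" by simp
  then have "0 \<le> a * y\<^sup>2 + 1 / a - 2 * y" using a by (simp add: zero_le_mult_iff)
  then show ?thesis by simp
qed

text \<open>The space \<open>H\<close> is only known to be separable and is no instance of the class
  \<open>second_countable_topology\<close>, on which the library measurability rules for sums rely.\<close>
locale separable_L2 = prob_space M
  for M :: "'e measure" +
  fixes D :: "'v::{real_inner,complete_space} set"
  assumes countable_D: "countable D" and dense_D: "closure D = UNIV"
begin

lemma dense_approx: "e > 0 \<Longrightarrow> \<exists>d\<in>D. norm (v - d) < e"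
  using dense_D closure_approachable[of v D] by (auto simp: dist_norm norm_minus_commute)

text \<open>Every open set is a countable union of balls with centre in \<open>D\<close> and
  rational radius, so distances to constants decide measurability.\<close>

lemma measurable_if_norms:
  assumes f: "\<And>c. (\<lambda>x. norm (f x - c :: 'v)) \<in> borel_measurable M"
  shows "f \<in> borel_measurable M"
proof (rule borel_measurableI)
  fix S :: "'v set" assume S: "open S"
  define I where "I = {(d, r). d \<in> D \<and> r \<in> \<rat> \<and> ball d r \<subseteq> S}"
  have "I \<subseteq> D \<times> \<rat>" by (auto simp: I_def)
  then have I: "countable I"
    using countable_D countable_rat by (blast intro: countable_subset countable_SIGMA)
  have "\<exists>(d, r)\<in>I. norm (v - d) < r" if v: "v \<in> S" for v
  proof -
    obtain e where e: "e > 0" "ball v e \<subseteq> S" using S v open_contains_ball by blast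
    obtain r where r: "r \<in> \<rat>" "0 < r" "r < e / 2" using Rats_dense_in_real[of 0 "e / 2"] e by auto
    obtain d where d: "d \<in> D" "norm (v - d) < r" using dense_approx r by blast
    have "ball d r \<subseteq> ball v e"
    proof
      fix y assume "y \<in> ball d r"
      then show "y \<in> ball v e"
        using dist_triangle[of v y d] d r by (simp add: dist_norm)
    qed
    then show ?thesis using d r e by (auto simp: I_def)
  qed
  then have "f -` S \<inter> space M = (\<Union>(d, r)\<in>I. {x \<in> space M. norm (f x - d) < r})"
    by (fastforce simp: I_def dist_norm norm_minus_commute subset_iff)
  also have "\<dots> \<in> sets M"
    by (rule sets.countable_UN''[OF I]) (use f in \<open>auto simp: case_prod_beta\<close>)
  finally show "f -` S \<inter> space M \<in> sets M" .
qed

lemma measurable_norm_minus_const: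
  assumes "f \<in> borel_measurable M"
  shows "(\<lambda>x. norm (f x - c :: 'v)) \<in> borel_measurable M"
  by (rule measurable_compose[OF assms borel_measurable_continuous_onI]) (intro continuous_intros)

text \<open>Avoids the measurability of the pair (f, g): norm (f x - g x) < r holds exactly if some
  \<open>d\<close> in \<open>D\<close> and rational \<open>s\<close> satisfy norm (f x - d) < s and
  norm (g x - d) < r - s. Sums, inner products and multiples are reduced to this.\<close>

lemma measurable_norm_diff:
  assumes f: "f \<in> borel_measurable M" and g: "g \<in> borel_measurable M"
  shows "(\<lambda>x. norm (f x - g x :: 'v)) \<in> borel_measurable M"
proof (subst borel_measurable_iff_less, intro allI)
  fix r :: real
  have "\<exists>d\<in>D. \<exists>s\<in>\<rat>. norm (v - d) < s \<and> norm (w - d) < r - s" if vw: "norm (v - w) < r" for v w :: 'v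
  proof -
    \<comment> \<open>\<open>s\<close> is spent twice, on the distance from \<open>v\<close> to
      \<open>d\<close> and on the slack left at \<open>w\<close>; hence half of the gap.\<close>
    obtain s where s: "s \<in> \<rat>" "0 < s" "s < (r - norm (v - w)) / 2"
      using Rats_dense_in_real[of 0 "(r - norm (v - w)) / 2"] vw by auto
    obtain d where d: "d \<in> D" "norm (v - d) < s" using dense_approx s by blast
    have "norm (w - d) \<le> norm (v - w) + norm (v - d)"
      using norm_triangle_ineq[of "w - v" "v - d"] by (simp add: norm_minus_commute)
    then show ?thesis using s d by (intro bexI[of _ d] bexI[of _ s]) auto
  qed
  moreover have "norm (v - w) < r" if "norm (v - d) < s" "norm (w - d) < r - s" for v w d :: 'v and s
    using norm_triangle_ineq[of "v - d" "d - w"] that by (simp add: norm_minus_commute)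
  ultimately have "{x \<in> space M. norm (f x - g x) < r} =
    (\<Union>(d, s)\<in>D \<times> \<rat>. {x \<in> space M. norm (f x - d) < s \<and> norm (g x - d) < r - s})"
    by (fastforce simp: Bex_def)
  also have "\<dots> \<in> sets M"
    using measurable_norm_minus_const[OF f] measurable_norm_minus_const[OF g]
    by (intro sets.countable_UN'' countable_SIGMA countable_D countable_rat) (auto simp: case_prod_beta)
  finally show "{x \<in> space M. norm (f x - g x) < r} \<in> sets M" .
qed

lemma measurable_lin:
  assumes f: "f \<in> borel_measurable M" and g: "g \<in> borel_measurable M"
  shows "(\<lambda>x. a *\<^sub>R f x + b *\<^sub>R g x :: 'v) \<in> borel_measurable M"
proof (rule measurable_if_norms)
  fix c
  have "(\<lambda>x. a *\<^sub>R f x) \<in> borel_measurable M" "(\<lambda>x. c - b *\<^sub>R g x) \<in> borel_measurable M"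
    by (rule measurable_compose[OF f borel_measurable_continuous_onI]
             measurable_compose[OF g borel_measurable_continuous_onI], intro continuous_intros)+
  from measurable_norm_diff[OF this]
  show "(\<lambda>x. norm (a *\<^sub>R f x + b *\<^sub>R g x - c)) \<in> borel_measurable M"
    by (simp add: algebra_simps)
qed

lemma measurable_norm:
  "f \<in> borel_measurable M \<Longrightarrow> (\<lambda>x. norm (f x :: 'v)) \<in> borel_measurable M"
  using measurable_norm_minus_const[of f 0] by simp

lemma measurable_inner:
  assumes f: "f \<in> borel_measurable M" and g: "g \<in> borel_measurable M"
  shows "(\<lambda>x. inner (f x) (g x :: 'v)) \<in> borel_measurable M"
proof -
  have "(\<lambda>x. ((norm (f x))\<^sup>2 + (norm (g x))\<^sup>2 - (norm (f x - g x))\<^sup>2) / 2) \<in> borel_measurable M"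
    using measurable_norm_diff[OF f g] measurable_norm[OF f] measurable_norm[OF g] by measurable
  moreover have "((norm v)\<^sup>2 + (norm w)\<^sup>2 - (norm (v - w))\<^sup>2) / 2 = inner v w" for v w :: 'v
    by (simp add: power2_norm_eq_inner inner_simps inner_commute)
  ultimately show ?thesis by simp
qed

text \<open>The squared norm of w f - c is a polynomial in w, the norm of f and the inner product of
  f with c, all of them real and measurable.\<close>

lemma measurable_scaleR:
  assumes w: "w \<in> borel_measurable M" and f: "f \<in> borel_measurable M"
  shows "(\<lambda>x. w x *\<^sub>R f x :: 'v) \<in> borel_measurable M"
proof (rule measurable_if_norms)
  fix c
  have "(\<lambda>x. inner (f x) c) \<in> borel_measurable M" by (rule measurable_inner[OF f]) simp
  then have "(\<lambda>x. sqrt ((w x)\<^sup>2 * (norm (f x))\<^sup>2 - 2 * w x * inner (f x) c + (norm c)\<^sup>2)) \<in> borel_measurable M"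
    using w measurable_norm[OF f] by measurable
  moreover have "sqrt (a\<^sup>2 * (norm v)\<^sup>2 - 2 * a * inner v c + (norm c)\<^sup>2) = norm (a *\<^sub>R v - c)" for a and v :: 'v
    unfolding norm_eq_sqrt_inner[of "a *\<^sub>R v - c"] power2_norm_eq_inner
    by (simp add: inner_simps inner_commute power2_eq_square algebra_simps)
  ultimately show "(\<lambda>x. norm (w x *\<^sub>R f x - c)) \<in> borel_measurable M" by simp
qed

lemma L2_measurable: "f \<in> L2 M \<Longrightarrow> f \<in> borel_measurable M"
  by (simp add: L2_def)

lemma L2_norm2: "f \<in> L2 M \<Longrightarrow> integrable M (\<lambda>x. (norm (f x))\<^sup>2)"
  by (simp add: L2_def)

lemma L2_dominated:
  assumes f: "f \<in> borel_measurable M" and g: "integrable M g"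
    and le: "\<And>x. x \<in> space M \<Longrightarrow> (norm (f x :: 'v))\<^sup>2 \<le> g x"
  shows "f \<in> L2 M"
  unfolding L2_def using f measurable_norm[OF f] le
  by (auto intro!: Bochner_Integration.integrable_bound[OF g] AE_I2 order_trans[OF _ abs_ge_self])

lemma L2_lin:
  assumes f: "f \<in> L2 M" and g: "g \<in> L2 M"
  shows "(\<lambda>x. a *\<^sub>R f x + b *\<^sub>R g x :: 'v) \<in> L2 M"
proof (rule L2_dominated)
  show "integrable M (\<lambda>x. 2 * a\<^sup>2 * (norm (f x))\<^sup>2 + 2 * b\<^sup>2 * (norm (g x))\<^sup>2)"
    using L2_norm2[OF f] L2_norm2[OF g] by auto
  fix x
  have "norm (a *\<^sub>R f x + b *\<^sub>R g x) \<le> \<bar>a\<bar> * norm (f x) + \<bar>b\<bar> * norm (g x)"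
    using norm_triangle_ineq[of "a *\<^sub>R f x" "b *\<^sub>R g x"] by simp
  then have "(norm (a *\<^sub>R f x + b *\<^sub>R g x))\<^sup>2 \<le> (\<bar>a\<bar> * norm (f x) + \<bar>b\<bar> * norm (g x))\<^sup>2"
    by (rule power_mono) simp
  also have "\<dots> \<le> 2 * (\<bar>a\<bar> * norm (f x))\<^sup>2 + 2 * (\<bar>b\<bar> * norm (g x))\<^sup>2"
    using sum_squares_bound[of "\<bar>a\<bar> * norm (f x)" "\<bar>b\<bar> * norm (g x)"] by (simp add: power2_sum)
  finally show "(norm (a *\<^sub>R f x + b *\<^sub>R g x))\<^sup>2 \<le> 2 * a\<^sup>2 * (norm (f x))\<^sup>2 + 2 * b\<^sup>2 * (norm (g x))\<^sup>2"
    by (simp add: power_mult_distrib)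
qed (use f g in \<open>auto intro: measurable_lin simp: L2_def\<close>)

lemma L2_diff: "f \<in> L2 M \<Longrightarrow> g \<in> L2 M \<Longrightarrow> (\<lambda>x. f x - g x :: 'v) \<in> L2 M"
  using L2_lin[of f g 1 "-1"] by simp

lemma L2_add: "f \<in> L2 M \<Longrightarrow> g \<in> L2 M \<Longrightarrow> (\<lambda>x. f x + g x :: 'v) \<in> L2 M"
  using L2_lin[of f g 1 1] by simp

lemma L2_scaleR:
  assumes w: "w \<in> borel_measurable M" "\<And>x. \<bar>w x\<bar> \<le> c" and f: "f \<in> L2 M"
  shows "(\<lambda>x. w x *\<^sub>R f x :: 'v) \<in> L2 M"
proof (rule L2_dominated)
  show "integrable M (\<lambda>x. c\<^sup>2 * (norm (f x))\<^sup>2)" using L2_norm2[OF f] by simp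
  show "(norm (w x *\<^sub>R f x))\<^sup>2 \<le> c\<^sup>2 * (norm (f x))\<^sup>2" for x
    using power_mono[OF w(2)[of x], of 2] by (simp add: power_mult_distrib mult_right_mono)
qed (use w f in \<open>auto intro: measurable_scaleR simp: L2_def\<close>)

lemma L2_bounded:
  assumes "f \<in> borel_measurable M" "\<And>x. norm (f x :: 'v) \<le> c"
  shows "f \<in> L2 M"
  by (rule L2_dominated[of _ "\<lambda>_. c\<^sup>2"]) (use assms in \<open>auto intro: power_mono\<close>)

lemma integrable_inner:
  assumes f: "f \<in> L2 M" and g: "g \<in> L2 M"
  shows "integrable M (\<lambda>x. inner (f x) (g x :: 'v))"
proof (rule Bochner_Integration.integrable_bound)
  show "integrable M (\<lambda>x. (norm (f x))\<^sup>2 + (norm (g x))\<^sup>2)"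
    using L2_norm2[OF f] L2_norm2[OF g] by simp
  show "(\<lambda>x. inner (f x) (g x)) \<in> borel_measurable M"
    using f g by (intro measurable_inner) (auto simp: L2_def)
  have "\<bar>inner v w\<bar> \<le> (norm v)\<^sup>2 + (norm w)\<^sup>2" for v w :: 'v
  proof -
    have "0 \<le> norm v * norm w" by simp
    then show ?thesis
      using Cauchy_Schwarz_ineq2[of v w] sum_squares_bound[of "norm v" "norm w"] by linarith
  qed
  then show "AE x in M. norm (inner (f x) (g x)) \<le> norm ((norm (f x))\<^sup>2 + (norm (g x))\<^sup>2)"
    by (intro AE_I2) auto
qed

text \<open>A rapidly converging subsequence converges almost everywhere, and Fatou's lemma shows
  that its pointwise limit is the limit of the whole sequence in mean square.\<close>

lemma Riesz_Fischer:
  fixes f :: "nat \<Rightarrow> 'e \<Rightarrow> 'v"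
  assumes f: "\<And>n. f n \<in> L2 M"
    and cauchy: "\<And>e. e > 0 \<Longrightarrow> \<exists>N. \<forall>m\<ge>N. \<forall>n\<ge>N. (LINT x|M. (norm (f m x - f n x))\<^sup>2) < e"
  shows "\<exists>p\<in>L2 M. (\<lambda>n. LINT x|M. (norm (f n x - p x))\<^sup>2) \<longlonglongrightarrow> 0"
proof -
  let ?q = "\<lambda>u v. LINT x|M. (norm (u x - v x :: 'v))\<^sup>2"
  \<comment> \<open>Squared distances below 4^-k, combined with Young's inequality of weight 2^k,
    give increments with integral at most 2^-k.\<close>
  have "\<exists>N. \<forall>m\<ge>N. \<forall>n\<ge>N. ?q (f m) (f n) < (1/4) ^ k" for k :: nat
    by (rule cauchy) simp
  then obtain N where N: "\<And>k m n. m \<ge> N k \<Longrightarrow> n \<ge> N k \<Longrightarrow> ?q (f m) (f n) < (1/4) ^ k"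
    by metis
  \<comment> \<open>The sum makes the indices dominate all earlier thresholds, so that
    \<open>g k\<close> and \<open>g (Suc k)\<close> are both past \<open>N k\<close>; the summand
    \<open>k\<close> makes them tend to infinity.\<close>
  define r where "r k = k + (\<Sum>i\<le>k. N i)" for k
  have rN: "r k \<ge> N k" for k unfolding r_def by (simp add: member_le_sum trans_le_add2)
  have r1: "r (Suc k) \<ge> N k" for k using rN[of k] by (simp add: r_def)
  have rk: "r k \<ge> k" for k by (simp add: r_def)
  define g where "g k = f (r k)" for k
  have g: "g k \<in> L2 M" and gm: "g k \<in> borel_measurable M" for k using f by (auto simp: g_def L2_def)
  define d where "d k x = norm (g (Suc k) x - g k x)" for k x
  have dm [measurable]: "d k \<in> borel_measurable M" for k
    unfolding d_def by (rule measurable_norm_diff[OF gm gm])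
  have d2: "integrable M (\<lambda>x. (d k x)\<^sup>2)" for k
    unfolding d_def by (rule L2_norm2[OF L2_diff[OF g g]])
  have amgm: "d k x \<le> (2 ^ k * (d k x)\<^sup>2 + (1/2) ^ k) / 2" for k x
  proof -
    have "d k x \<le> (2 ^ k * (d k x)\<^sup>2 + 1 / 2 ^ k) / 2" by (rule le_half_weighted_square) simp
    then show ?thesis by (simp add: power_one_over)
  qed
  have dint: "integrable M (d k)" for k
  proof (rule Bochner_Integration.integrable_bound)
    show "integrable M (\<lambda>x. (2 ^ k * (d k x)\<^sup>2 + (1/2) ^ k) / 2)" using d2[of k] by simp
    show "AE x in M. norm (d k x) \<le> norm ((2 ^ k * (d k x)\<^sup>2 + (1/2) ^ k) / 2)"
      using amgm[of k] by (intro AE_I2) (auto simp: d_def intro!: order_trans[OF amgm[unfolded d_def]])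
  qed simp
  have dle: "(LINT x|M. d k x) \<le> (1/2) ^ k" for k
  proof -
    have "(LINT x|M. d k x) \<le> (LINT x|M. (2 ^ k * (d k x)\<^sup>2 + (1/2) ^ k) / 2)"
      using dint d2[of k] amgm by (intro integral_mono) auto
    also have "\<dots> = (2 ^ k * (LINT x|M. (d k x)\<^sup>2) + (1/2) ^ k) / 2"
      using d2[of k] by (simp add: prob_space)
    also have "\<dots> \<le> (2 ^ k * (1/4) ^ k + (1/2) ^ k) / 2"
      using N[OF r1 rN, of k] by (simp add: d_def g_def)
    also have "(2::real) ^ k * (1/4) ^ k = (1/2) ^ k" by (simp flip: power_mult_distrib)
    finally show ?thesis by simp
  qed
  define S where "S = {x \<in> space M. (\<Sum>k. ennreal (d k x)) \<noteq> top}"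
  have S [measurable]: "S \<in> sets M" unfolding S_def by measurable
  have "(\<integral>\<^sup>+x. (\<Sum>k. ennreal (d k x)) \<partial>M) = (\<Sum>k. \<integral>\<^sup>+x. ennreal (d k x) \<partial>M)"
    by (rule nn_integral_suminf) measurable
  also have "\<dots> = (\<Sum>k. ennreal (LINT x|M. d k x))"
    using dint by (subst nn_integral_eq_integral) (auto simp: d_def)
  also have "\<dots> \<le> (\<Sum>k. ennreal ((1/2) ^ k))"
    by (intro suminf_le ennreal_leI dle) auto
  also have "\<dots> = ennreal (\<Sum>k. (1/2) ^ k)"
    by (rule suminf_ennreal2) (auto intro: summable_geometric)
  also have "\<dots> < top" by simp
  finally have "AE x in M. (\<Sum>k. ennreal (d k x)) \<noteq> top"
    using nn_integral_noteq_infinite[of "\<lambda>x. \<Sum>k. ennreal (d k x)" M] by simp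
  then have AES: "AE x in M. x \<in> S" by (auto simp: S_def)
  have conv: "convergent (\<lambda>k. g k x)" if "x \<in> S" for x
  proof -
    have "summable (\<lambda>k. d k x)"
      using that summable_suminf_not_top[of "\<lambda>k. d k x"] by (auto simp: S_def d_def)
    then have C: "Cauchy (\<lambda>n. \<Sum>k<n. d k x)"
      by (intro convergent_Cauchy) (simp add: summable_iff_convergent)
    have "dist (g (m + n) x) (g m x) \<le> (\<Sum>k<m + n. d k x) - (\<Sum>k<m. d k x)" for m n
    proof (induction n)
      case (Suc n)
      have "dist (g (Suc (m + n)) x) (g m x) \<le> d (m + n) x + dist (g (m + n) x) (g m x)"
        using dist_triangle[of "g (Suc (m + n)) x" "g m x" "g (m + n) x"] by (simp add: d_def dist_norm)
      then show ?case using Suc by simp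
    qed simp
    then have le: "dist (g n x) (g m x) \<le> dist (\<Sum>k<n. d k x) (\<Sum>k<m. d k x)" if "m \<le> n" for m n
      using that by (auto simp: le_iff_add dist_real_def intro: order_trans[OF _ abs_ge_self])
    have "dist (g m x) (g n x) \<le> dist (\<Sum>k<m. d k x) (\<Sum>k<n. d k x)" for m n
      using le[of m n] le[of n m] by (cases "m \<le> n") (auto simp: dist_commute)
    then have "Cauchy (\<lambda>k. g k x)"
      using C unfolding Cauchy_def by (meson le_less_trans)
    then show ?thesis by (rule Cauchy_convergent)
  qed
  \<comment> \<open>The value 0 off the null set where convergence may fail makes \<open>p\<close>
    an everywhere limit of measurable functions.\<close>
  define p where "p x = (if x \<in> S then lim (\<lambda>k. g k x) else 0)" for x
  have plim: "(\<lambda>k. if x \<in> S then g k x else 0) \<longlonglongrightarrow> p x" for x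
    using conv[of x] by (auto simp: p_def convergent_LIMSEQ_iff)
  have pm: "p \<in> borel_measurable M"
  proof (rule measurable_if_norms)
    fix c
    show "(\<lambda>x. norm (p x - c)) \<in> borel_measurable M"
    proof (rule borel_measurable_LIMSEQ_real)
      show "(\<lambda>k. norm ((if x \<in> S then g k x else 0) - c)) \<longlonglongrightarrow> norm (p x - c)" for x
        by (intro tendsto_intros plim)
      have "(\<lambda>x. if x \<in> S then norm (g k x - c) else norm c) \<in> borel_measurable M" for k
        using measurable_norm_minus_const[OF gm, of k c] by measurable
      moreover have "norm ((if x \<in> S then g k x else 0) - c) = (if x \<in> S then norm (g k x - c) else norm c)" for k x
        by simp
      ultimately show "(\<lambda>x. norm ((if x \<in> S then g k x else 0) - c)) \<in> borel_measurable M" for k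
        by simp
    qed
  qed
  have key: "integrable M (\<lambda>x. (norm (f n x - p x))\<^sup>2) \<and> ?q (f n) p \<le> e"
    if e: "e \<ge> 0" and n: "\<And>k. k \<ge> K \<Longrightarrow> ?q (f n) (g k) \<le> e" for n e K
  proof -
    have m: "(\<lambda>x. norm (f n x - g k x)) \<in> borel_measurable M" for k
      using measurable_norm_diff gm f by (simp add: L2_def)
    have mp: "(\<lambda>x. norm (f n x - p x)) \<in> borel_measurable M"
      using measurable_norm_diff pm f by (simp add: L2_def)
    have "(\<integral>\<^sup>+x. ennreal ((norm (f n x - p x))\<^sup>2) \<partial>M)
        = (\<integral>\<^sup>+x. liminf (\<lambda>k. ennreal ((norm (f n x - g k x))\<^sup>2)) \<partial>M)"
    proof (rule nn_integral_cong_AE)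
      show "AE x in M. ennreal ((norm (f n x - p x))\<^sup>2) = liminf (\<lambda>k. ennreal ((norm (f n x - g k x))\<^sup>2))"
        using AES
      proof eventually_elim
        case (elim x)
        have "(\<lambda>k. g k x) \<longlonglongrightarrow> p x" using plim[of x] elim by simp
        then have "(\<lambda>k. ennreal ((norm (f n x - g k x))\<^sup>2)) \<longlonglongrightarrow> ennreal ((norm (f n x - p x))\<^sup>2)"
          by (intro tendsto_intros)
        then show ?case by (intro lim_imp_Liminf[symmetric]) auto
      qed
    qed
    also have "\<dots> \<le> liminf (\<lambda>k. \<integral>\<^sup>+x. ennreal ((norm (f n x - g k x))\<^sup>2) \<partial>M)"
      by (intro nn_integral_liminf measurable_compose[OF _ measurable_ennreal] borel_measurable_power m)
    also have "\<dots> \<le> ennreal e"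
    proof (rule Liminf_le)
      show "\<forall>\<^sub>F k in sequentially. (\<integral>\<^sup>+x. ennreal ((norm (f n x - g k x))\<^sup>2) \<partial>M) \<le> ennreal e"
        unfolding eventually_sequentially
      proof (intro exI[of _ K] allI impI)
        fix k assume "k \<ge> K"
        then show "(\<integral>\<^sup>+x. ennreal ((norm (f n x - g k x))\<^sup>2) \<partial>M) \<le> ennreal e"
          using n L2_norm2[OF L2_diff[OF f g]]
          by (subst nn_integral_eq_integral) (auto intro: ennreal_leI)
      qed
    qed simp
    finally have le: "(\<integral>\<^sup>+x. ennreal ((norm (f n x - p x))\<^sup>2) \<partial>M) \<le> ennreal e" .
    have int: "integrable M (\<lambda>x. (norm (f n x - p x))\<^sup>2)"
    proof (rule integrableI_bounded)
      show "(\<lambda>x. (norm (f n x - p x))\<^sup>2) \<in> borel_measurable M" using mp by measurable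
      show "(\<integral>\<^sup>+x. ennreal (norm ((norm (f n x - p x))\<^sup>2)) \<partial>M) < \<infinity>"
        using le by (simp add: le_less_trans)
    qed
    moreover have "?q (f n) p \<le> e"
      using le e nn_integral_eq_integral[OF int] by (simp add: ennreal_le_iff)
    ultimately show ?thesis by simp
  qed
  have tail: "\<exists>N. \<forall>n\<ge>N. integrable M (\<lambda>x. (norm (f n x - p x))\<^sup>2) \<and> ?q (f n) p \<le> e" if e: "e > 0" for e
  proof -
    obtain N0 where N0: "\<And>m n. m \<ge> N0 \<Longrightarrow> n \<ge> N0 \<Longrightarrow> ?q (f m) (f n) < e"
      using cauchy[OF e] by blast
    have "integrable M (\<lambda>x. (norm (f n x - p x))\<^sup>2) \<and> ?q (f n) p \<le> e" if "n \<ge> N0" for n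
    proof (rule key)
      show "?q (f n) (g k) \<le> e" if "k \<ge> N0" for k
        using N0[OF \<open>n \<ge> N0\<close>, of "r k"] that rk[of k] by (simp add: g_def)
    qed (use e in auto)
    then show ?thesis by blast
  qed
  have "p \<in> L2 M"
  proof -
    obtain n where "integrable M (\<lambda>x. (norm (f n x - p x))\<^sup>2)" using tail[of 1] by auto
    moreover have "(\<lambda>x. f n x - p x) \<in> borel_measurable M"
      using measurable_lin[of "f n" p 1 "-1"] f pm by (simp add: L2_def)
    ultimately have "(\<lambda>x. f n x - p x) \<in> L2 M" by (simp add: L2_def)
    from L2_diff[OF f this, of n] show ?thesis by simp
  qed
  moreover have "(\<lambda>n. ?q (f n) p) \<longlonglongrightarrow> 0"
  proof (rule LIMSEQ_I)
    fix e :: real assume e: "e > 0"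
    then obtain N where N: "\<And>n. n \<ge> N \<Longrightarrow> ?q (f n) p \<le> e / 2" using tail[of "e / 2"] by auto
    have "norm (?q (f n) p - 0) < e" if "n \<ge> N" for n
      using N[OF that] e by simp
    then show "\<exists>N. \<forall>n\<ge>N. norm (?q (f n) p - 0) < e" by blast
  qed
  ultimately show ?thesis by blast
qed

text \<open>The form is the real inner product, which on complex-valued functions is the real part
  of the hermitian one. The imaginary part is recovered by multiplying one argument by \<i>.\<close>

sublocale semi_hilbert "L2 M :: ('e \<Rightarrow> 'v) set" "\<lambda>a u b v x. a *\<^sub>R u x + b *\<^sub>R v x"
  "\<lambda>u v. LINT x|M. inner (u x) (v x)"
proof
  show "L2 M \<noteq> ({} :: ('e \<Rightarrow> 'v) set)" using L2_bounded[of "\<lambda>_. 0" 0] by auto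
  show "(\<lambda>x. a *\<^sub>R u x + b *\<^sub>R v x) \<in> L2 M" if "u \<in> L2 M" "v \<in> L2 M" for a b and u v :: "'e \<Rightarrow> 'v"
    using that by (rule L2_lin)
  show "(LINT x|M. inner (u x) (v x)) = (LINT x|M. inner (v x) (u x))" for u v :: "'e \<Rightarrow> 'v"
    by (simp add: inner_commute)
  show "(LINT x|M. inner (a *\<^sub>R u x + b *\<^sub>R v x) (z x)) =
      a * (LINT x|M. inner (u x) (z x)) + b * (LINT x|M. inner (v x) (z x))"
    if "u \<in> L2 M" "v \<in> L2 M" "z \<in> L2 M" for a b and u v z :: "'e \<Rightarrow> 'v"
    using that by (simp add: inner_add_left integrable_inner)
  show "0 \<le> (LINT x|M. inner (u x) (u x))" for u :: "'e \<Rightarrow> 'v" by simp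
  fix f :: "nat \<Rightarrow> 'e \<Rightarrow> 'v"
  assume "\<And>n. f n \<in> L2 M"
    "\<And>e. e > 0 \<Longrightarrow> \<exists>N. \<forall>m\<ge>N. \<forall>n\<ge>N. (LINT x|M. inner (1 *\<^sub>R f m x + - 1 *\<^sub>R f n x) (1 *\<^sub>R f m x + - 1 *\<^sub>R f n x)) < e"
  then show "\<exists>p\<in>L2 M. (\<lambda>n. LINT x|M. inner (1 *\<^sub>R f n x + - 1 *\<^sub>R p x) (1 *\<^sub>R f n x + - 1 *\<^sub>R p x)) \<longlonglongrightarrow> 0"
    using Riesz_Fischer[of f] by (simp add: power2_norm_eq_inner)
qed

end

section \<open>Separability of the Hilbert space\<close>

lemma semi_hilbert_closed_subspace:
  fixes X :: "'h::{real_inner,complete_space} set"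
  assumes X: "subspace X" "closed X"
  shows "semi_hilbert X (\<lambda>a x b y. a *\<^sub>R x + b *\<^sub>R y) inner"
proof
  show "X \<noteq> {}" using subspace_0[OF X(1)] by auto
  show "a *\<^sub>R x + b *\<^sub>R y \<in> X" if "x \<in> X" "y \<in> X" for a b x y
    using that X(1) by (simp add: subspace_add subspace_scale)
  fix f :: "nat \<Rightarrow> 'h"
  assume f: "\<And>n. f n \<in> X"
    and C: "\<And>e. e > 0 \<Longrightarrow> \<exists>N. \<forall>m\<ge>N. \<forall>n\<ge>N. inner (1 *\<^sub>R f m + - 1 *\<^sub>R f n) (1 *\<^sub>R f m + - 1 *\<^sub>R f n) < e"
  have "Cauchy f"
  proof (rule metric_CauchyI)
    fix e :: real assume e: "e > 0"
    then obtain N where N: "\<And>m n. m \<ge> N \<Longrightarrow> n \<ge> N \<Longrightarrow> inner (f m - f n) (f m - f n) < e\<^sup>2"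
      using C[of "e\<^sup>2"] by auto
    have "dist (f m) (f n) < e" if "m \<ge> N" "n \<ge> N" for m n
      using N[OF that] e by (simp add: dist_norm power2_norm_eq_inner[symmetric] power_less_imp_less_base[of _ 2])
    then show "\<exists>N. \<forall>m\<ge>N. \<forall>n\<ge>N. dist (f m) (f n) < e" by blast
  qed
  then obtain x where x: "f \<longlonglongrightarrow> x" using Cauchy_convergent convergentD by blast
  then have "x \<in> X" using f X(2) closed_sequentially by blast
  moreover have "(\<lambda>n. inner (f n - x) (f n - x)) \<longlonglongrightarrow> inner (x - x) (x - x)"
    by (intro tendsto_intros x)
  ultimately show "\<exists>x\<in>X. (\<lambda>n. inner (1 *\<^sub>R f n + - 1 *\<^sub>R x) (1 *\<^sub>R f n + - 1 *\<^sub>R x)) \<longlonglongrightarrow> 0"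
    by auto
qed (auto simp: inner_add_left intro: inner_commute)

text \<open>For \<open>l\<close> the inner product with a fixed vector, \<open>p\<close> is the
  orthogonal projection of that vector onto \<open>X\<close>.\<close>

lemma Riesz_representation:
  fixes X :: "'h::{real_inner,complete_space} set"
  assumes X: "subspace X" "closed X" and l: "bounded_linear l"
  obtains p where "p \<in> X" "\<And>z. z \<in> X \<Longrightarrow> inner p z = l z"
proof -
  interpret l: bounded_linear l by (rule l)
  interpret semi_hilbert X "\<lambda>a x b y. a *\<^sub>R x + b *\<^sub>R y" inner
    by (rule semi_hilbert_closed_subspace[OF X])
  obtain C where "\<And>x. norm (l x) \<le> norm x * C" using l.bounded by blast
  then have "\<exists>p\<in>X. \<forall>z\<in>X. inner p z = l z"
    by (intro Riesz[where C = C]) (auto simp: l.add l.scaleR nrm_def norm_eq_sqrt_inner mult.commute)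
  then show thesis using that by blast
qed

text \<open>Shows that the description in \<open>hadj\<close> is met by exactly one vector.\<close>

lemma inner_hadj:
  fixes iH :: "'h::{real_inner,complete_space} \<Rightarrow> 'e::real_normed_vector"
  assumes "bounded_linear iH" "bounded_linear xs"
  shows "inner (hadj iH xs) k = xs (iH k)"
proof -
  have "bounded_linear (\<lambda>k. xs (iH k))" using assms bounded_linear_compose by blast
  then obtain h where h: "\<And>k. inner h k = xs (iH k)"
    using Riesz_representation[of UNIV "\<lambda>k. xs (iH k)"] by (metis UNIV_I closed_UNIV subspace_UNIV)
  have "\<forall>k. inner (hadj iH xs) k = xs (iH k)"
    unfolding hadj_def
  proof (rule theI)
    show "\<forall>k. inner h k = xs (iH k)" using h by simp
    fix h' assume "\<forall>k. inner h' k = xs (iH k)"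
    then have "inner (h' - h) (h' - h) = 0" using h by (simp add: inner_diff_left)
    then show "h' = h" by simp
  qed
  then show ?thesis by simp
qed

text \<open>\<open>D\<close> consists of the rational combinations of \<open>C\<close>;
  approximating real scalars by rational ones makes the closure a real subspace.\<close>

lemma countable_dense_subspace:
  fixes C :: "'a::real_normed_vector set"
  assumes C: "countable C"
  obtains D where "countable D" "C \<subseteq> D" "subspace (closure D)"
proof
  \<comment> \<open>Combinations are coded as lists: countability is immediate and addition is
    concatenation.\<close>
  define s where "s l = (\<Sum>(q, d)\<leftarrow>l. real_of_rat q *\<^sub>R d)" for l :: "(rat \<times> 'a) list"
  define D where "D = s ` lists (UNIV \<times> C)"
  show "countable D" unfolding D_def by (intro countable_image countable_lists countable_SIGMA C) auto
  have "d \<in> D" if "d \<in> C" for d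
    unfolding D_def using that by (intro image_eqI[of _ s "[(1, d)]"]) (auto simp: s_def)
  then show "C \<subseteq> D" by auto
  have D0: "0 \<in> D" unfolding D_def by (intro image_eqI[of _ s "[]"]) (auto simp: s_def)
  have Dadd: "x + y \<in> D" if xy: "x \<in> D" "y \<in> D" for x y
  proof -
    obtain k l where "k \<in> lists (UNIV \<times> C)" "l \<in> lists (UNIV \<times> C)" "x = s k" "y = s l"
      using xy by (auto simp: D_def)
    then show ?thesis unfolding D_def by (intro image_eqI[of _ s "k @ l"]) (auto simp: s_def)
  qed
  have Dscale: "real_of_rat r *\<^sub>R x \<in> D" if x: "x \<in> D" for x r
  proof -
    obtain k where k: "k \<in> lists (UNIV \<times> C)" "x = s k" using x by (auto simp: D_def)
    have "s (map (\<lambda>(q, d). (r * q, d)) l) = real_of_rat r *\<^sub>R s l" for l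
      by (induction l) (auto simp: s_def of_rat_mult scaleR_add_right)
    moreover have "map (\<lambda>(q, d). (r * q, d)) k \<in> lists (UNIV \<times> C)" using k(1) by auto
    ultimately show ?thesis unfolding D_def k(2) by (metis image_eqI)
  qed
  show "subspace (closure D)"
    unfolding subspace_def
  proof (intro conjI ballI allI)
    show "0 \<in> closure D" using D0 closure_subset by blast
    show "x + y \<in> closure D" if "x \<in> closure D" "y \<in> closure D" for x y
    proof -
      obtain f g where "\<And>n. f n \<in> D" "f \<longlonglongrightarrow> x" "\<And>n. g n \<in> D" "g \<longlonglongrightarrow> y"
        using \<open>x \<in> _\<close> \<open>y \<in> _\<close> unfolding closure_sequential by blast
      then show ?thesis
        unfolding closure_sequential by (intro exI[of _ "\<lambda>n. f n + g n"]) (auto intro: tendsto_add Dadd)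
    qed
    show "c *\<^sub>R x \<in> closure D" if x: "x \<in> closure D" for c x
    proof -
      obtain f where f: "\<And>n. f n \<in> D" "f \<longlonglongrightarrow> x"
        using x unfolding closure_sequential by blast
      have "\<exists>r. c - 1 / real (Suc n) < real_of_rat r \<and> real_of_rat r < c" for n
        by (rule of_rat_dense) simp
      then obtain r where r: "\<And>n. c - 1 / real (Suc n) < real_of_rat (r n)" "\<And>n. real_of_rat (r n) < c"
        by metis
      have "(\<lambda>n. c - 1 / real (Suc n)) \<longlonglongrightarrow> c - 0"
        using LIMSEQ_inverse_real_of_nat by (intro tendsto_diff tendsto_const) (simp add: inverse_eq_divide)
      then have lim: "(\<lambda>n. c - 1 / real (Suc n)) \<longlonglongrightarrow> c" by simp
      have "(\<lambda>n. real_of_rat (r n)) \<longlonglongrightarrow> c"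
        by (rule tendsto_sandwich[OF _ _ lim tendsto_const])
           (use r in \<open>auto intro!: always_eventually less_imp_le\<close>)
      then show ?thesis
        unfolding closure_sequential using f
        by (intro exI[of _ "\<lambda>n. real_of_rat (r n) *\<^sub>R f n"]) (auto intro: tendsto_scaleR Dscale)
    qed
  qed
qed

text \<open>Functionals norming a dense sequence of the image separate its points, so their adjoint
  images are total.\<close>
lemma separable_if_injects_into_separable:
  fixes iH :: "'h::{real_inner,complete_space} \<Rightarrow> 'e::real_normed_vector"
  assumes iH: "bounded_linear iH" "inj iH" and D: "countable D" "range iH \<subseteq> closure D"
  obtains D' :: "'h set" where "countable D'" "closure D' = UNIV"
proof -
  have "\<exists>l. bounded_linear l \<and> (\<forall>x. \<bar>l x\<bar> \<le> norm x) \<and> l m = norm m" for m :: 'e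
    by (metis norming_functional)
  then obtain l where l: "\<And>m. bounded_linear (l m)" "\<And>m x. \<bar>l m x\<bar> \<le> norm x"
    "\<And>m::'e. l m m = norm m" by metis
  obtain D' where D': "countable D'" "(\<lambda>m. hadj iH (l m)) ` D \<subseteq> D'" "subspace (closure D')"
    using countable_dense_subspace[OF countable_image[OF D(1)]] by metis
  have "h \<in> closure D'" for h
  proof -
    obtain p where p: "p \<in> closure D'" "\<And>z. z \<in> closure D' \<Longrightarrow> inner p z = inner h z"
      using Riesz_representation[OF D'(3) closed_closure bounded_linear_inner_right[of h]] by metis
    \<comment> \<open>\<open>h - p\<close> is orthogonal to the adjoint images, which means that
      every norming functional vanishes at its image under \<open>iH\<close>.\<close>
    have z: "l m (iH (h - p)) = 0" if m: "m \<in> D" for m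
    proof -
      have "hadj iH (l m) \<in> closure D'" using D'(2) m closure_subset by fastforce
      then show ?thesis
        using p(2) inner_hadj[OF iH(1) l(1), of m "h - p"]
        by (simp add: inner_diff_right inner_commute[of p] inner_commute[of h])
    qed
    \<comment> \<open>For \<open>m\<close> close to y = \<open>iH (h - p)\<close>,
      \<open>l m\<close> sees only the error: norm m = \<open>l m\<close> (m - y) \<le> norm (m -
      y). Hence norm y is at most twice the error.\<close>
    have "norm (iH (h - p)) \<le> e" if e: "e > 0" for e
    proof -
      have "iH (h - p) \<in> closure D" using D(2) by auto
      then obtain m where m: "m \<in> D" "dist m (iH (h - p)) < e / 2"
        unfolding closure_approachable using e by (meson half_gt_zero)
      interpret lm: bounded_linear "l m" by (rule l)
      have "norm m = l m (m - iH (h - p))" using z[OF m(1)] l(3)[of m] by (simp add: lm.diff)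
      also have "\<dots> \<le> norm (m - iH (h - p))" using l(2)[of m "m - iH (h - p)"] by simp
      finally show ?thesis
        using m(2) norm_triangle_ineq4[of m "m - iH (h - p)"] by (simp add: dist_norm)
    qed
    then have "iH (h - p) = 0" by (metis dense_ge norm_le_zero_iff)
    moreover have "iH 0 = 0" using iH(1) by (simp add: linear_simps)
    ultimately have "h - p = 0" using iH(2) by (metis injD)
    then show ?thesis using p(1) by simp
  qed
  then show thesis using that D'(1) by blast
qed

text \<open>Inner regularity gives compact sets of mass close to 1. They are totally bounded, so the
  union of their finite nets is countable and dense in all of them.\<close>

lemma radon_separable_support:
  fixes M :: "'a::metric_space measure"
  assumes M: "prob_space M" "sets M = sets borel" "radon_measure M"
  obtains D where "countable D" "AE x in M. x \<in> closure D"
proof -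
  interpret prob_space M by (rule M)
  have "\<exists>K. compact K \<and> emeasure M K > ennreal (1 - 1 / real (Suc n))" for n
  proof -
    have "ennreal (1 - 1 / real (Suc n)) < emeasure M (space M)"
      unfolding emeasure_space_1 by (simp add: ennreal_less_one_iff)
    also have "emeasure M (space M) = (SUP K\<in>{K. compact K \<and> K \<subseteq> space M}. emeasure M K)"
      using M(3) sets.top[of M] unfolding radon_measure_def by blast
    finally show ?thesis by (auto simp: less_SUP_iff)
  qed
  then obtain K where K: "\<And>n. compact (K n)" "\<And>n. emeasure M (K n) > ennreal (1 - 1 / real (Suc n))"
    by metis
  have "\<exists>F. finite F \<and> K n \<subseteq> (\<Union>x\<in>F. ball x (1 / real (Suc m)))" for n m
  proof -
    have "seq_compact (K n)" using K(1) compact_eq_seq_compact_metric by blast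
    then show ?thesis using seq_compact_imp_totally_bounded by (metis of_nat_0_less_iff zero_less_Suc zero_less_divide_1_iff)
  qed
  then obtain F where F: "\<And>n m. finite (F n m)" "\<And>n m. K n \<subseteq> (\<Union>x\<in>F n m. ball x (1 / real (Suc m)))"
    by metis
  define D where "D = (\<Union>n m. F n m)"
  have "countable D" unfolding D_def
    by (rule countable_UN[OF countableI_type], rule countable_UN[OF countableI_type],
        rule countable_finite[OF F(1)])
  have KD: "K n \<subseteq> closure D" for n
  proof
    fix x assume x: "x \<in> K n"
    show "x \<in> closure D"
      unfolding closure_approachable
    proof (intro allI impI)
      fix e :: real assume "e > 0"
      then obtain m where m: "1 / real (Suc m) < e" using nat_approx_posE by blast
      obtain y where "y \<in> F n m" "dist y x < 1 / real (Suc m)" using F(2)[of n m] x by auto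
      then show "\<exists>y\<in>D. dist y x < e" using m by (auto simp: D_def intro: less_trans)
    qed
  qed
  have cl: "closure D \<in> sets M" unfolding M(2) by simp
  have "prob (closure D) \<ge> 1 - 1 / real (Suc n)" for n
  proof -
    have "ennreal (1 - 1 / real (Suc n)) \<le> emeasure M (closure D)"
      using K(2)[of n] emeasure_mono[OF KD cl, of n] by (simp add: less_le_trans less_imp_le)
    then show ?thesis by (simp add: emeasure_eq_measure)
  qed
  moreover have "(\<lambda>n. 1 - 1 / real (Suc n)) \<longlonglongrightarrow> 1 - 0"
    using LIMSEQ_inverse_real_of_nat by (intro tendsto_diff tendsto_const) (simp add: inverse_eq_divide)
  ultimately have "1 - 0 \<le> prob (closure D)" by (intro LIMSEQ_le_const2[of "\<lambda>n. 1 - 1 / real (Suc n)"]) auto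
  then have "AE x in M. x \<in> closure D"
    using prob_le_1[of "closure D"] cl by (intro AE_in_set_eq_1[THEN iffD2]) auto
  then show thesis using that \<open>countable D\<close> by blast
qed

text \<open>The complement of the support is a possibly uncountable union of open sets on which
  \<open>u\<close> vanishes almost everywhere. A compact subset of the exceptional set meets the
  matter in finitely many of them, so it is null, and inner regularity makes the whole set
  null.\<close>

lemma AE_zero_off_l2supp:
  fixes u :: "'e::t2_space \<Rightarrow> 'v::real_normed_vector"
  assumes M: "sets M = sets borel" "radon_measure M" and u: "u \<in> borel_measurable M"
  shows "AE x in M. x \<notin> l2supp M u \<longrightarrow> u x = 0"
proof -
  have sp: "space M = UNIV" using M(1) sets_eq_imp_space_eq space_borel by metis
  define \<V> where "\<V> = {V. open V \<and> (AE x in M. x \<in> V \<longrightarrow> u x = 0)}"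
  define N where "N = \<Union>\<V> \<inter> {x \<in> space M. u x \<noteq> 0}"
  have "u -` (- {0}) \<inter> space M \<in> sets M" by (rule measurable_sets[OF u]) auto
  moreover have "\<Union>\<V> \<in> sets M" unfolding M(1) by (rule borel_open) (auto simp: \<V>_def)
  ultimately have N: "N \<in> sets M"
    unfolding N_def using sp by (auto simp: vimage_def Collect_conj_eq intro!: sets.Int)
  have "emeasure M K = 0" if K: "compact K" "K \<subseteq> N" for K
  proof -
    have "K \<subseteq> \<Union>\<V>" "\<And>V. V \<in> \<V> \<Longrightarrow> open V" using K(2) by (auto simp: N_def \<V>_def)
    then obtain \<F> where F: "\<F> \<subseteq> \<V>" "finite \<F>" "K \<subseteq> \<Union>\<F>" using compactE[OF K(1)] by metis
    have "AE x in M. \<forall>V\<in>\<F>. x \<in> V \<longrightarrow> u x = 0"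
      using F by (intro AE_finite_allI) (auto simp: \<V>_def)
    then have "AE x in M. x \<notin> K"
      by eventually_elim (use F(3) K(2) in \<open>auto simp: N_def\<close>)
    then show ?thesis
      using K(1) M(1) AE_iff_null_sets[of K M] by (auto simp: compact_imp_closed)
  qed
  then have "emeasure M N = 0"
    using M(2) N unfolding radon_measure_def by (auto intro!: SUP_eq_const[of _ _ 0] simp: SUP_eq_iff)
  then have "AE x in M. x \<notin> N" using N by (intro AE_not_in) (auto simp: null_sets_def)
  then show ?thesis
    by eventually_elim (auto simp: N_def sp l2supp_def \<V>_def)
qed

text \<open>A functional that vanishes on the separable carrier of the measure vanishes almost
  everywhere, hence has zero covariance with any \<open>xs\<close> and kills
  \<open>Qcov M xs\<close>. By Hahn-Banach, \<open>Qcov M xs\<close> lies in the closed span of the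
  carrier.\<close>

lemma rkhs_separable:
  fixes M :: "'e::real_normed_vector measure"
  assumes M: "prob_space M" "sets M = sets borel" "radon_measure M"
  obtains D where "countable D" "rkhs M \<subseteq> closure D"
proof -
  obtain D0 where D0: "countable D0" "AE x in M. x \<in> closure D0"
    by (rule radon_separable_support[OF M])
  \<comment> \<open>the junk value of \<open>Qcov\<close>, taken if no representing vector exists\<close>
  define c :: 'e where "c = (THE h. False)"
  obtain D where D: "countable D" "insert c D0 \<subseteq> D" "subspace (closure D)"
    using countable_dense_subspace[of "insert c D0"] D0(1) by auto
  have Q: "Qcov M xs \<in> closure D" for xs
  proof -
    let ?P = "\<lambda>h. \<forall>ys. bounded_linear ys \<longrightarrow> ys h = (LINT x|M. xs x * ys x)"
    show ?thesis
    proof (cases "\<exists>h. ?P h")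
      case True
      then obtain h where h: "?P h" by blast
      have uniq: "h' = h" if "?P h'" for h'
      proof -
        obtain l where l: "bounded_linear l" "l (h' - h) = norm (h' - h)"
          by (rule norming_functional)
        then have "l h' = l h" using h[rule_format, OF l(1)] that[rule_format, OF l(1)] by argo
        moreover have "l (h' - h) = l h' - l h"
          using l(1) by (intro linear_diff bounded_linear.linear)
        ultimately show ?thesis using l(2) by simp
      qed
      have "Qcov M xs = h" unfolding Qcov_def by (rule the_equality[of ?P]) (rule h, rule uniq)
      moreover have "h \<in> closure D"
      proof (rule ccontr)
        assume "h \<notin> closure D"
        then obtain l where l: "bounded_linear l" "\<And>x. x \<in> closure D \<Longrightarrow> l x = 0" "l h \<noteq> (0::real)"
          using annihilating_functional[OF D(3) closed_closure] by metis
        have "closure D0 \<subseteq> closure D" using D(2) by (intro closure_mono) auto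
        then have "AE x in M. xs x * l x = 0"
          using D0(2) l(2) by (auto elim!: eventually_mono)
        then have "(LINT x|M. xs x * l x) = 0" by (rule integral_eq_zero_AE)
        then show False using h l by simp
      qed
      ultimately show ?thesis by simp
    next
      case False
      have "\<not> ?P h" for h
      proof
        assume "?P h"
        then have "\<exists>h. ?P h" by (rule exI[of ?P])
        then show False using False by (rule notE[rotated])
      qed
      \<comment> \<open>All unsatisfiable predicates are the same function, so \<open>THE\<close>
        returns the same value for every \<open>xs\<close> without representer.\<close>
      then have "?P = (\<lambda>h. False)" by (intro ext) (simp only: not_False_eq_True)
      then have "Qcov M xs = c" unfolding Qcov_def c_def by simp
      then show ?thesis using D(2) closure_subset[of D] by auto
    qed
  qed
  have "rkhs M \<subseteq> closure D"
  proof
    fix h assume "h \<in> rkhs M"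
    then obtain X where "(\<lambda>n. Qcov M (X n)) \<longlonglongrightarrow> h" by (auto simp: rkhs_def)
    then show "h \<in> closure D"
      by (rule closed_sequentially[OF closed_closure, rotated]) (rule Q)
  qed
  then show thesis using that D(1) by blast
qed

text \<open>The part of \<open>H\<close> that \<open>iH\<close> sends into the reproducing kernel
  space is dense, so continuity puts the whole range of \<open>iH\<close> into the closure of a
  countable set; injectivity brings separability back to \<open>H\<close>.\<close>

lemma separable_H:
  fixes iH :: "'h::{real_inner,complete_space} \<Rightarrow> 'e::real_normed_vector"
  assumes iH: "bounded_linear iH" "inj iH" and "A3 iH M"
    and M: "prob_space M" "sets M = sets borel" "radon_measure M"
  obtains D :: "'h set" where "countable D" "closure D = UNIV"
proof -
  obtain D where D: "countable D" "rkhs M \<subseteq> closure D" by (rule rkhs_separable[OF M])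
  have "range iH = iH ` closure (iH -` rkhs M)" using assms(3) by (simp add: A3_def)
  also have "\<dots> \<subseteq> closure (iH ` (iH -` rkhs M))"
    using iH(1) by (intro image_closure_subset)
      (auto intro: linear_continuous_on closure_subset[THEN subsetD])
  also have "\<dots> \<subseteq> closure D" using D(2) by (intro closure_minimal) auto
  finally show thesis using separable_if_injects_into_separable[OF iH D(1)] that by blast
qed

section \<open>The product rule for cylindrical weights\<close>

text \<open>The origin of the speed: the gradient of a functional of norm at most one is
  \<open>hadj iH l\<close>. The bound comes from pairing this vector with itself.\<close>

lemma norm_hadj_le:
  fixes iH :: "'h::{real_inner,complete_space} \<Rightarrow> 'e::real_normed_vector"
  assumes iH: "bounded_linear iH" and l: "bounded_linear l" "\<And>x. \<bar>l x\<bar> \<le> norm x"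
  shows "norm (hadj iH l) \<le> onorm iH"
proof -
  let ?h = "hadj iH l"
  have "norm ?h * norm ?h = l (iH ?h)"
    using inner_hadj[OF iH l(1), of ?h] by (simp flip: power2_norm_eq_inner power2_eq_square)
  also have "\<dots> \<le> norm (iH ?h)" using l(2)[of "iH ?h"] by simp
  also have "\<dots> \<le> onorm iH * norm ?h" by (rule onorm[OF iH])
  finally show ?thesis using le_of_square_le[of "norm ?h" "onorm iH"] onorm_pos_le[OF iH] by simp
qed

abbreviation trunc :: "nat \<Rightarrow> (nat \<Rightarrow> real) \<Rightarrow> nat \<Rightarrow> real" where
  "trunc n y \<equiv> \<lambda>j. if j < n then y j else 0"

lemma C1b_trunc: "C1b n \<phi> \<Longrightarrow> \<phi> (trunc n y) = \<phi> y"
  unfolding C1b_def by metis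

lemma C1b_cong:
  assumes "C1b n \<phi>" "\<And>j. j < n \<Longrightarrow> y j = z j"
  shows "\<phi> y = \<phi> z"
proof -
  have "trunc n y = trunc n z" using assms(2) by auto
  then show ?thesis using C1b_trunc[OF assms(1)] by metis
qed

lemma C1b_has_derivative:
  assumes "C1b n \<phi>" "j < n"
  shows "((\<lambda>s. \<phi> (y(j := s))) has_vector_derivative pd \<phi> j (y(j := s))) (at s)"
proof -
  have "(\<lambda>r. \<phi> ((y(j := s))(j := r))) differentiable (at ((y(j := s)) j))"
    using assms unfolding C1b_def by blast
  then have "(\<lambda>r. \<phi> (y(j := r))) differentiable (at s)" by simp
  moreover have "pd \<phi> j (y(j := s)) = vector_derivative (\<lambda>r. \<phi> (y(j := r))) (at s)"
    by (simp add: pd_def)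
  ultimately show ?thesis by (simp add: vector_derivative_works)
qed

lemma pd_eqI:
  assumes "((\<lambda>s. \<phi> (y(j := s))) has_vector_derivative d) (at (y j))"
  shows "pd \<phi> j y = d"
  unfolding pd_def using assms by (rule vector_derivative_at)

lemma pd_cong:
  assumes "C1b n \<phi>" "j < n" "\<And>i. i < n \<Longrightarrow> y i = z i"
  shows "pd \<phi> j y = pd \<phi> j z"
proof -
  have "(\<lambda>s. \<phi> (y(j := s))) = (\<lambda>s. \<phi> (z(j := s)))"
    using assms by (intro ext C1b_cong[OF assms(1)]) auto
  then show ?thesis using assms(2,3) by (simp add: pd_def)
qed

lemma C1b_pd_bound:
  assumes "C1b n \<phi>"
  obtains M where "\<And>j y. j < n \<Longrightarrow> norm (pd \<phi> j y) \<le> M j"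
proof -
  have "\<forall>j. \<exists>c. j < n \<longrightarrow> (\<forall>y. norm (pd \<phi> j y) \<le> c)"
    using assms unfolding C1b_def bounded_iff by (metis rangeI)
  then show thesis using that by metis
qed

text \<open>\<open>C1b\<close> speaks of partial derivatives only. Their boundedness gives a
  Lipschitz estimate in each coordinate, and changing the \<open>n\<close> relevant coordinates one
  by one gives joint continuity in the product topology.\<close>

lemma C1b_continuous:
  assumes \<phi>: "C1b n \<phi>"
  shows "continuous_on UNIV \<phi>"
proof -
  obtain M where M: "\<And>j y. j < n \<Longrightarrow> norm (pd \<phi> j y) \<le> M j" using C1b_pd_bound[OF \<phi>] by blast
  have step: "norm (\<phi> (y(j := s)) - \<phi> (y(j := t))) \<le> M j * \<bar>s - t\<bar>" if j: "j < n" for y j s t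
  proof -
    have "norm (\<phi> (y(j := s)) - \<phi> (y(j := t))) \<le> M j * norm (s - t)"
    proof (rule differentiable_bound[where S = UNIV and f = "\<lambda>r. \<phi> (y(j := r))"
          and f' = "\<lambda>r h. h *\<^sub>R pd \<phi> j (y(j := r))"])
      fix r
      show "((\<lambda>r. \<phi> (y(j := r))) has_derivative (\<lambda>h. h *\<^sub>R pd \<phi> j (y(j := r)))) (at r)"
        using C1b_has_derivative[OF \<phi> j] by (simp add: has_vector_derivative_def)
      show "onorm (\<lambda>h. h *\<^sub>R pd \<phi> j (y(j := r))) \<le> M j"
        using M[OF j] by (intro onorm_le) (auto simp: mult.commute intro!: mult_left_mono)
    qed auto
    then show ?thesis by simp
  qed
  have lip: "norm (\<phi> z - \<phi> y) \<le> (\<Sum>j<n. M j * \<bar>z j - y j\<bar>)" for y z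
  proof -
    \<comment> \<open>Interpolates from \<open>y\<close> to \<open>z\<close>, with the first
      \<open>k\<close> coordinates already exchanged.\<close>
    define m where "m k = (\<lambda>j. if j < k then z j else y j)" for k
    have "norm (\<phi> (m k) - \<phi> y) \<le> (\<Sum>j<k. M j * \<bar>z j - y j\<bar>)" if "k \<le> n" for k
      using that
    proof (induction k)
      case (Suc k)
      have "m (Suc k) = (m k)(k := z k)" "m k = (m k)(k := y k)" by (auto simp: m_def)
      then have "norm (\<phi> (m (Suc k)) - \<phi> (m k)) \<le> M k * \<bar>z k - y k\<bar>"
        using step[of k "m k" "z k" "y k"] Suc.prems by auto
      then show ?case
        using Suc norm_triangle_ineq[of "\<phi> (m (Suc k)) - \<phi> (m k)" "\<phi> (m k) - \<phi> y"] by simp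
    qed (simp add: m_def)
    moreover have "\<phi> (m n) = \<phi> z" by (rule C1b_cong[OF \<phi>]) (simp add: m_def)
    ultimately show ?thesis by fastforce
  qed
  have "isCont \<phi> y" for y
  proof -
    have "continuous_on UNIV (\<lambda>z. \<Sum>j<n. M j * \<bar>z j - y j\<bar>)"
      by (intro continuous_intros) auto
    then have "isCont (\<lambda>z. \<Sum>j<n. M j * \<bar>z j - y j\<bar>) y" by (simp add: continuous_on_eq_continuous_at)
    then have "((\<lambda>z. \<Sum>j<n. M j * \<bar>z j - y j\<bar>) \<longlongrightarrow> 0) (at y)" by (simp add: isCont_def)
    then have "((\<lambda>z. \<phi> z - \<phi> y) \<longlongrightarrow> 0) (at y)"
      by (rule Lim_null_comparison[rotated]) (use lip in auto)
    then show ?thesis by (simp add: isCont_def LIM_zero_iff)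
  qed
  then show ?thesis by (simp add: continuous_at_imp_continuous_on)
qed

lemma scaleHC_scaleR: "scaleHC (a *\<^sub>R c) p = a *\<^sub>R scaleHC c p"
  by (simp add: scaleHC_def algebra_simps)

lemma norm_scaleHC: "norm (scaleHC c (h, 0)) = cmod c * norm h"
  by (simp add: scaleHC_def norm_Pair cmod_def power_mult_distrib real_sqrt_mult flip: distrib_right)

lemma continuous_cyl:
  fixes xs :: "nat \<Rightarrow> 'e::real_normed_vector \<Rightarrow> real"
  assumes "\<And>j. j < n \<Longrightarrow> bounded_linear (xs j)"
  shows "continuous_on UNIV (cyl n xs)"
proof (rule continuous_on_coordinatewise_then_product)
  fix j
  show "continuous_on UNIV (\<lambda>x. cyl n xs x j)"
    using assms[of j] linear_continuous_on by (cases "j < n") (auto simp: cyl_def)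
qed

text \<open>Continuity gives measurability of the vector-valued sum directly, and boundedness gives
  square integrability for a probability measure.\<close>

lemma grad0_continuous_bounded:
  assumes "(F, G) \<in> grad0 iH"
  shows "continuous_on UNIV F" "continuous_on UNIV G" "\<exists>c. \<forall>x. norm (F x) \<le> c" "\<exists>c. \<forall>x. norm (G x) \<le> c"
proof -
  obtain n xs \<phi> where *: "C1b n \<phi>" "\<And>j. j < n \<Longrightarrow> bounded_linear (xs j)"
    "F = (\<lambda>x. \<phi> (cyl n xs x))"
    "G = (\<lambda>x. \<Sum>j<n. scaleHC (pd \<phi> j (cyl n xs x)) (hadj iH (xs j), 0))"
    using assms unfolding grad0_def by blast
  note cc = continuous_on_compose2[OF _ continuous_cyl[OF *(2)] subset_UNIV]
  show "continuous_on UNIV F" unfolding *(3) by (rule cc[OF C1b_continuous[OF *(1)]])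
  have pc: "continuous_on UNIV (\<lambda>x. pd \<phi> j (cyl n xs x))" if "j < n" for j
    by (rule cc) (use *(1) that in \<open>simp_all add: C1b_def\<close>)
  show "continuous_on UNIV G"
    unfolding *(4) scaleHC_def by (intro continuous_intros pc) auto
  show "\<exists>c. \<forall>x. norm (F x) \<le> c"
    using *(1) unfolding *(3) C1b_def bounded_iff by (metis rangeI)
  obtain M where M: "\<And>j y. j < n \<Longrightarrow> norm (pd \<phi> j y) \<le> M j" using C1b_pd_bound[OF *(1)] by blast
  have "norm (G x) \<le> (\<Sum>j<n. M j * norm (hadj iH (xs j)))" for x
    unfolding *(4) using M
    by (intro order_trans[OF norm_sum] sum_mono) (auto simp: norm_scaleHC intro!: mult_right_mono)
  then show "\<exists>c. \<forall>x. norm (G x) \<le> c" by blast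
qed

locale bounded_C1 =
  fixes w w' :: "real \<Rightarrow> real" and cw cw' :: real
  assumes deriv_w: "\<And>s. DERIV w s :> w' s"
    and cont_w': "continuous_on UNIV w'"
    and bound_w: "\<And>s. \<bar>w s\<bar> \<le> cw" and bound_w': "\<And>s. \<bar>w' s\<bar> \<le> cw'"
begin

lemma cont_w: "continuous_on UNIV w"
  using deriv_w by (intro continuous_at_imp_continuous_on) (auto intro: DERIV_isCont)

text \<open>The weight occupies a fresh coordinate \<open>n\<close> on which \<phi> does not depend,
  so each partial derivative acts on one factor only.\<close>

lemma C1b_times_weight:
  assumes \<phi>: "C1b n \<phi>"
  defines "\<psi> \<equiv> \<lambda>y. w (y n) *\<^sub>R \<phi> y"
  shows "C1b (Suc n) \<psi>" and "j < n \<Longrightarrow> pd \<psi> j y = w (y n) *\<^sub>R pd \<phi> j y"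
    and "pd \<psi> n y = w' (y n) *\<^sub>R \<phi> y"
proof -
  have dn: "((\<lambda>s. \<psi> (y(n := s))) has_vector_derivative w' (y n) *\<^sub>R \<phi> y) (at (y n))" for y
  proof -
    have "\<phi> (y(n := s)) = \<phi> y" for s by (rule C1b_cong[OF \<phi>]) simp
    then have "(\<lambda>s. \<psi> (y(n := s))) = (\<lambda>s. w s *\<^sub>R \<phi> y)" by (simp add: \<psi>_def)
    then show ?thesis by (auto intro!: derivative_eq_intros deriv_w)
  qed
  have dj: "((\<lambda>s. \<psi> (y(j := s))) has_vector_derivative w (y n) *\<^sub>R pd \<phi> j y) (at (y j))"
    if j: "j < n" for y j
  proof -
    have "(\<lambda>s. \<psi> (y(j := s))) = (\<lambda>s. w (y n) *\<^sub>R \<phi> (y(j := s)))" using j by (simp add: \<psi>_def)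
    moreover have "((\<lambda>s. \<phi> (y(j := s))) has_vector_derivative pd \<phi> j y) (at (y j))"
      using C1b_has_derivative[OF \<phi> j, of y "y j"] by simp
    ultimately show ?thesis by (auto intro!: derivative_eq_intros)
  qed
  show pj: "pd \<psi> j y = w (y n) *\<^sub>R pd \<phi> j y" if "j < n" for j y by (rule pd_eqI[OF dj[OF that]])
  show pn: "pd \<psi> n y = w' (y n) *\<^sub>R \<phi> y" for y by (rule pd_eqI[OF dn])
  have cw_y: "continuous_on UNIV (\<lambda>y::nat \<Rightarrow> real. w (y n))" "continuous_on UNIV (\<lambda>y::nat \<Rightarrow> real. w' (y n))"
    by (rule continuous_on_compose2[OF cont_w continuous_on_product_coordinates subset_UNIV]
             continuous_on_compose2[OF cont_w' continuous_on_product_coordinates subset_UNIV])+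
  have bd: "bounded (range (\<lambda>y. a (y n) *\<^sub>R f y))"
    if a: "\<And>s. \<bar>a s\<bar> \<le> c" and f: "bounded (range f)" for a c and f :: "(nat \<Rightarrow> real) \<Rightarrow> complex"
  proof -
    obtain M where M: "\<And>y. norm (f y) \<le> M" using f by (auto simp: bounded_iff)
    have "norm (a (y n) *\<^sub>R f y) \<le> c * M" for y
      using mult_mono[OF a[of "y n"] M[of y]] a[of 0] by (simp add: order_trans[OF abs_ge_zero])
    then show ?thesis by (auto simp: bounded_iff)
  qed
  have "(\<forall>y. (\<lambda>s. \<psi> (y(j := s))) differentiable at (y j)) \<and>
      continuous_on UNIV (pd \<psi> j) \<and> bounded (range (pd \<psi> j))" if j: "j < Suc n" for j
  proof (cases "j = n")
    case False
    with j have j: "j < n" by simp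
    have "pd \<psi> j = (\<lambda>y. w (y n) *\<^sub>R pd \<phi> j y)" using pj[OF j] by auto
    then show ?thesis
      using \<phi> j dj[OF j] differentiableI_vector
      by (auto intro!: continuous_intros cw_y bd[OF bound_w] simp: C1b_def)
  next
    case True
    have "pd \<psi> n = (\<lambda>y. w' (y n) *\<^sub>R \<phi> y)" using pn by auto
    then show ?thesis
      using \<phi> C1b_continuous[OF \<phi>] dn differentiableI_vector True
      by (auto intro!: continuous_intros cw_y bd[OF bound_w'] simp: C1b_def)
  qed
  moreover have "\<psi> y = \<psi> (trunc (Suc n) y)" for y
    using C1b_cong[OF \<phi>, of y "trunc (Suc n) y"] by (simp add: \<psi>_def)
  moreover have "bounded (range \<psi>)"
    unfolding \<psi>_def using \<phi> by (intro bd[OF bound_w]) (simp add: C1b_def)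
  ultimately show "C1b (Suc n) \<psi>" unfolding C1b_def by blast
qed

text \<open>The product rule as a formula for arbitrary pairs, so that it also applies to limits (f,
  k) in the closed gradient, where \<open>k\<close> is not given by differentiation.\<close>

definition weighted_grad ::
  "('h::real_inner \<Rightarrow> 'e::real_normed_vector) \<Rightarrow> ('e \<Rightarrow> real) \<Rightarrow> ('e \<Rightarrow> complex) \<Rightarrow> ('e \<Rightarrow> 'h \<times> 'h) \<Rightarrow> 'e \<Rightarrow> 'h \<times> 'h" where
  "weighted_grad iH l f k x = w (l x) *\<^sub>R k x + w' (l x) *\<^sub>R scaleHC (f x) (hadj iH l, 0)"

text \<open>\<open>l\<close> is appended to the list of functionals as number \<open>n\<close>, even
  if it occurs there already.\<close>

lemma grad0_times_weight:
  assumes FG: "(F, G) \<in> grad0 iH" and l: "bounded_linear l"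
  shows "(\<lambda>x. w (l x) *\<^sub>R F x, weighted_grad iH l F G) \<in> grad0 iH"
proof -
  obtain n xs \<phi> where *: "C1b n \<phi>" "\<And>j. j < n \<Longrightarrow> bounded_linear (xs j)"
    "F = (\<lambda>x. \<phi> (cyl n xs x))"
    "G = (\<lambda>x. \<Sum>j<n. scaleHC (pd \<phi> j (cyl n xs x)) (hadj iH (xs j), 0))"
    using FG unfolding grad0_def by blast
  define \<psi> where "\<psi> y = w (y n) *\<^sub>R \<phi> y" for y
  let ?ys = "xs(n := l)"
  note W = C1b_times_weight[OF *(1), folded \<psi>_def]
  have ph: "\<phi> (cyl (Suc n) ?ys x) = F x" for x
    unfolding *(3) by (rule C1b_cong[OF *(1)]) (simp add: cyl_def)
  have pp: "pd \<phi> j (cyl (Suc n) ?ys x) = pd \<phi> j (cyl n xs x)" if "j < n" for j x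
    by (rule pd_cong[OF *(1) that]) (simp add: cyl_def)
  have cn: "cyl (Suc n) ?ys x n = l x" for x by (simp add: cyl_def)
  show ?thesis
    unfolding grad0_def
  proof (intro CollectI case_prodI exI conjI)
    show "C1b (Suc n) \<psi>" by (rule W(1))
    show "\<forall>j<Suc n. bounded_linear (?ys j)" using *(2) l by (auto simp: less_Suc_eq)
    show "(\<lambda>x. w (l x) *\<^sub>R F x) = (\<lambda>x. \<psi> (cyl (Suc n) ?ys x))"
      by (simp add: \<psi>_def ph cn)
    show "weighted_grad iH l F G =
      (\<lambda>x. \<Sum>j<Suc n. scaleHC (pd \<psi> j (cyl (Suc n) ?ys x)) (hadj iH (?ys j), 0))"
    proof
      fix x
      have "(\<Sum>j<n. scaleHC (pd \<psi> j (cyl (Suc n) ?ys x)) (hadj iH (?ys j), 0)) = w (l x) *\<^sub>R G x"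
        unfolding *(4) scaleR_sum_right
        by (intro sum.cong) (auto simp: W(2) pp cn scaleHC_scaleR)
      then show "weighted_grad iH l F G x =
          (\<Sum>j<Suc n. scaleHC (pd \<psi> j (cyl (Suc n) ?ys x)) (hadj iH (?ys j), 0))"
        by (simp add: weighted_grad_def W(3) cn ph scaleHC_scaleR)
    qed
  qed
qed

end

section \<open>The closed gradient, the Dirac operator and cylindrical weights\<close>

lemma l2norm_nonneg [simp]: "0 \<le> l2norm M u"
  by (simp add: l2norm_def)

lemma integrable_complexI:
  fixes f :: "'a \<Rightarrow> complex"
  assumes "integrable M (\<lambda>x. Re (f x))" "integrable M (\<lambda>x. Im (f x))"
  shows "integrable M f"
proof -
  have "integrable M (\<lambda>x. complex_of_real (Re (f x)) + \<i> * complex_of_real (Im (f x)))"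
    using assms by (intro Bochner_Integration.integrable_add integrable_mult_right integrable_of_real)
  then show ?thesis by (simp flip: complex_eq)
qed

lemma l2norm_dominated:
  assumes "integrable M (\<lambda>x. (norm (v x))\<^sup>2)" "\<And>x. norm (u x) \<le> c * norm (v x)" "0 \<le> c"
  shows "l2norm M u \<le> c * l2norm M v"
proof -
  have "(LINT x|M. (norm (u x))\<^sup>2) \<le> (LINT x|M. c\<^sup>2 * (norm (v x))\<^sup>2)"
  proof (rule integral_mono')
    show "(norm (u x))\<^sup>2 \<le> c\<^sup>2 * (norm (v x))\<^sup>2" for x
      using power_mono[OF assms(2)[of x] norm_ge_zero, of 2] by (simp add: power_mult_distrib)
  qed (use assms(1) in auto)
  then have "l2norm M u \<le> sqrt (c\<^sup>2 * (LINT x|M. (norm (v x))\<^sup>2))"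
    by (simp add: l2norm_def)
  then show ?thesis using assms(3) by (simp add: l2norm_def real_sqrt_mult)
qed

lemma (in semi_hilbert) nrm_triangle:
  assumes "x \<in> X" "y \<in> X"
  shows "nrm (lin 1 x 1 y) \<le> nrm x + nrm y"
proof -
  have "B (lin 1 x 1 y) (lin 1 x 1 y) \<le> (nrm x + nrm y)\<^sup>2"
    using Cauchy_Schwarz[OF assms] assms sym[OF assms]
    by (simp add: power2_eq_square algebra_simps)
  then show ?thesis
    using assms by (simp add: nrm_def[of "lin 1 x 1 y"] real_le_lsqrt del: lin_left lin_right)
qed

context separable_L2
begin

lemma l2norm_eq_nrm: "l2norm M u = nrm (u :: 'e \<Rightarrow> 'v)"
  by (simp add: l2norm_def nrm_def power2_norm_eq_inner)

lemma l2norm_triangle: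
  "u \<in> L2 M \<Longrightarrow> v \<in> L2 M \<Longrightarrow> l2norm M (\<lambda>x. u x + v x :: 'v) \<le> l2norm M u + l2norm M v"
  using nrm_triangle[of u v] by (simp add: l2norm_eq_nrm)

end

lemma separable_L2_complex: "prob_space M \<Longrightarrow> \<exists>D::complex set. separable_L2 M D"
proof -
  assume M: "prob_space M"
  obtain D :: "complex set" where D: "countable D" "\<And>X. open X \<Longrightarrow> X \<noteq> {} \<Longrightarrow> \<exists>d\<in>D. d \<in> X"
    using countable_dense_exists by blast
  have "closure D = UNIV"
  proof (rule ccontr)
    assume "closure D \<noteq> UNIV"
    then obtain d where "d \<in> D" "d \<in> - closure D" using D(2)[of "- closure D"] by auto
    then show False using closure_subset[of D] by auto
  qed
  then show ?thesis using M D(1) by (auto simp: separable_L2_def separable_L2_axioms_def)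
qed

lemma separable_L2_Times:
  assumes "separable_L2 M D" "separable_L2 M D'"
  shows "separable_L2 M (D \<times> D')"
  using assms by (auto simp: separable_L2_def separable_L2_axioms_def closure_Times)

locale hilbert_embedding = prob_space \<mu>
  for \<mu> :: "'e::real_normed_vector measure" +
  fixes iH :: "'h::{real_inner,complete_space} \<Rightarrow> 'e" and DH :: "'h set"
  assumes iH: "bounded_linear iH" and sets_\<mu>: "sets \<mu> = sets borel"
    and DH: "countable DH" "closure DH = UNIV"
begin

definition DC :: "complex set" where "DC = (SOME D. separable_L2 \<mu> D)"

text \<open>The prefixes \<open>C\<close>, \<open>Hr\<close>, \<open>H\<close> and \<open>V\<close>
  stand for values in the complex numbers, in the real space, in its complexification (pairs), and
  in the direct sum on which the Dirac operator acts.\<close>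

sublocale C: separable_L2 \<mu> DC
  unfolding DC_def by (rule someI_ex, rule separable_L2_complex, unfold_locales)

sublocale Hr: separable_L2 \<mu> DH
  by unfold_locales (use DH in auto)

sublocale H: separable_L2 \<mu> "DH \<times> DH"
  by (rule separable_L2_Times; unfold_locales)

sublocale V: separable_L2 \<mu> "DC \<times> (DH \<times> DH)"
  by (rule separable_L2_Times; unfold_locales)

lemma measurable_continuous:
  fixes f :: "'e \<Rightarrow> 'a::topological_space"
  assumes "continuous_on UNIV f"
  shows "f \<in> borel_measurable \<mu>"
  using borel_measurable_continuous_onI[OF assms] measurable_cong_sets[OF sets_\<mu> refl] by metis

lemma measurable_of_functional:
  fixes a :: "real \<Rightarrow> real"
  assumes "bounded_linear l" "continuous_on UNIV a"
  shows "(\<lambda>x. a (l x)) \<in> borel_measurable \<mu>"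
  by (intro measurable_continuous continuous_on_compose2[OF assms(2)] linear_continuous_on assms) auto

lemma grad0_L2:
  assumes "(F, G) \<in> grad0 iH"
  shows "F \<in> L2 \<mu>" "G \<in> L2 \<mu>"
  using grad0_continuous_bounded[OF assms] C.L2_bounded H.L2_bounded measurable_continuous by metis+

lemma L2_scaleHC:
  assumes f: "f \<in> L2 \<mu>"
  shows "(\<lambda>x. scaleHC (f x) (h, 0 :: 'h)) \<in> L2 \<mu>"
proof (rule H.L2_dominated)
  show "(\<lambda>x. scaleHC (f x) (h, 0)) \<in> borel_measurable \<mu>"
    by (rule measurable_compose[OF C.L2_measurable[OF f] borel_measurable_continuous_onI])
       (auto simp: scaleHC_def intro!: continuous_intros)
  show "integrable \<mu> (\<lambda>x. (norm h)\<^sup>2 * (norm (f x))\<^sup>2)" using C.L2_norm2[OF f] by simp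
  show "(norm (scaleHC (f x) (h, 0 :: 'h)))\<^sup>2 \<le> (norm h)\<^sup>2 * (norm (f x))\<^sup>2" for x
    by (simp add: norm_scaleHC power_mult_distrib)
qed

lemma scaleHC_diff: "scaleHC (a - b) (h, 0) = scaleHC a (h, 0) - scaleHC b (h, 0 :: 'h)"
  by (simp add: scaleHC_def algebra_simps)

lemma Re_cinnerH: "Re (cinnerH p q) = inner p q"
  by (simp add: cinnerH_def inner_prod_def)

lemma Im_cinnerH: "Im (cinnerH p q) = - inner (scaleHC \<i> p) q"
  by (simp add: cinnerH_def scaleHC_def inner_prod_def)

lemma norm_scaleHC_i: "norm (scaleHC \<i> p) = norm p"
  by (simp add: scaleHC_def norm_prod_def norm_Pair)

lemma L2_scaleHC_i:
  assumes "k \<in> L2 \<mu>"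
  shows "(\<lambda>x. scaleHC \<i> (k x) :: 'h \<times> 'h) \<in> L2 \<mu>"
proof (rule H.L2_dominated[OF _ H.L2_norm2[OF assms]])
  show "(\<lambda>x. scaleHC \<i> (k x)) \<in> borel_measurable \<mu>"
    by (rule measurable_compose[OF H.L2_measurable[OF assms] borel_measurable_continuous_onI])
       (auto simp: scaleHC_def intro!: continuous_intros)
qed (simp add: norm_scaleHC_i)

lemma integral_Im_cinnerH:
  assumes "k \<in> L2 \<mu>" "g \<in> L2 \<mu>"
  shows "Im (LINT x|\<mu>. cinnerH (k x) (g x)) = - (LINT x|\<mu>. inner (scaleHC \<i> (k x)) (g x :: 'h \<times> 'h))"
proof -
  have "integrable \<mu> (\<lambda>x. cinnerH (k x) (g x))"
    using H.integrable_inner[OF assms] H.integrable_inner[OF L2_scaleHC_i[OF assms(1)] assms(2)]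
    by (intro integrable_complexI) (simp_all add: Re_cinnerH Im_cinnerH)
  then show ?thesis by (subst integral_Im[symmetric]) (simp_all add: Im_cinnerH)
qed

lemma L2_times_i:
  assumes h: "h \<in> L2 \<mu>"
  shows "(\<lambda>x. \<i> * h x) \<in> L2 \<mu>"
  by (rule C.L2_dominated[OF _ C.L2_norm2[OF h]]) (use C.L2_measurable[OF h] in \<open>auto simp: norm_mult\<close>)

lemma integral_Im_cnj:
  assumes "f \<in> L2 \<mu>" "h \<in> L2 \<mu>"
  shows "Im (LINT x|\<mu>. f x * cnj (h x)) = (LINT x|\<mu>. inner (\<i> * h x) (f x))"
proof -
  note ih = L2_times_i[OF assms(2)]
  have eq: "Re (a * cnj b) = inner a b" "Im (a * cnj b) = inner (\<i> * b) a" for a b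
    by (simp_all add: inner_complex_def)
  have "integrable \<mu> (\<lambda>x. f x * cnj (h x))"
    using C.integrable_inner[OF assms] C.integrable_inner[OF ih assms(1)]
    by (intro integrable_complexI) (simp_all only: eq)
  then have "Im (LINT x|\<mu>. f x * cnj (h x)) = (LINT x|\<mu>. Im (f x * cnj (h x)))"
    by (rule integral_Im[symmetric])
  then show ?thesis by (simp only: eq)
qed

text \<open>\<open>Dirac\<close> provides square integrability of the four components separately, so
  the pairing is written as a sum of two component pairings.\<close>

lemma Dirac_inner_measurable:
  assumes vd: "(v, d) \<in> Dirac iH \<mu>"
  shows "(\<lambda>x. inner (iV (d x)) (v x)) \<in> borel_measurable \<mu>"
proof -
  have "(\<lambda>x. fst (v x)) \<in> L2 \<mu>" "(\<lambda>x. snd (d x)) \<in> L2 \<mu>" "(\<lambda>x. snd (v x)) \<in> L2 \<mu>" "(\<lambda>x. fst (d x)) \<in> L2 \<mu>"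
    using vd by (auto simp: Dirac_def gradH_def gradH_adj_def)
  then have "(\<lambda>x. inner (\<i> * fst (d x)) (fst (v x)) + inner (scaleHC \<i> (snd (d x))) (snd (v x))) \<in> borel_measurable \<mu>"
    by (intro borel_measurable_add borel_measurable_integrable C.integrable_inner H.integrable_inner
        L2_times_i L2_scaleHC_i)
  then show ?thesis by (simp add: iV_def scaleV_def inner_prod_def)
qed

end

locale weighted_embedding = hilbert_embedding \<mu> iH DH + bounded_C1 w w' cw cw'
  for \<mu> :: "'e::real_normed_vector measure" and iH :: "'h::{real_inner,complete_space} \<Rightarrow> 'e" and DH
    and w w' cw cw' +
  fixes l :: "'e \<Rightarrow> real"
  assumes l: "bounded_linear l" and l_le: "\<And>x. \<bar>l x\<bar> \<le> norm x"
begin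

lemma weight_measurable: "(\<lambda>x. w (l x)) \<in> borel_measurable \<mu>" "(\<lambda>x. w' (l x)) \<in> borel_measurable \<mu>"
  using measurable_of_functional[OF l] cont_w cont_w' by auto

lemma weighted_grad_L2:
  assumes "f \<in> L2 \<mu>" "k \<in> L2 \<mu>"
  shows "weighted_grad iH l f k \<in> L2 \<mu>"
  unfolding weighted_grad_def[abs_def]
  by (intro H.L2_add H.L2_scaleR[OF weight_measurable(1) bound_w] H.L2_scaleR[OF weight_measurable(2) bound_w']
      L2_scaleHC assms)

text \<open>Since \<open>w\<close> and \<open>w'\<close> are bounded, multiplication and the product
  rule formula are continuous in mean square, and the approximating cylindrical sequence can be
  multiplied termwise.\<close>

theorem gradH_times_weight:
  assumes "(f, k) \<in> gradH iH \<mu>"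
  shows "(\<lambda>x. w (l x) *\<^sub>R f x, weighted_grad iH l f k) \<in> gradH iH \<mu>"
proof -
  let ?h = "hadj iH l"
  obtain F G where f: "f \<in> L2 \<mu>" and k: "k \<in> L2 \<mu>"
    and FG: "\<And>n. (F n, G n) \<in> grad0 iH"
    and lim: "(\<lambda>n. l2norm \<mu> (\<lambda>x. F n x - f x)) \<longlonglongrightarrow> 0" "(\<lambda>n. l2norm \<mu> (\<lambda>x. G n x - k x)) \<longlonglongrightarrow> 0"
    using assms unfolding gradH_def l2lim_def by blast
  note FL = grad0_L2(1)[OF FG] and GL = grad0_L2(2)[OF FG]
  have dF: "(\<lambda>x. F n x - f x) \<in> L2 \<mu>" and dG: "(\<lambda>x. G n x - k x) \<in> L2 \<mu>" for n
    by (intro C.L2_diff H.L2_diff FL GL f k)+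
  have c: "0 \<le> cw" "0 \<le> cw'" using bound_w[of 0] bound_w'[of 0] by linarith+
  have e1: "l2norm \<mu> (\<lambda>x. w (l x) *\<^sub>R F n x - w (l x) *\<^sub>R f x) \<le> cw * l2norm \<mu> (\<lambda>x. F n x - f x)" for n
    using c bound_w by (intro l2norm_dominated C.L2_norm2 dF)
      (auto intro!: mult_right_mono simp flip: scaleR_diff_right)
  have e2: "l2norm \<mu> (\<lambda>x. weighted_grad iH l (F n) (G n) x - weighted_grad iH l f k x)
      \<le> cw * l2norm \<mu> (\<lambda>x. G n x - k x) + (cw' * norm ?h) * l2norm \<mu> (\<lambda>x. F n x - f x)" for n
  proof -
    let ?a = "\<lambda>x. w (l x) *\<^sub>R (G n x - k x)" and ?b = "\<lambda>x. w' (l x) *\<^sub>R scaleHC (F n x - f x) (?h, 0)"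
    have "(\<lambda>x. weighted_grad iH l (F n) (G n) x - weighted_grad iH l f k x) = (\<lambda>x. ?a x + ?b x)"
      by (auto simp: weighted_grad_def scaleHC_diff algebra_simps)
    moreover have "l2norm \<mu> (\<lambda>x. ?a x + ?b x) \<le> l2norm \<mu> ?a + l2norm \<mu> ?b"
      by (intro H.l2norm_triangle H.L2_scaleR[OF weight_measurable(1) bound_w]
          H.L2_scaleR[OF weight_measurable(2) bound_w'] L2_scaleHC dF dG)
    moreover have "l2norm \<mu> ?a \<le> cw * l2norm \<mu> (\<lambda>x. G n x - k x)"
      using c bound_w by (intro l2norm_dominated H.L2_norm2 dG) (auto intro!: mult_right_mono)
    moreover have "l2norm \<mu> ?b \<le> (cw' * norm ?h) * l2norm \<mu> (\<lambda>x. F n x - f x)"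
    proof (intro l2norm_dominated C.L2_norm2 dF)
      show "norm (?b x) \<le> cw' * norm ?h * norm (F n x - f x)" for x
        using mult_right_mono[OF bound_w'[of "l x"], of "norm ?h * norm (F n x - f x)"]
        by (simp add: norm_scaleHC mult.commute mult.left_commute)
    qed (use c in auto)
    ultimately show ?thesis by simp
  qed
  have "l2lim \<mu> (\<lambda>n x. w (l x) *\<^sub>R F n x) (\<lambda>x. w (l x) *\<^sub>R f x)"
    unfolding l2lim_def
    by (rule tendsto_if_close[OF tendsto_mult[OF tendsto_const[of cw] lim(1)]]) (use e1 in auto)
  moreover have "l2lim \<mu> (\<lambda>n. weighted_grad iH l (F n) (G n)) (weighted_grad iH l f k)"
    unfolding l2lim_def
    by (rule tendsto_if_close[OF tendsto_add[OF tendsto_mult[OF tendsto_const[of cw] lim(2)]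
          tendsto_mult[OF tendsto_const[of "cw' * norm ?h"] lim(1)]]])
       (use e2 in auto)
  moreover have "(\<lambda>x. w (l x) *\<^sub>R f x) \<in> L2 \<mu>"
    by (rule C.L2_scaleR[OF weight_measurable(1) bound_w f])
  ultimately show ?thesis
    unfolding gradH_def using weighted_grad_L2[OF f k] grad0_times_weight[OF FG l]
    by (auto intro!: exI[of _ "\<lambda>n x. w (l x) *\<^sub>R F n x"] exI[of _ "\<lambda>n. weighted_grad iH l (F n) (G n)"])
qed

text \<open>By symmetry of the Dirac operator, the imaginary part of \<open>\<langle>D v, w v\<rangle>\<close> only sees its commutator with
  the weight, that is, the gradient of the weight.\<close>
lemma Dirac_energy_estimate:
  assumes vd: "(v, d) \<in> Dirac iH \<mu>" and v: "v \<in> L2 \<mu>"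
    and c: "\<And>s. onorm iH * \<bar>w' s\<bar> \<le> 2 * c * w s"
  shows "\<bar>LINT x|\<mu>. w (l x) * inner (iV (d x)) (v x)\<bar> \<le> c * (LINT x|\<mu>. w (l x) * inner (v x) (v x))"
proof -
  define f where "f = (\<lambda>x. fst (v x))"
  define G where "G = (\<lambda>x. snd (v x))"
  define g where "g = (\<lambda>x. fst (d x))"
  define k where "k = (\<lambda>x. snd (d x))"
  let ?s = "\<lambda>x. scaleHC (f x) (hadj iH l, 0 :: 'h)"
  have fk: "(f, k) \<in> gradH iH \<mu>" and Gg: "(G, g) \<in> gradH_adj iH \<mu>"
    using vd by (auto simp: Dirac_def f_def G_def g_def k_def)
  have f: "f \<in> L2 \<mu>" and k: "k \<in> L2 \<mu>" using fk by (auto simp: gradH_def)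
  have G: "G \<in> L2 \<mu>" and g: "g \<in> L2 \<mu>" using Gg by (auto simp: gradH_adj_def)
  note ws = weight_measurable(1) bound_w and ws' = weight_measurable(2) bound_w'
  have wf: "(\<lambda>x. w (l x) *\<^sub>R f x) \<in> L2 \<mu>" by (rule C.L2_scaleR[OF ws f])
  have wG: "(\<lambda>x. w (l x) *\<^sub>R G x) \<in> L2 \<mu>" by (rule H.L2_scaleR[OF ws G])
  have w'G: "(\<lambda>x. w' (l x) *\<^sub>R G x) \<in> L2 \<mu>" by (rule H.L2_scaleR[OF ws' G])
  have si: "scaleHC \<i> (a *\<^sub>R p + b *\<^sub>R q) = a *\<^sub>R scaleHC \<i> p + b *\<^sub>R scaleHC \<i> q" for a b and p q :: "'h \<times> 'h"
    by (simp add: scaleHC_def algebra_simps)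
  \<comment> \<open>The adjoint relation for (G, g) is tested with the weighted pair, which is again
    in the gradient.\<close>
  have "(LINT x|\<mu>. cinnerH (weighted_grad iH l f k x) (G x)) = (LINT x|\<mu>. (w (l x) *\<^sub>R f x) * cnj (g x))"
  proof -
    have "\<forall>(f, k)\<in>gradH iH \<mu>. (LINT x|\<mu>. cinnerH (k x) (G x)) = (LINT x|\<mu>. f x * cnj (g x))"
      using Gg by (simp add: gradH_adj_def)
    from bspec[OF this gradH_times_weight[OF fk]] show ?thesis by simp
  qed
  then have "Im (LINT x|\<mu>. cinnerH (weighted_grad iH l f k x) (G x)) = Im (LINT x|\<mu>. (w (l x) *\<^sub>R f x) * cnj (g x))"
    by simp
  then have 1: "- (LINT x|\<mu>. inner (scaleHC \<i> (weighted_grad iH l f k x)) (G x))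
      = (LINT x|\<mu>. inner (\<i> * g x) (w (l x) *\<^sub>R f x))"
    unfolding integral_Im_cinnerH[OF weighted_grad_L2[OF f k] G] integral_Im_cnj[OF wf g] .
  have ig: "(\<lambda>x. \<i> * g x) \<in> L2 \<mu>" by (rule L2_times_i[OF g])
  note int = C.integrable_inner[OF ig wf] H.integrable_inner[OF L2_scaleHC_i[OF k] wG]
    H.integrable_inner[OF L2_scaleHC_i[OF L2_scaleHC[OF f, of "hadj iH l"]] w'G]
  have 2: "(LINT x|\<mu>. inner (scaleHC \<i> (weighted_grad iH l f k x)) (G x)) =
      (LINT x|\<mu>. inner (scaleHC \<i> (k x)) (w (l x) *\<^sub>R G x)) + (LINT x|\<mu>. inner (scaleHC \<i> (?s x)) (w' (l x) *\<^sub>R G x))"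
    unfolding Bochner_Integration.integral_add[OF int(2,3), symmetric]
    by (simp add: weighted_grad_def si inner_add_left)
  have "(LINT x|\<mu>. w (l x) * inner (iV (d x)) (v x)) =
      (LINT x|\<mu>. inner (\<i> * g x) (w (l x) *\<^sub>R f x)) + (LINT x|\<mu>. inner (scaleHC \<i> (k x)) (w (l x) *\<^sub>R G x))"
    unfolding Bochner_Integration.integral_add[OF int(1,2), symmetric]
    by (simp add: iV_def scaleV_def f_def G_def g_def k_def inner_prod_def distrib_left)
  \<comment> \<open>The two pairings containing \<open>w\<close> cancel by the adjoint relation;
    what remains is the term with \<open>w'\<close>.\<close>
  also have "\<dots> = - (LINT x|\<mu>. inner (scaleHC \<i> (?s x)) (w' (l x) *\<^sub>R G x))"
    using 1 2 by simp
  finally have eq: "\<bar>LINT x|\<mu>. w (l x) * inner (iV (d x)) (v x)\<bar>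
      = norm (LINT x|\<mu>. inner (scaleHC \<i> (?s x)) (w' (l x) *\<^sub>R G x))" by simp
  also have "\<dots> \<le> (LINT x|\<mu>. c * (w (l x) * inner (v x) (v x)))"
  proof (rule order_trans[OF integral_norm_bound], rule integral_mono[OF integrable_norm[OF int(3)]])
    show "integrable \<mu> (\<lambda>x. c * (w (l x) * inner (v x) (v x)))"
      using V.integrable_inner[OF V.L2_scaleR[OF ws v] v] by simp
    fix x
    let ?n = "norm (f x)" and ?m = "norm (G x)" and ?cw = "c * w (l x)"
    have "norm (inner (scaleHC \<i> (?s x)) (w' (l x) *\<^sub>R G x)) \<le> norm (scaleHC \<i> (?s x)) * norm (w' (l x) *\<^sub>R G x)"
      using Cauchy_Schwarz_ineq2 by (metis real_norm_def)
    also have "\<dots> = (norm (hadj iH l) * \<bar>w' (l x)\<bar>) * (?n * ?m)"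
      by (simp add: norm_scaleHC_i norm_scaleHC)
    also have "\<dots> \<le> (onorm iH * \<bar>w' (l x)\<bar>) * (?n * ?m)"
      using norm_hadj_le[OF iH l l_le] by (intro mult_right_mono) auto
    also have "\<dots> \<le> (2 * c * w (l x)) * (?n * ?m)"
      using c by (intro mult_right_mono) auto
    also have "\<dots> = ?cw * (2 * ?n * ?m)" by simp
    \<comment> \<open>The remaining term pairs f with G, so the factor 2 of the hypothesis on
      \<open>w'\<close> is absorbed by 2 |f| |G| \<le> |f|^2 + |G|^2.\<close>
    also have "\<dots> \<le> ?cw * (?n\<^sup>2 + ?m\<^sup>2)"
    proof (rule mult_left_mono[OF sum_squares_bound])
      have "0 \<le> onorm iH * \<bar>w' (l x)\<bar>" using onorm_pos_le[OF iH] by simp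
      then show "0 \<le> ?cw" using c[of "l x"] by linarith
    qed
    also have "?n\<^sup>2 + ?m\<^sup>2 = inner (v x) (v x)"
      by (simp add: f_def G_def power2_norm_eq_inner inner_prod_def)
    finally show "norm (inner (scaleHC \<i> (?s x)) (w' (l x) *\<^sub>R G x)) \<le> c * (w (l x) * inner (v x) (v x))"
      by (simp add: mult.assoc)
  qed
  finally show ?thesis by simp
qed

end

section \<open>Finite speed of propagation\<close>

lemma scaleHC_of_real: "scaleHC (of_real a) p = a *\<^sub>R p"
  by (simp add: scaleHC_def prod_eq_iff)

lemma scaleV_of_real: "scaleV (of_real a) p = a *\<^sub>R p"
  by (simp add: scaleV_def scaleHC_of_real prod_eq_iff scaleR_conv_of_real)

locale dirac_group = hilbert_embedding \<mu> iH DH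
  for \<mu> :: "'e::real_normed_vector measure" and iH :: "'h::{real_inner,complete_space} \<Rightarrow> 'e" and DH +
  fixes U :: "real \<Rightarrow> ('e \<Rightarrow> complex \<times> ('h \<times> 'h)) \<Rightarrow> ('e \<Rightarrow> complex \<times> ('h \<times> 'h))"
  assumes U: "unitary_group_generated_by \<mu> (Dirac iH \<mu>) U"
begin

lemma integral_inner_cong:
  assumes "ae_eq \<mu> u v" "u \<in> L2 \<mu>" "v \<in> L2 \<mu>" "z \<in> L2 \<mu>"
  shows "(LINT x|\<mu>. inner (u x) (z x :: complex \<times> ('h \<times> 'h))) = (LINT x|\<mu>. inner (v x) (z x))"
proof (rule integral_cong_AE)
  show "AE x in \<mu>. inner (u x) (z x) = inner (v x) (z x)"
    using assms(1) unfolding ae_eq_def by eventually_elim simp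
qed (use assms V.L2_measurable V.measurable_inner in blast)+

lemmas U_parts = U[unfolded unitary_group_generated_by_def]

lemmas U_L2 = U_parts[THEN conjunct1, rule_format]
lemmas U_plus = U_parts[THEN conjunct2, THEN conjunct2, THEN conjunct1, rule_format]
lemmas U_scaleV = U_parts[THEN conjunct2, THEN conjunct2, THEN conjunct2, THEN conjunct1, rule_format]
lemmas U_l2norm = U_parts[THEN conjunct2, THEN conjunct2, THEN conjunct2, THEN conjunct2, THEN conjunct1, rule_format]
lemmas U_zero = U_parts[THEN conjunct2, THEN conjunct2, THEN conjunct2, THEN conjunct2, THEN conjunct2, THEN conjunct1, rule_format]
lemmas U_group = U_parts[THEN conjunct2, THEN conjunct2, THEN conjunct2, THEN conjunct2, THEN conjunct2, THEN conjunct2, THEN conjunct1, rule_format]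
lemmas U_continuous = U_parts[THEN conjunct2, THEN conjunct2, THEN conjunct2, THEN conjunct2, THEN conjunct2, THEN conjunct2, THEN conjunct2, THEN conjunct1, rule_format]
lemmas U_generator = U_parts[THEN conjunct2, THEN conjunct2, THEN conjunct2, THEN conjunct2, THEN conjunct2, THEN conjunct2, THEN conjunct2, THEN conjunct2, rule_format]

lemma U_lin_ae:
  assumes u: "u \<in> L2 \<mu>" and v: "v \<in> L2 \<mu>"
  shows "ae_eq \<mu> (U t (\<lambda>x. a *\<^sub>R u x + b *\<^sub>R v x)) (\<lambda>x. a *\<^sub>R U t u x + b *\<^sub>R U t v x)"
proof -
  have sc: "ae_eq \<mu> (U t (\<lambda>x. a *\<^sub>R u x)) (\<lambda>x. a *\<^sub>R U t u x)" if "u \<in> L2 \<mu>" for a u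
  proof -
    have "ae_eq \<mu> (U t (\<lambda>x. scaleV (of_real a) (u x))) (\<lambda>x. scaleV (of_real a) (U t u x))"
      by (rule U_scaleV[OF that])
    then show ?thesis by (simp add: scaleV_of_real)
  qed
  have L: "(\<lambda>x. a *\<^sub>R u x) \<in> L2 \<mu>" if "u \<in> L2 \<mu>" for a and u :: "'e \<Rightarrow> complex \<times> ('h \<times> 'h)"
    using V.L2_lin[OF that that, of a 0] by simp
  have "ae_eq \<mu> (U t (\<lambda>x. a *\<^sub>R u x + b *\<^sub>R v x)) (\<lambda>x. U t (\<lambda>x. a *\<^sub>R u x) x + U t (\<lambda>x. b *\<^sub>R v x) x)"
    by (rule U_plus[OF L[OF u] L[OF v]])
  then show ?thesis
    using sc[OF u, of a] sc[OF v, of b] unfolding ae_eq_def by eventually_elim simp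
qed

sublocale G: semi_hilbert_group "L2 \<mu> :: ('e \<Rightarrow> complex \<times> ('h \<times> 'h)) set"
  "\<lambda>a u b v x. a *\<^sub>R u x + b *\<^sub>R v x" "\<lambda>u v. LINT x|\<mu>. inner (u x) (v x)" U
proof
  fix u v z :: "'e \<Rightarrow> complex \<times> ('h \<times> 'h)" and s t a b :: real
  assume u: "u \<in> L2 \<mu>"
  show "U t u \<in> L2 \<mu>" by (rule U_L2[OF u])
  have "l2norm \<mu> (U t u) = l2norm \<mu> u" by (rule U_l2norm[OF u])
  then show "(LINT x|\<mu>. inner (U t u x) (U t u x)) = (LINT x|\<mu>. inner (u x) (u x))"
    by (simp add: l2norm_def power2_norm_eq_inner)
  note U0 = U_zero[OF u]
  have "((\<lambda>t. l2norm \<mu> (\<lambda>x. U t u x - U 0 u x)) \<longlongrightarrow> 0) (at 0)"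
    by (rule U_continuous[OF u])
  then have "((\<lambda>t. (l2norm \<mu> (\<lambda>x. U t u x - U 0 u x))\<^sup>2) \<longlongrightarrow> 0\<^sup>2) (at 0)" by (rule tendsto_power)
  moreover have "(l2norm \<mu> (\<lambda>x. U t u x - U 0 u x))\<^sup>2
      = (LINT x|\<mu>. inner (1 *\<^sub>R U t u x + - 1 *\<^sub>R u x) (1 *\<^sub>R U t u x + - 1 *\<^sub>R u x))" for t
  proof -
    have "(l2norm \<mu> (\<lambda>x. U t u x - U 0 u x))\<^sup>2 = (LINT x|\<mu>. (norm (U t u x - U 0 u x))\<^sup>2)"
      by (simp add: l2norm_def)
    also have "\<dots> = (LINT x|\<mu>. (norm (U t u x - u x))\<^sup>2)"
      using U0 V.L2_norm2[OF V.L2_diff[OF U_L2[OF u] U_L2[OF u]]] V.L2_norm2[OF V.L2_diff[OF U_L2[OF u] u]]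
      by (intro integral_cong_AE borel_measurable_integrable) (auto simp: ae_eq_def)
    finally show ?thesis by (simp add: power2_norm_eq_inner)
  qed
  ultimately show "((\<lambda>t. LINT x|\<mu>. inner (1 *\<^sub>R U t u x + - 1 *\<^sub>R u x) (1 *\<^sub>R U t u x + - 1 *\<^sub>R u x)) \<longlongrightarrow> 0) (at 0)"
    by simp
  {
    assume z: "z \<in> L2 \<mu>"
    show "(LINT x|\<mu>. inner (U 0 u x) (z x)) = (LINT x|\<mu>. inner (u x) (z x))"
      by (rule integral_inner_cong[OF U0 U_L2[OF u] u z])
    show "(LINT x|\<mu>. inner (U (s + t) u x) (z x)) = (LINT x|\<mu>. inner (U s (U t u) x) (z x))"
      by (intro integral_inner_cong U_group U_L2 u z)
  }
  assume v: "v \<in> L2 \<mu>" and z: "z \<in> L2 \<mu>"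
  have "(LINT x|\<mu>. inner (U t (\<lambda>x. a *\<^sub>R u x + b *\<^sub>R v x) x) (z x))
      = (LINT x|\<mu>. inner (a *\<^sub>R U t u x + b *\<^sub>R U t v x) (z x))"
    by (intro integral_inner_cong U_lin_ae U_L2 V.L2_lin u v z)
  then show "(LINT x|\<mu>. inner (U t (\<lambda>x. a *\<^sub>R u x + b *\<^sub>R v x) x) (z x))
      = a * (LINT x|\<mu>. inner (U t u x) (z x)) + b * (LINT x|\<mu>. inner (U t v x) (z x))"
    using U_L2[OF u] U_L2[OF v] z by (simp add: inner_add_left V.integrable_inner)
qed

lemma generates_Dirac:
  assumes "G.generates v w"
  obtains d where "(v, d) \<in> Dirac iH \<mu>" "ae_eq \<mu> w (\<lambda>x. iV (d x))"
proof -
  have v: "v \<in> L2 \<mu>" and w: "w \<in> L2 \<mu>"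
    and lim: "((\<lambda>t. V.q (\<lambda>x. (1 / t) *\<^sub>R U t v x + (- 1 / t) *\<^sub>R v x) w) \<longlongrightarrow> 0) (at 0)"
    using assms by (auto simp: G.generates_def)
  have "((\<lambda>t. sqrt (V.q (\<lambda>x. (1 / t) *\<^sub>R U t v x + (- 1 / t) *\<^sub>R v x) w)) \<longlongrightarrow> sqrt 0) (at 0)"
    by (intro tendsto_intros lim)
  moreover have "sqrt (V.q (\<lambda>x. (1 / t) *\<^sub>R U t v x + (- 1 / t) *\<^sub>R v x) w)
      = l2norm \<mu> (\<lambda>x. (1 / t) *\<^sub>R (U t v x - v x) - w x)" for t
    by (simp add: V.q_def l2norm_def power2_norm_eq_inner scaleR_diff_right)
  ultimately have "((\<lambda>t. l2norm \<mu> (\<lambda>x. (1 / t) *\<^sub>R (U t v x - v x) - w x)) \<longlongrightarrow> 0) (at 0)" by simp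
  then have "\<exists>d. (v, d) \<in> Dirac iH \<mu> \<and> ae_eq \<mu> w (\<lambda>x. iV (d x))"
    using U_generator[OF v w] by blast
  then show thesis using that by blast
qed

text \<open>The abstract Gronwall inequality for the weighted inner product \<open>b\<close>; the
  generator is \<i> times the Dirac operator, so the energy estimate is the required bound on
  \<open>b\<close>.\<close>

lemma energy_gronwall:
  assumes W: "weighted_embedding \<mu> iH DH w w' cw cw' l"
    and c: "\<And>s. onorm iH * \<bar>w' s\<bar> \<le> 2 * c * w s" and u: "u \<in> L2 \<mu>"
  shows "(LINT x|\<mu>. w (l x) * (norm (U t u x))\<^sup>2) \<le> exp (2 * c * \<bar>t\<bar>) * (LINT x|\<mu>. w (l x) * (norm (u x))\<^sup>2)"
proof -
  interpret W: weighted_embedding \<mu> iH DH w w' cw cw' l by (rule W)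
  define b where "b = (\<lambda>u v :: 'e \<Rightarrow> complex \<times> ('h \<times> 'h). LINT x|\<mu>. w (l x) * inner (u x) (v x))"
  have wL: "(\<lambda>x. w (l x) *\<^sub>R u x) \<in> L2 \<mu>" if "u \<in> L2 \<mu>" for u :: "'e \<Rightarrow> complex \<times> ('h \<times> 'h)"
    by (rule V.L2_scaleR[OF W.weight_measurable(1) W.bound_w that])
  have int: "integrable \<mu> (\<lambda>x. w (l x) * inner (u x) (v x))" if "u \<in> L2 \<mu>" "v \<in> L2 \<mu>"
    for u v :: "'e \<Rightarrow> complex \<times> ('h \<times> 'h)"
    using V.integrable_inner[OF wL[OF that(1)] that(2)] by simp
  have cw: "0 \<le> cw" using W.bound_w[of 0] by linarith
  have "b (U t u) (U t u) \<le> exp (2 * c * \<bar>t\<bar>) * b u u"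
  proof (rule G.gronwall[where b = b and C = cw and c = c, OF _ _ _ _ u])
    show "b (\<lambda>x. r *\<^sub>R u x + s *\<^sub>R v x) z = r * b u z + s * b v z"
      if "u \<in> L2 \<mu>" "v \<in> L2 \<mu>" "z \<in> L2 \<mu>" for u v z r s
      using int[OF that(1,3)] int[OF that(2,3)] unfolding b_def
      by (simp add: inner_add_left distrib_left mult.left_commute)
    show "b u v = b v u" if "u \<in> L2 \<mu>" "v \<in> L2 \<mu>" for u v by (simp add: b_def inner_commute)
    show "\<bar>b u v\<bar> \<le> cw * (V.nrm u * V.nrm v)" if u: "u \<in> L2 \<mu>" and v: "v \<in> L2 \<mu>" for u v
    proof -
      have "\<bar>b u v\<bar> \<le> V.nrm (\<lambda>x. w (l x) *\<^sub>R u x) * V.nrm v"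
        using V.Cauchy_Schwarz[OF wL[OF u] v] by (simp add: b_def)
      also have "V.nrm (\<lambda>x. w (l x) *\<^sub>R u x) \<le> cw * V.nrm u"
        unfolding V.l2norm_eq_nrm[symmetric] using cw W.bound_w
        by (intro l2norm_dominated V.L2_norm2 u) (auto intro!: mult_right_mono)
      finally show ?thesis using v by (simp add: mult.assoc mult_right_mono)
    qed
    show "\<bar>b w0 v\<bar> \<le> c * b v v" if gen: "G.generates v w0" for v w0
    proof -
      have v: "v \<in> L2 \<mu>" and w0: "w0 \<in> L2 \<mu>" using gen by (auto simp: G.generates_def)
      obtain d where d: "(v, d) \<in> Dirac iH \<mu>" "ae_eq \<mu> w0 (\<lambda>x. iV (d x))"
        by (rule generates_Dirac[OF gen])
      have "b w0 v = (LINT x|\<mu>. w (l x) * inner (iV (d x)) (v x))"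
        unfolding b_def
      proof (rule integral_cong_AE)
        show "AE x in \<mu>. w (l x) * inner (w0 x) (v x) = w (l x) * inner (iV (d x)) (v x)"
          using d(2) unfolding ae_eq_def by eventually_elim simp
        show "(\<lambda>x. w (l x) * inner (w0 x) (v x)) \<in> borel_measurable \<mu>"
          using int[OF w0 v] by simp
        show "(\<lambda>x. w (l x) * inner (iV (d x)) (v x)) \<in> borel_measurable \<mu>"
          by (intro borel_measurable_times W.weight_measurable Dirac_inner_measurable[OF d(1)])
      qed
      then show ?thesis using W.Dirac_energy_estimate[OF d(1) v c] by (simp add: b_def)
    qed
  qed
  then show ?thesis by (simp add: b_def power2_norm_eq_inner)
qed

end

text \<open>The functions \<open>s \<mapsto> arctan (\<eta> s) / \<eta>\<close> are bounded with slope at most one and tend to the identity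
  as \<open>\<eta> \<rightarrow> 0\<close>.\<close>
lemma arctan_weight:
  fixes \<alpha> \<eta> :: real
  assumes "\<alpha> \<ge> 0" "\<eta> > 0"
  defines "w \<equiv> \<lambda>s. exp (2 * \<alpha> * (arctan (\<eta> * s) / \<eta>))"
    and "w' \<equiv> \<lambda>s. 2 * \<alpha> / (1 + (\<eta> * s)\<^sup>2) * exp (2 * \<alpha> * (arctan (\<eta> * s) / \<eta>))"
  shows "bounded_C1 w w' (exp (\<alpha> * pi / \<eta>)) (2 * \<alpha> * exp (\<alpha> * pi / \<eta>))"
    and "\<And>s. \<bar>w' s\<bar> \<le> 2 * \<alpha> * w s"
proof -
  have pos: "1 + (\<eta> * s)\<^sup>2 \<ge> 1" for s by simp
  have w: "\<bar>w s\<bar> \<le> exp (\<alpha> * pi / \<eta>)" for s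
  proof -
    have "arctan (\<eta> * s) \<le> pi / 2" using arctan_ubound[of "\<eta> * s"] by simp
    then have "2 * \<alpha> * arctan (\<eta> * s) \<le> 2 * \<alpha> * (pi / 2)" using assms(1) by (intro mult_left_mono) auto
    then have "2 * \<alpha> * arctan (\<eta> * s) / \<eta> \<le> \<alpha> * pi / \<eta>" using assms(2) by (intro divide_right_mono) auto
    then show ?thesis by (simp add: w_def)
  qed
  have le: "\<bar>w' s\<bar> \<le> 2 * \<alpha> * w s" for s
  proof -
    have "2 * \<alpha> / (1 + (\<eta> * s)\<^sup>2) \<le> 2 * \<alpha>"
      unfolding pos_divide_le_eq[OF less_le_trans[OF zero_less_one pos[of s]]]
      using mult_left_mono[OF pos[of s], of "2 * \<alpha>"] assms(1) by linarith
    moreover have "0 \<le> 2 * \<alpha> / (1 + (\<eta> * s)\<^sup>2)"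
      using assms(1) by (intro divide_nonneg_pos less_le_trans[OF zero_less_one pos]) simp
    ultimately have "\<bar>2 * \<alpha> / (1 + (\<eta> * s)\<^sup>2)\<bar> \<le> 2 * \<alpha>" by linarith
    then show ?thesis unfolding w'_def w_def abs_mult abs_exp_cancel by (rule mult_right_mono) simp
  qed
  show "\<bar>w' s\<bar> \<le> 2 * \<alpha> * w s" for s by (rule le)
  show "bounded_C1 w w' (exp (\<alpha> * pi / \<eta>)) (2 * \<alpha> * exp (\<alpha> * pi / \<eta>))"
  proof
    show "DERIV w s :> w' s" for s
    proof -
      have "DERIV (\<lambda>s. arctan (\<eta> * s)) s :> inverse (1 + (\<eta> * s)\<^sup>2) * \<eta>"
        by (rule DERIV_chain2[OF DERIV_arctan]) (auto intro!: derivative_eq_intros)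
      from DERIV_cmult[OF DERIV_cdivide[OF this, of \<eta>], of "2 * \<alpha>"]
      have "DERIV (\<lambda>s. 2 * \<alpha> * (arctan (\<eta> * s) / \<eta>)) s :> 2 * \<alpha> / (1 + (\<eta> * s)\<^sup>2)"
        using assms(2) by (simp add: divide_inverse[of "2 * \<alpha>"])
      from DERIV_fun_exp[OF this] show ?thesis by (simp add: w_def w'_def mult.commute)
    qed
    have "1 + (\<eta> * s)\<^sup>2 \<noteq> 0" for s using pos[of s] by linarith
    then show "continuous_on UNIV w'"
      unfolding w'_def using assms(2) by (intro continuous_intros) auto
    show "\<bar>w s\<bar> \<le> exp (\<alpha> * pi / \<eta>)" for s by (rule w)
    show "\<bar>w' s\<bar> \<le> 2 * \<alpha> * exp (\<alpha> * pi / \<eta>)" for s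
      using order_trans[OF le[of s] mult_left_mono[OF order_trans[OF abs_ge_self w[of s]], of "2 * \<alpha>"]] assms(1)
      by simp
  qed
qed

text \<open>The bounded substitute for the identity must still separate the levels \<open>b\<close>
  and \<open>c\<close> by more than \<open>d\<close>, which will be the distance travelled. It does
  for small \<eta>, because arctan has slope 1 at 0.\<close>

lemma arctan_slope:
  fixes b c d :: real
  assumes "d < b - c"
  obtains \<eta> where "\<eta> > 0" "d < arctan (\<eta> * b) / \<eta> - arctan (\<eta> * c) / \<eta>"
proof -
  have D: "((\<lambda>h. arctan (h * x) / h) \<longlongrightarrow> x) (at 0)" for x :: real
  proof -
    have "DERIV (\<lambda>h. arctan (h * x)) 0 :> x" by (auto intro!: derivative_eq_intros)
    then show ?thesis by (simp add: has_field_derivative_iff)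
  qed
  have "\<forall>\<^sub>F h in at 0. d < arctan (h * b) / h - arctan (h * c) / h"
    by (rule order_tendstoD(1)[OF tendsto_diff[OF D D] assms])
  then obtain r where r: "r > 0" "\<And>h. h \<noteq> 0 \<Longrightarrow> \<bar>h\<bar> < r \<Longrightarrow> d < arctan (h * b) / h - arctan (h * c) / h"
    unfolding eventually_at by (auto simp: dist_real_def)
  show thesis by (rule that[of "r / 2"]) (use r(1) r(2)[of "r / 2"] in auto)
qed

section \<open>From half-spaces to balls and closed sets\<close>

context dirac_group
begin

text \<open>\<eta> is fixed with g b - g c > \<kappa> |t|. The weight is at least exp (2 \<alpha> g
  b) where mass is to be excluded and at most exp (2 \<alpha> g c) where \<open>u\<close> lives, so
  for large \<alpha> the growth factor exp (2 \<alpha> \<kappa> |t|) cannot make up the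
  difference.\<close>

lemma U_vanishes_half_space_closed:
  assumes l: "bounded_linear l" "\<And>x. \<bar>l x\<bar> \<le> norm x"
    and u: "u \<in> L2 \<mu>" "AE x in \<mu>. c < l x \<longrightarrow> u x = 0"
    and b: "c + onorm iH * \<bar>t\<bar> < b"
  shows "AE x in \<mu>. b \<le> l x \<longrightarrow> U t u x = 0"
proof -
  let ?\<kappa> = "onorm iH"
  have "?\<kappa> * \<bar>t\<bar> < b - c" using b by simp
  then obtain \<eta> where \<eta>: "\<eta> > 0" "?\<kappa> * \<bar>t\<bar> < arctan (\<eta> * b) / \<eta> - arctan (\<eta> * c) / \<eta>"
    by (rule arctan_slope)
  define g where "g s = arctan (\<eta> * s) / \<eta>" for s
  have g_mono: "g r \<le> g s" if "r \<le> s" for r s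
    unfolding g_def using that \<eta>(1) by (intro divide_right_mono arctan_monotone') (auto intro: mult_left_mono)
  define \<delta> where "\<delta> = g b - g c - ?\<kappa> * \<bar>t\<bar>"
  have \<delta>: "\<delta> > 0" using \<eta>(2) by (simp add: \<delta>_def g_def)
  have n2: "integrable \<mu> (\<lambda>x. (norm (u x))\<^sup>2)" "integrable \<mu> (\<lambda>x. (norm (U t u x))\<^sup>2)"
    using V.L2_norm2[OF u(1)] V.L2_norm2[OF U_L2[OF u(1)]] .
  have lm: "l \<in> borel_measurable \<mu>"
    using measurable_of_functional[OF l(1), of "\<lambda>s. s"] by simp
  define m where "m = (LINT x|\<mu>. indicator {b..} (l x) * (norm (U t u x))\<^sup>2)"
  define N where "N = (LINT x|\<mu>. (norm (u x))\<^sup>2)"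
  have im: "integrable \<mu> (\<lambda>x. indicator {b..} (l x) * (norm (U t u x))\<^sup>2)"
  proof (rule Bochner_Integration.integrable_bound[OF n2(2)])
    have "(\<lambda>x. indicator {b..} (l x) :: real) \<in> borel_measurable \<mu>"
      by (rule measurable_compose[OF lm]) simp
    then show "(\<lambda>x. indicator {b..} (l x) * (norm (U t u x))\<^sup>2) \<in> borel_measurable \<mu>"
      using n2(2) by (intro borel_measurable_times) auto
  qed (auto simp: indicator_def)
  have key: "exp (2 * \<alpha> * \<delta>) * m \<le> N" if \<alpha>: "\<alpha> \<ge> 0" for \<alpha>
  proof -
    let ?w = "\<lambda>s. exp (2 * \<alpha> * g s)"
    let ?w' = "\<lambda>s. 2 * \<alpha> / (1 + (\<eta> * s)\<^sup>2) * exp (2 * \<alpha> * g s)"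
    note W0 = arctan_weight[OF \<alpha> \<eta>(1), folded g_def]
    interpret W: weighted_embedding \<mu> iH DH ?w ?w' "exp (\<alpha> * pi / \<eta>)" "2 * \<alpha> * exp (\<alpha> * pi / \<eta>)" l
      by (intro weighted_embedding.intro weighted_embedding_axioms.intro hilbert_embedding_axioms W0(1) l)
    have c: "?\<kappa> * \<bar>?w' s\<bar> \<le> 2 * (\<alpha> * ?\<kappa>) * ?w s" for s
      using mult_left_mono[OF W0(2)[of s] onorm_pos_le[OF iH]] by (simp add: mult_ac)
    have iw: "integrable \<mu> (\<lambda>x. ?w (l x) * (norm (v x))\<^sup>2)" if "v \<in> L2 \<mu>" for v :: "'e \<Rightarrow> complex \<times> ('h \<times> 'h)"
      using V.integrable_inner[OF V.L2_scaleR[OF W.weight_measurable(1) W.bound_w that] that]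
      by (simp add: power2_norm_eq_inner)
    have "exp (2 * \<alpha> * g b) * m = (LINT x|\<mu>. exp (2 * \<alpha> * g b) * (indicator {b..} (l x) * (norm (U t u x))\<^sup>2))"
      by (simp add: m_def)
    also have "\<dots> \<le> (LINT x|\<mu>. ?w (l x) * (norm (U t u x))\<^sup>2)"
    proof (rule integral_mono[OF integrable_mult_right[OF im] iw[OF U_L2[OF u(1)]]])
      show "exp (2 * \<alpha> * g b) * (indicator {b..} (l x) * (norm (U t u x))\<^sup>2) \<le> ?w (l x) * (norm (U t u x))\<^sup>2" for x
        using g_mono[of b "l x"] \<alpha> by (auto simp: indicator_def intro!: mult_right_mono mult_left_mono)
    qed
    also have "\<dots> \<le> exp (2 * (\<alpha> * ?\<kappa>) * \<bar>t\<bar>) * (LINT x|\<mu>. ?w (l x) * (norm (u x))\<^sup>2)"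
      by (rule energy_gronwall[OF W.weighted_embedding_axioms c u(1)])
    also have "(LINT x|\<mu>. ?w (l x) * (norm (u x))\<^sup>2) \<le> (LINT x|\<mu>. exp (2 * \<alpha> * g c) * (norm (u x))\<^sup>2)"
    proof (rule integral_mono_AE[OF iw[OF u(1)]])
      show "integrable \<mu> (\<lambda>x. exp (2 * \<alpha> * g c) * (norm (u x))\<^sup>2)" using n2(1) by simp
      show "AE x in \<mu>. ?w (l x) * (norm (u x))\<^sup>2 \<le> exp (2 * \<alpha> * g c) * (norm (u x))\<^sup>2"
        using u(2)
      proof eventually_elim
        case (elim x)
        show ?case
        proof (cases "c < l x")
          case False
          then show ?thesis using g_mono[of "l x" c] \<alpha> by (intro mult_right_mono) (auto intro: mult_left_mono)
        qed (use elim in simp)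
      qed
    qed
    also have "\<dots> = exp (2 * \<alpha> * g c) * N" by (simp add: N_def)
    finally have "exp (2 * \<alpha> * g b) * m \<le> exp (2 * (\<alpha> * ?\<kappa>) * \<bar>t\<bar> + 2 * \<alpha> * g c) * N"
      by (simp add: exp_add mult.assoc)
    moreover have "2 * \<alpha> * g b = 2 * \<alpha> * \<delta> + (2 * (\<alpha> * ?\<kappa>) * \<bar>t\<bar> + 2 * \<alpha> * g c)"
      by (simp add: \<delta>_def algebra_simps)
    ultimately show ?thesis by (simp add: exp_add mult.commute mult.left_commute)
  qed
  have m0: "m \<ge> 0" unfolding m_def by (rule Bochner_Integration.integral_nonneg) simp
  have N0: "N \<ge> 0" unfolding N_def by (rule Bochner_Integration.integral_nonneg) simp
  have "m = 0"
  proof (rule ccontr)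
    assume "m \<noteq> 0"
    then have m: "m > 0" using m0 by simp
    \<comment> \<open>Chosen so that 2 \<alpha> \<delta> m = N; then exp x \<ge> 1 + x already gives
      N + m \<le> N.\<close>
    define \<alpha> where "\<alpha> = N / (2 * \<delta> * m)"
    have "N + m = (1 + 2 * \<alpha> * \<delta>) * m" using \<delta> m by (simp add: \<alpha>_def field_simps)
    also have "\<dots> \<le> exp (2 * \<alpha> * \<delta>) * m" using m by (intro mult_right_mono exp_ge_add_one_self) auto
    also have "\<dots> \<le> N" using N0 \<delta> m by (intro key) (simp add: \<alpha>_def)
    finally show False using m by simp
  qed
  then have "AE x in \<mu>. indicator {b..} (l x) * (norm (U t u x))\<^sup>2 = 0"
    unfolding m_def using integral_nonneg_eq_0_iff_AE[OF im] by simp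
  then show ?thesis by eventually_elim (auto simp: indicator_def split: if_splits)
qed

lemma U_vanishes_half_space:
  assumes l: "bounded_linear l" "\<And>x. \<bar>l x\<bar> \<le> norm x"
    and u: "u \<in> L2 \<mu>" "AE x in \<mu>. c < l x \<longrightarrow> u x = 0"
  shows "AE x in \<mu>. c + onorm iH * \<bar>t\<bar> < l x \<longrightarrow> U t u x = 0"
proof -
  let ?b = "\<lambda>n. c + onorm iH * \<bar>t\<bar> + 1 / real (Suc n)"
  have "AE x in \<mu>. \<forall>n. ?b n \<le> l x \<longrightarrow> U t u x = 0"
    unfolding AE_all_countable by (intro allI U_vanishes_half_space_closed[OF l u]) simp
  then show ?thesis
  proof eventually_elim
    case (elim x)
    show ?case
    proof
      assume "c + onorm iH * \<bar>t\<bar> < l x"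
      then obtain n where "1 / real (Suc n) < l x - (c + onorm iH * \<bar>t\<bar>)"
        using nat_approx_posE[of "l x - (c + onorm iH * \<bar>t\<bar>)"] by auto
      then show "U t u x = 0" using elim[rule_format, of n] by simp
    qed
  qed
qed

text \<open>The outside of the ball is an uncountable union of open half-spaces, and null sets do
  not add up over it. Each half-space only removes its points from the support;
  \<open>AE_zero_off_l2supp\<close> turns this back into a statement almost everywhere.\<close>

lemma U_vanishes_off_ball:
  assumes radon: "radon_measure \<mu>"
    and u: "u \<in> L2 \<mu>" "\<And>x. x \<notin> ball a r \<Longrightarrow> u x = 0"
  shows "AE x in \<mu>. r + onorm iH * \<bar>t\<bar> < dist a x \<longrightarrow> U t u x = 0"
proof -
  have "p \<notin> l2supp \<mu> (U t u)" if p: "r + onorm iH * \<bar>t\<bar> < dist a p" for p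
  proof -
    obtain l where l: "bounded_linear l" "\<And>x. \<bar>l x\<bar> \<le> norm x" "l (p - a) = norm (p - a)"
      using norming_functional[of "p - a"] by blast
    have diff: "l (x - a) = l x - l a" for x
      using l(1) by (intro linear_diff bounded_linear.linear)
    have "u x = 0" if "r + l a < l x" for x
    proof -
      have "r < norm (x - a)" using that l(2)[of "x - a"] diff[of x] by linarith
      then show ?thesis by (intro u(2)) (simp add: dist_norm norm_minus_commute)
    qed
    then have "AE x in \<mu>. r + l a + onorm iH * \<bar>t\<bar> < l x \<longrightarrow> U t u x = 0"
      by (intro U_vanishes_half_space l u(1)) auto
    then have "AE x in \<mu>. x \<in> {x. r + l a + onorm iH * \<bar>t\<bar> < l x} \<longrightarrow> U t u x = 0" by simp
    moreover have "open {x. r + l a + onorm iH * \<bar>t\<bar> < l x}"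
      using l(1) by (intro open_Collect_less continuous_on_const linear_continuous_on)
    moreover have "p \<in> {x. r + l a + onorm iH * \<bar>t\<bar> < l x}"
      using p l(3) diff[of p] by (simp add: dist_norm norm_minus_commute)
    ultimately show ?thesis unfolding l2supp_def by blast
  qed
  then show ?thesis
    using AE_zero_off_l2supp[OF sets_\<mu> radon V.L2_measurable[OF U_L2[OF u(1), of t]]]
    by (auto elim!: eventually_mono)
qed

theorem speed_of_propagation:
  assumes radon: "radon_measure \<mu>"
  shows "speed_of_propagation \<mu> U (onorm iH)"
  unfolding speed_of_propagation_def
proof (intro allI impI subsetI CollectI, rule ccontr)
  fix K u t a
  assume u: "u \<in> L2 \<mu>" and K: "l2supp \<mu> u \<subseteq> K" and a: "a \<in> l2supp \<mu> (U t u)"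
    and "\<not> infdist a K \<le> onorm iH * \<bar>t\<bar>"
  \<comment> \<open>Half of the gap, so that the ball of radius \<open>r\<close> around
    \<open>a\<close>, enlarged by \<kappa> |t|, still stays away from \<open>K\<close>.\<close>
  define r where "r = (infdist a K - onorm iH * \<bar>t\<bar>) / 2"
  have r: "r > 0" "r + onorm iH * \<bar>- t\<bar> < infdist a K"
    using \<open>\<not> _\<close> by (auto simp: r_def field_simps)
  \<comment> \<open>With this test function the pairing with \<open>U t u\<close> is the energy of
    \<open>U t u\<close> in the ball.\<close>
  define z where "z x = (indicator (ball a r) x :: real) *\<^sub>R U t u x" for x
  have z: "z \<in> L2 \<mu>"
    unfolding z_def[abs_def]
  proof (rule V.L2_scaleR[of _ 1, OF _ _ U_L2[OF u]])
    show "(\<lambda>x. indicator (ball a r) x :: real) \<in> borel_measurable \<mu>"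
      by (intro borel_measurable_indicator) (simp add: sets_\<mu>)
  qed (simp add: indicator_def)
  have z_off: "z x = 0" if "x \<notin> ball a r" for x using that by (simp add: z_def)
  have off: "AE x in \<mu>. r + onorm iH * \<bar>- t\<bar> < dist a x \<longrightarrow> U (- t) z x = 0"
    by (rule U_vanishes_off_ball[OF radon z z_off])
  have "AE x in \<mu>. inner (u x) (U (- t) z x) = 0"
    using AE_zero_off_l2supp[OF sets_\<mu> radon V.L2_measurable[OF u]]
      off
  proof eventually_elim
    case (elim x)
    show ?case
    proof (cases "x \<in> K")
      case True
      then have "r + onorm iH * \<bar>- t\<bar> < dist a x" using r(2) infdist_le[OF True, of a] by simp
      then show ?thesis using elim(2) by (simp add: z_def)
    qed (use elim(1) K in auto)
  qed
  then have "(LINT x|\<mu>. inner (u x) (U (- t) z x)) = 0" by (rule integral_eq_zero_AE)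
  then have "(LINT x|\<mu>. inner (U t u x) (z x)) = 0" using G.U_adjoint[OF u z] by simp
  moreover have "inner (U t u x) (z x) = inner (z x) (z x)" for x
    by (simp add: z_def indicator_def)
  ultimately have "AE x in \<mu>. inner (z x) (z x) = 0"
    using integral_nonneg_eq_0_iff_AE[OF V.integrable_inner[OF z z]] by simp
  then have "AE x in \<mu>. x \<in> ball a r \<longrightarrow> U t u x = 0"
    by eventually_elim (auto simp: z_def)
  then have "a \<notin> l2supp \<mu> (U t u)" unfolding l2supp_def using r(1) by (auto intro!: exI[of _ "ball a r"])
  then show False using a by simp
qed

end

theorem theorem5p4:
  fixes iH :: "'h::{real_inner, complete_space} \<Rightarrow> 'e::banach"
    and S :: "real \<Rightarrow> 'e \<Rightarrow> 'e"
    and \<mu> :: "'e measure"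
    and U :: "real \<Rightarrow> ('e \<Rightarrow> complex \<times> ('h \<times> 'h)) \<Rightarrow> ('e \<Rightarrow> complex \<times> ('h \<times> 'h))"
  assumes "bounded_linear iH" and "inj iH"
    and "C0_semigroup S"
    and "A1 iH S \<mu>"
    and "A3 iH \<mu>"
    and "OU_selfadjoint iH S \<mu>"
    and "unitary_group_generated_by \<mu> (Dirac iH \<mu>) U"
  shows "speed_of_propagation \<mu> U (onorm iH)"
proof -
  have \<mu>: "prob_space \<mu>" "sets \<mu> = sets borel" "radon_measure \<mu>"
    using assms(4) by (auto simp: A1_def centred_gaussian_def)
  obtain DH :: "'h set" where DH: "countable DH" "closure DH = UNIV"
    by (rule separable_H[OF assms(1,2,5) \<mu>])
  interpret dirac_group \<mu> iH DH U
    using \<mu> assms(1,7) DH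
    by (intro dirac_group.intro hilbert_embedding.intro hilbert_embedding_axioms.intro dirac_group_axioms.intro)
  show ?thesis by (rule speed_of_propagation[OF \<mu>(3)])
qed

end
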